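(* Let $L>0$ and suppose $g(x,y)=g(x)$ for some $g\in L^2(0,L;\mathbb{C})$. Then the control system $$u_t(t,x)-u_x(t,x)=\int_0^L g(x)u(t,y)\,dy,\quad u(t,L)=U(t),\quad u(0,x)=u^0(x)$$ is exactly controllable at time $L$ if and only if $\ker(\lambda-A^* )\cap\ker B^*=\{0\}$ for every $\lambda\in\mathbb{C}$.
   Context: For $T>0$, $u^0\in L^2(0,L)$, $U\in L^2(0,T)$, the (weak) solution is the unique $u\in C^0([0,T];L^2(0,L))$ such that for every $\tau\in[0,T]$ and every $\phi\in C^1([0,\tau]\times[0,L])$ with $\phi(\cdot,0)=0$, $$\int_0^\tau\!\!\int_0^L u\,\overline{\Big(-\phi_t+\phi_x-\int_0^L\overline{g(y)}\phi(t,y)dy\Big)}\,dx\,dt+\int_0^L u(\tau)\overline{\phi(\tau)}dx-\int_0^L u^0\overline{\phi(0)}dx-\int_0^\tau U(t)\overline{\phi(t,L)}dt=0.$$ Exact controllability at time $T$: for all $u^0,u^1\in L^2(0,L)$ there is $U\in L^2(0,T)$ with $u(T)=u^1$. $A^*$ is the operator on $L^2(0,L)$ with domain $D(A^* )=\{z\in H^1(0,L): z(0)=0\}$ and $A^*z(x)=-z'(x)+\int_0^L\overline{g(y)}z(y)\,dy$; $B^*:D(A^* )\to\mathbb{C}$ is $B^*z=z(L)$. *)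

theory Defs
  imports "HOL-Analysis.Analysis"
begin

definition intL :: "real set \<Rightarrow> (real \<Rightarrow> 'b::{banach,second_countable_topology}) \<Rightarrow> 'b" where
  "intL S f = integral\<^sup>L (lebesgue_on S) f"

definition L2 :: "real set \<Rightarrow> (real \<Rightarrow> complex) \<Rightarrow> bool" where
  "L2 S f \<longleftrightarrow> f \<in> borel_measurable (lebesgue_on S)
      \<and> integrable (lebesgue_on S) (\<lambda>x. (cmod (f x))^2)"

definition C0_L2 :: "real \<Rightarrow> real \<Rightarrow> (real \<Rightarrow> real \<Rightarrow> complex) \<Rightarrow> bool" where
  "C0_L2 T L u \<longleftrightarrow> (\<forall>t\<in>{0..T}. L2 {0..L} (u t)) \<and>
     (\<forall>t0\<in>{0..T}. ((\<lambda>t. intL {0..L} (\<lambda>x. (cmod (u t x - u t0 x))^2)) \<longlongrightarrow> 0)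
                       (at t0 within {0..T}))"

definition C1_rect :: "real \<Rightarrow> real \<Rightarrow> (real \<Rightarrow> real \<Rightarrow> complex) \<Rightarrow>
    (real \<Rightarrow> real \<Rightarrow> complex) \<Rightarrow> (real \<Rightarrow> real \<Rightarrow> complex) \<Rightarrow> bool" where
  "C1_rect \<tau> L \<phi> \<phi>t \<phi>x \<longleftrightarrow>
     continuous_on ({0..\<tau>} \<times> {0..L}) (\<lambda>(t,x). \<phi> t x) \<and>
     continuous_on ({0..\<tau>} \<times> {0..L}) (\<lambda>(t,x). \<phi>t t x) \<and>
     continuous_on ({0..\<tau>} \<times> {0..L}) (\<lambda>(t,x). \<phi>x t x) \<and>
     (\<forall>t\<in>{0..\<tau>}. \<forall>x\<in>{0..L}.
        ((\<lambda>s. \<phi> s x) has_vector_derivative \<phi>t t x) (at t within {0..\<tau>}) \<and>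
        ((\<lambda>y. \<phi> t y) has_vector_derivative \<phi>x t x) (at x within {0..L}))"

text \<open>Weak solution of u_t - u_x = int_0^L g(x) u(t,y) dy, u(t,L) = U(t), u(0) = u0.\<close>
definition weak_solution :: "real \<Rightarrow> (real \<Rightarrow> complex) \<Rightarrow> real \<Rightarrow> (real \<Rightarrow> complex) \<Rightarrow>
    (real \<Rightarrow> complex) \<Rightarrow> (real \<Rightarrow> real \<Rightarrow> complex) \<Rightarrow> bool" where
  "weak_solution L g T u0 U u \<longleftrightarrow> C0_L2 T L u \<and>
     (\<forall>\<tau>\<in>{0..T}. \<forall>\<phi> \<phi>t \<phi>x. C1_rect \<tau> L \<phi> \<phi>t \<phi>x \<and> (\<forall>t\<in>{0..\<tau>}. \<phi> t 0 = 0) \<longrightarrow>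
        intL {0..\<tau>} (\<lambda>t. intL {0..L} (\<lambda>x. u t x *
            cnj (- \<phi>t t x + \<phi>x t x - intL {0..L} (\<lambda>y. cnj (g y) * \<phi> t y))))
        + intL {0..L} (\<lambda>x. u \<tau> x * cnj (\<phi> \<tau> x))
        - intL {0..L} (\<lambda>x. u0 x * cnj (\<phi> 0 x))
        - intL {0..\<tau>} (\<lambda>t. U t * cnj (\<phi> t L)) = 0)"

definition exactly_controllable :: "real \<Rightarrow> (real \<Rightarrow> complex) \<Rightarrow> real \<Rightarrow> bool" where
  "exactly_controllable L g T \<longleftrightarrow>
     (\<forall>u0 u1. L2 {0..L} u0 \<and> L2 {0..L} u1 \<longrightarrow>
        (\<exists>U u. L2 {0..T} U \<and> weak_solution L g T u0 U u \<and>
               (AE x in lebesgue_on {0..L}. u T x = u1 x)))"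

text \<open>z \<in> H^1(0,L), z its continuous representative, z' its weak derivative (in L^2).\<close>
definition H1_with_deriv :: "real \<Rightarrow> (real \<Rightarrow> complex) \<Rightarrow> (real \<Rightarrow> complex) \<Rightarrow> bool" where
  "H1_with_deriv L z z' \<longleftrightarrow> L2 {0..L} z' \<and>
     (\<forall>x\<in>{0..L}. z x = z 0 + intL {0..x} z')"

text \<open>z \<in> D(A*), and A* z = w in L^2(0,L), where A* z = -z' + int_0^L conj(g y) z(y) dy.\<close>
definition Astar_eq :: "real \<Rightarrow> (real \<Rightarrow> complex) \<Rightarrow> (real \<Rightarrow> complex) \<Rightarrow> (real \<Rightarrow> complex) \<Rightarrow> bool" where
  "Astar_eq L g z w \<longleftrightarrow> z 0 = 0 \<and> (\<exists>z'. H1_with_deriv L z z' \<and>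
     (AE x in lebesgue_on {0..L}. - z' x + intL {0..L} (\<lambda>y. cnj (g y) * z y) = w x))"

end

theory Submission
  imports Defs
begin

text \<open>
  Necessity: an eigenfunction \<open>z\<close> of \<open>A*\<close> with \<open>z(L) = 0\<close> is \<open>C\<^sup>1\<close>, and testing the weak formulation
  with \<open>exp (- \<lambda> t) z(x)\<close> shows that the pairing of the final state with \<open>z\<close> is determined by the initial state.

  Sufficiency: write \<open>m(t)\<close> for the integral of \<open>u(t)\<close> over \<open>[0,L]\<close>. Solving along characteristics and
  imposing \<open>u(L) = u1\<close> expresses \<open>U\<close> in terms of \<open>m\<close>, and integrating \<open>u(t)\<close> over \<open>[0,L]\<close> leaves
  one integral equation for \<open>m\<close>. With \<open>G(r)\<close> the integral of \<open>g\<close> over \<open>[r,L]\<close>, extended periodically,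
  it reads \<open>m = f + G * m - (G * m)(0)\<close>, where \<open>*\<close> is convolution on the circle of length \<open>L\<close> and \<open>f\<close>
  depends on \<open>u0\<close> and \<open>u1\<close>. It is diagonal in the Fourier basis up to the constant mode, hence
  solvable as soon as no Fourier coefficient of \<open>G\<close> with index \<open>k \<noteq> 0\<close> is resonant; a resonance at
  \<open>k\<close> yields the eigenfunction \<open>z\<close> with derivative \<open>exp (2 \<pi> i k x / L)\<close>, \<open>z(0) = z(L) = 0\<close>.\<close>

section \<open>Square-integrable functions on an interval\<close>

text \<open>A characteristic \<open>x + t = r\<close> crosses the interval in time exactly
  \<open>L\<close>, so at time \<open>L\<close> all transported traces of \<open>u0\<close> have
  left, and each value of the final state is one value of the control plus the contribution of the
  source. Hence \<open>m\<close> and the target determine \<open>U\<close>; the difficulty is that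
  \<open>m\<close> must also be the mean of the solution it produces. The circle arises here: the
  source up to time \<open>t\<close> gives the Volterra part of the convolution (\<open>s\<close>
  from \<open>0\<close> to \<open>t\<close>), and the correction of \<open>U\<close> by the source
  at time \<open>L\<close> gives the wrapped part (\<open>s\<close> from \<open>t\<close> to
  \<open>L\<close>) and the constant \<open>(G * m)(0)\<close>. The operator
  \<open>m - G * m + (G * m)(0)\<close> fixes constants, so only modes with
  \<open>k \<noteq> 0\<close> can obstruct. Resonance and eigenfunction match by Fubini: the
  coefficient of \<open>G\<close> at \<open>k\<close> is the integral of \<open>g\<close> against
  the primitive of a mode, and this primitive vanishes at both ends because the mode has mean zero.
  Since \<open>G 0\<close> and \<open>G L\<close> may differ, the periodic kernel can jump, which is
  why it is approximated in \<open>L\<^sup>1\<close> and not uniformly.\<close>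

lemma integrable_indicator_Icc [simp, intro]: "integrable lborel (indicat_real {a..(b::real)})"
  by (cases "a \<le> b") auto

text \<open>The problem is posed with \<open>lebesgue_on\<close>, but Fubini and the measurability
  arguments run over \<open>lborel\<close>. For a Borel integrand, completing the measure does not
  change the integral.\<close>

lemma intL_eq_lborel:
  fixes f :: "real \<Rightarrow> 'b::{banach,second_countable_topology}"
  assumes "(\<lambda>x. indicator S x *\<^sub>R f x) \<in> borel_measurable borel" "S \<in> sets borel"
  shows "intL S f = (LINT x:S|lborel. f x)"
proof -
  have "intL S f = integral\<^sup>L lebesgue (\<lambda>x. indicator S x *\<^sub>R f x)"
    unfolding intL_def using assms(2) by (subst integral_restrict_space) (auto simp: sets_completionI_sets)
  also have "\<dots> = (LINT x:S|lborel. f x)"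
    unfolding set_lebesgue_integral_def by (rule integral_completion) (use assms(1) in simp)
  finally show ?thesis .
qed

lemma L2_iff_lborel:
  assumes [measurable]: "f \<in> borel_measurable borel"
  shows "L2 {a..b} f \<longleftrightarrow> set_integrable lborel {a..b} (\<lambda>x. (cmod (f x))^2)"
proof -
  have "f \<in> borel_measurable (lebesgue_on {a..b})"
    by (intro measurable_restrict_space1 measurable_completion) simp
  then show ?thesis
    unfolding L2_def set_integrable_def
    by (subst integrable_restrict_space) (auto simp: integrable_completion)
qed

lemma completion_ex_borel_measurable_complex:
  fixes f :: "'a \<Rightarrow> complex"
  assumes "f \<in> borel_measurable (completion M)"
  shows "\<exists>g\<in>borel_measurable M. AE x in M. f x = g x"
proof -
  obtain p where p: "p \<in> borel_measurable M" "AE x in M. Re (f x) = p x"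
    using completion_ex_borel_measurable_real[of "\<lambda>x. Re (f x)" M] assms by auto
  obtain q where q: "q \<in> borel_measurable M" "AE x in M. Im (f x) = q x"
    using completion_ex_borel_measurable_real[of "\<lambda>x. Im (f x)" M] assms by auto
  have "AE x in M. f x = Complex (p x) (q x)"
    using p(2) q(2) by eventually_elim (simp add: complex_eq_iff)
  moreover have "(\<lambda>x. Complex (p x) (q x)) \<in> borel_measurable M"
    unfolding Complex_eq using p(1) q(1) by measurable
  ultimately show ?thesis by (rule bexI)
qed

text \<open>A Borel function that vanishes off the interval can be translated freely, so later
  formulas need no case distinctions. Integrability follows from \<open>|z| \<le> 1 + |z|^2\<close>
  on a bounded interval.\<close>

lemma L2_borel_representative:
  fixes f :: "real \<Rightarrow> complex"
  assumes "L2 {a..b} f"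
  obtains g where "g \<in> borel_measurable borel" "\<And>x. x \<notin> {a..b} \<Longrightarrow> g x = 0"
    "AE x in lebesgue_on {a..b}. f x = g x" "integrable lborel (\<lambda>x. (cmod (g x))^2)"
    "integrable lborel g"
proof -
  have m: "(\<lambda>x. indicator {a..b} x *\<^sub>R f x) \<in> borel_measurable lebesgue"
    using assms unfolding L2_def by (subst (asm) borel_measurable_restrict_space_iff) auto
  obtain g0 where g0 [measurable]: "g0 \<in> borel_measurable borel"
    and ae: "AE x in lborel. indicator {a..b} x *\<^sub>R f x = g0 x"
    using completion_ex_borel_measurable_complex[OF m] by auto
  define g where "g x = indicator {a..b} x *\<^sub>R g0 x" for x
  have gm [measurable]: "g \<in> borel_measurable borel"
    unfolding g_def by measurable
  have aeg: "AE x in lebesgue. x \<in> {a..b} \<longrightarrow> f x = g x"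
    using AE_completion[OF ae] by eventually_elim (auto simp: g_def)
  have ae': "AE x in lebesgue_on {a..b}. f x = g x"
    by (subst AE_restrict_space_iff) (use aeg in auto)
  have "integrable (lebesgue_on {a..b}) (\<lambda>x. (cmod (g x))^2)"
  proof (rule integrable_cong_AE_imp)
    show "integrable (lebesgue_on {a..b}) (\<lambda>x. (cmod (f x))^2)"
      using assms by (simp add: L2_def)
    show "AE x in lebesgue_on {a..b}. (cmod (f x))\<^sup>2 = (cmod (g x))\<^sup>2"
      using ae' by eventually_elim simp
    show "(\<lambda>x. (cmod (g x))^2) \<in> borel_measurable (lebesgue_on {a..b})"
      by (intro measurable_restrict_space1 measurable_completion) simp
  qed
  then have "integrable lebesgue (\<lambda>x. indicator {a..b} x *\<^sub>R (cmod (g x))^2)"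
    by (subst (asm) integrable_restrict_space) auto
  then have "integrable lborel (\<lambda>x. indicator {a..b} x *\<^sub>R (cmod (g x))^2)"
    by (subst (asm) integrable_completion) auto
  moreover have "indicator {a..b} x *\<^sub>R (cmod (g x))^2 = (cmod (g x))^2" for x
    by (auto simp: g_def indicator_def)
  ultimately have i2: "integrable lborel (\<lambda>x. (cmod (g x))^2)" by (simp only:)
  have "integrable lborel (\<lambda>x. indicat_real {a..b} x + (cmod (g x))^2)"
    using i2 by (intro Bochner_Integration.integrable_add) auto
  then have i1: "integrable lborel g"
  proof (rule Bochner_Integration.integrable_bound)
    have "cmod z \<le> 1 + (cmod z)^2" for z
      using zero_le_power2[of "cmod z - 1/2"] by (simp add: power2_diff field_simps)
    then show "AE x in lborel. cmod (g x) \<le> norm (indicat_real {a..b} x + (cmod (g x))\<^sup>2)"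
      by (intro AE_I2) (auto simp: g_def indicator_def)
  qed simp
  show thesis by (rule that[OF gm _ ae' i2 i1]) (simp add: g_def)
qed

text \<open>Every exchange of integrals below has this shape: the outer variable lives in a bounded
  interval and the inner \<open>L\<^sup>1\<close> norms are uniformly bounded, which together give
  integrability on the plane.\<close>

lemma lborel_Fubini_bounded:
  fixes f :: "real \<Rightarrow> real \<Rightarrow> complex"
  assumes [measurable]: "case_prod f \<in> borel_measurable (lborel \<Otimes>\<^sub>M lborel)"
    and int: "\<And>x. integrable lborel (f x)"
    and supp: "\<And>x y. x \<notin> {a..b} \<Longrightarrow> f x y = 0"
    and bd: "\<And>x. (LINT y|lborel. cmod (f x y)) \<le> C"
  shows "(LINT x|lborel. LINT y|lborel. f x y) = (LINT y|lborel. LINT x|lborel. f x y)"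
proof -
  have *: "integrable (lborel \<Otimes>\<^sub>M lborel) (case_prod f)"
  proof (rule lborel_pair.Fubini_integrable)
    show "integrable lborel (\<lambda>x. LINT y|lborel. norm (case (x, y) of (x, y) \<Rightarrow> f x y))"
    proof (rule Bochner_Integration.integrable_bound[of _ "\<lambda>x. C * indicat_real {a..b} x"])
      show "AE x in lborel. norm (LINT y|lborel. norm (case (x, y) of (x, y) \<Rightarrow> f x y))
          \<le> norm (C * indicat_real {a..b} x)"
      proof (intro AE_I2)
        fix x
        have "0 \<le> (LINT y|lborel. cmod (f x y))" by (rule Bochner_Integration.integral_nonneg) simp
        then show "norm (LINT y|lborel. norm (case (x, y) of (x, y) \<Rightarrow> f x y))
          \<le> norm (C * indicat_real {a..b} x)"
          using bd[of x] supp[of x] by (cases "x \<in> {a..b}") auto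
      qed
    qed (auto intro!: integrable_mult_right integrable_indicator_Icc)
  qed (use int in auto)
  show "(LINT x|lborel. LINT y|lborel. f x y) = (LINT y|lborel. LINT x|lborel. f x y)"
    using lborel_pair.Fubini_integral[OF *] by simp
qed

lemma lborel_integral_shift:
  fixes f :: "real \<Rightarrow> 'a :: {banach, second_countable_topology}"
  shows "(LINT x|lborel. f (x + t)) = (LINT x|lborel. f x)"
    and "(LINT x|lborel. f (t - x)) = (LINT x|lborel. f x)"
proof -
  show "(LINT x|lborel. f (x + t)) = (LINT x|lborel. f x)"
    by (subst lborel_integral_real_affine[of 1 f t], simp, simp add: add.commute)
  show "(LINT x|lborel. f (t - x)) = (LINT x|lborel. f x)"
    by (subst lborel_integral_real_affine[of "-1" f t], simp, simp)
qed

lemma lborel_integrable_shift: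
  fixes f :: "real \<Rightarrow> 'a :: {banach, second_countable_topology}"
  assumes "integrable lborel f"
  shows "integrable lborel (\<lambda>x. f (x + t))" "integrable lborel (\<lambda>x. f (t - x))"
proof -
  show "integrable lborel (\<lambda>x. f (x + t))"
    using lborel_integrable_real_affine[OF assms, of 1 t] by (simp add: add.commute)
  show "integrable lborel (\<lambda>x. f (t - x))"
    using lborel_integrable_real_affine[OF assms, of "-1" t] by simp
qed

section \<open>Density of continuous functions and continuity of translations in mean square\<close>

definition clip :: "real \<Rightarrow> complex \<Rightarrow> complex" where
  "clip N z = (N / max N (cmod z)) *\<^sub>R z"

lemma norm_clip_le: "N > 0 \<Longrightarrow> cmod (clip N z) \<le> N"
  by (auto simp: clip_def max_def field_simps)

lemma clip_eq: "N > 0 \<Longrightarrow> cmod z \<le> N \<Longrightarrow> clip N z = z"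
  by (auto simp: clip_def max_def)

lemma norm_diff_clip_le:
  assumes "N > 0"
  shows "cmod (z - clip N z) \<le> cmod z"
proof -
  have "z - clip N z = (1 - N / max N (cmod z)) *\<^sub>R z"
    by (simp add: clip_def scaleR_left_diff_distrib)
  moreover have "\<bar>1 - N / max N (cmod z)\<bar> \<le> 1"
    using assms divide_le_eq_1_pos[of "max N (cmod z)" N] by (auto simp: abs_le_iff)
  ultimately show ?thesis
    by (simp add: mult_left_le_one_le)
qed

lemma continuous_on_clip [continuous_intros]:
  assumes "N > 0" "continuous_on S f"
  shows "continuous_on S (\<lambda>x. clip N (f x))"
  unfolding clip_def using assms by (intro continuous_intros) auto

lemma borel_measurable_clip [measurable]: "clip N \<in> borel_measurable borel"
  unfolding clip_def by measurable

text \<open>Truncation by \<open>clip\<close>, the radial retraction onto the disc of radius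
  \<open>N\<close>, makes dominated convergence available twice: the first error is dominated by
  \<open>|v|^2\<close>, and the second compares clipped functions, which differ by at most
  \<open>2 * N\<close>. A quarter of \<open>e\<close> for each leaves room for
  \<open>(a + b)^2 \<le> 2 a^2 + 2 b^2\<close>.\<close>

lemma L2_dense_continuous:
  fixes v :: "real \<Rightarrow> complex"
  assumes [measurable]: "v \<in> borel_measurable borel"
    and int: "integrable lborel (\<lambda>x. (cmod (v x))^2)" and "e > 0"
  obtains w where "continuous_on UNIV w"
    "(LINT x:{a..b}|lborel. (cmod (v x - w x))^2) < e"
proof -
  have "(\<lambda>n. LINT x|lborel. (cmod (v x - clip (real (Suc n)) (v x)))^2) \<longlonglongrightarrow> (LINT (x::real)|lborel. (0::real))"
  proof (rule integral_dominated_convergence[where w="\<lambda>x. (cmod (v x))^2"])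
    show "AE x in lborel. (\<lambda>n. (cmod (v x - clip (real (Suc n)) (v x)))^2) \<longlonglongrightarrow> 0"
    proof (intro AE_I2)
      fix x
      have "\<forall>\<^sub>F n in sequentially. cmod (v x) \<le> real (Suc n)"
        using eventually_ge_at_top[of "nat \<lceil>cmod (v x)\<rceil>"] by eventually_elim linarith
      then have "\<forall>\<^sub>F n in sequentially. (cmod (v x - clip (real (Suc n)) (v x)))^2 = 0"
        by eventually_elim (simp add: clip_eq)
      then show "(\<lambda>n. (cmod (v x - clip (real (Suc n)) (v x)))^2) \<longlonglongrightarrow> 0"
        by (rule tendsto_eventually)
    qed
    show "AE x in lborel. norm ((cmod (v x - clip (real (Suc n)) (v x)))^2) \<le> (cmod (v x))^2" for n
      by (intro AE_I2) (simp add: norm_diff_clip_le power_mono)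
  qed (use int in auto)
  then have "\<forall>\<^sub>F n in sequentially. (LINT x|lborel. (cmod (v x - clip (real (Suc n)) (v x)))^2) < e/4"
    by (rule order_tendstoD) (use \<open>e > 0\<close> in simp)
  then obtain n where n: "(LINT x|lborel. (cmod (v x - clip (real (Suc n)) (v x)))^2) < e/4"
    by (auto simp: eventually_sequentially)
  define N where "N = real (Suc n)"
  have N: "N > 0" by (simp add: N_def)
  have int1: "integrable lborel (\<lambda>x. (cmod (v x - clip N (v x)))^2)"
    by (rule Bochner_Integration.integrable_bound[OF int])
       (auto simp: norm_diff_clip_le[OF N] power_mono)
  \<comment> \<open>\<open>measurable_on\<close> supplies continuous functions converging to
    \<open>v\<close> off a negligible set, but with no bound; clipping them restores one.\<close>
  have "v measurable_on UNIV"
    by (intro lebesgue_measurable_imp_measurable_on measurable_completion) simp_all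
  then obtain N0 g where N0: "negligible N0" and gc: "\<And>n. continuous_on UNIV (g n)"
    and lim: "\<And>x. x \<notin> N0 \<Longrightarrow> (\<lambda>n. g n x) \<longlonglongrightarrow> v x"
    by (auto simp: measurable_on_def)
  have [measurable]: "g n \<in> borel_measurable borel" for n
    by (rule borel_measurable_continuous_onI[OF gc])
  have "AE x in lebesgue. x \<notin> N0"
    using N0 by (intro AE_not_in) (simp add: negligible_iff_null_sets)
  then have ae: "AE x in lborel. x \<notin> N0"
    by (simp add: AE_completion_iff)
  have "(\<lambda>k. LINT x|lborel. indicator {a..b} x * (cmod (clip N (v x) - clip N (g k x)))^2) \<longlonglongrightarrow> (LINT (x::real)|lborel. (0::real))"
  proof (rule integral_dominated_convergence[where w="\<lambda>x. (2*N)^2 * indicator {a..b} x"])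
    show "AE x in lborel. (\<lambda>k. indicator {a..b} x * (cmod (clip N (v x) - clip N (g k x)))^2) \<longlonglongrightarrow> 0"
      using ae
    proof eventually_elim
      case (elim x)
      have "isCont (clip N) (v x)"
        using continuous_on_clip[OF N continuous_on_id, of UNIV] by (simp add: continuous_on_eq_continuous_at)
      then have "(\<lambda>k. clip N (g k x)) \<longlonglongrightarrow> clip N (v x)"
        using lim[OF elim] by (rule isCont_tendsto_compose)
      then have "(\<lambda>k. indicator {a..b} x * (cmod (clip N (v x) - clip N (g k x)))^2)
          \<longlonglongrightarrow> indicator {a..b} x * (cmod (clip N (v x) - clip N (v x)))^2"
        by (intro tendsto_intros)
      then show ?case by simp
    qed
    show "AE x in lborel. norm (indicator {a..b} x * (cmod (clip N (v x) - clip N (g k x)))^2)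
       \<le> (2*N)^2 * indicator {a..b} x" for k
    proof (intro AE_I2)
      fix x
      have "cmod (clip N (v x) - clip N (g k x)) \<le> 2 * N"
        using norm_triangle_ineq4[of "clip N (v x)" "clip N (g k x)"]
          norm_clip_le[OF N, of "v x"] norm_clip_le[OF N, of "g k x"] by linarith
      then have "(cmod (clip N (v x) - clip N (g k x)))^2 \<le> (2*N)^2"
        by (rule power_mono) simp
      then show "norm (indicator {a..b} x * (cmod (clip N (v x) - clip N (g k x)))^2)
       \<le> (2*N)^2 * indicator {a..b} x" by (auto simp: indicator_def)
    qed
  qed (auto intro!: integrable_mult_right)
  then have "\<forall>\<^sub>F k in sequentially. (LINT x|lborel. indicator {a..b} x * (cmod (clip N (v x) - clip N (g k x)))^2) < e/4"
    by (rule order_tendstoD) (use \<open>e > 0\<close> in simp)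
  then obtain k where k: "(LINT x|lborel. indicator {a..b} x * (cmod (clip N (v x) - clip N (g k x)))^2) < e/4"
    by (auto simp: eventually_sequentially)
  have int2: "integrable lborel (\<lambda>x. indicator {a..b} x * (cmod (clip N (v x) - clip N (g k x)))^2)"
  proof (rule Bochner_Integration.integrable_bound[of _ "\<lambda>x. (2*N)^2 * indicator {a..b} x"])
    show "AE x in lborel. norm (indicator {a..b} x * (cmod (clip N (v x) - clip N (g k x)))^2)
       \<le> norm ((2*N)^2 * indicat_real {a..b} x)"
    proof (intro AE_I2)
      fix x
      have "cmod (clip N (v x) - clip N (g k x)) \<le> 2 * N"
        using norm_triangle_ineq4[of "clip N (v x)" "clip N (g k x)"]
          norm_clip_le[OF N, of "v x"] norm_clip_le[OF N, of "g k x"] by linarith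
      then have "(cmod (clip N (v x) - clip N (g k x)))^2 \<le> (2*N)^2"
        by (rule power_mono) simp
      then show "norm (indicator {a..b} x * (cmod (clip N (v x) - clip N (g k x)))^2)
       \<le> norm ((2*N)^2 * indicat_real {a..b} x)" by (auto simp: indicator_def)
    qed
  qed (auto intro!: integrable_mult_right)
  show thesis
  proof
    show "continuous_on UNIV (\<lambda>x. clip N (g k x))"
      by (intro continuous_on_clip N gc)
    have "(LINT x:{a..b}|lborel. (cmod (v x - clip N (g k x)))^2)
      \<le> (LINT x|lborel. 2 * (cmod (v x - clip N (v x)))^2
            + 2 * (indicator {a..b} x * (cmod (clip N (v x) - clip N (g k x)))^2))"
      unfolding set_lebesgue_integral_def
    proof (rule integral_mono')
      show "integrable lborel (\<lambda>x. 2 * (cmod (v x - clip N (v x)))^2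
            + 2 * (indicator {a..b} x * (cmod (clip N (v x) - clip N (g k x)))^2))"
        using int1 int2 by simp
      fix x
      have "cmod (v x - clip N (g k x)) \<le> cmod (v x - clip N (v x)) + cmod (clip N (v x) - clip N (g k x))"
        using norm_triangle_ineq[of "v x - clip N (v x)" "clip N (v x) - clip N (g k x)"] by simp
      then have "(cmod (v x - clip N (g k x)))^2 \<le> (cmod (v x - clip N (v x)) + cmod (clip N (v x) - clip N (g k x)))^2"
        by (rule power_mono) simp
      also have "\<dots> \<le> 2 * (cmod (v x - clip N (v x)))^2 + 2 * (cmod (clip N (v x) - clip N (g k x)))^2"
        using sum_squares_bound[of "cmod (v x - clip N (v x))" "cmod (clip N (v x) - clip N (g k x))"]
        by (simp add: power2_sum)
      finally show "indicat_real {a..b} x *\<^sub>R (cmod (v x - clip N (g k x)))^2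
        \<le> 2 * (cmod (v x - clip N (v x)))^2 + 2 * (indicator {a..b} x * (cmod (clip N (v x) - clip N (g k x)))^2)"
        by (auto simp: indicator_def)
    qed auto
    also have "\<dots> < e"
      using n k int1 int2 unfolding N_def[symmetric] by simp
    finally show "(LINT x:{a..b}|lborel. (cmod (v x - clip N (g k x)))^2) < e" .
  qed
qed

lemma cmod_diff_sq_le3:
  "(cmod (a - d))^2 \<le> 3 * (cmod (a - b))^2 + 3 * (cmod (b - c))^2 + 3 * (cmod (c - d))^2"
proof -
  have "cmod (a - d) \<le> cmod (a - b) + cmod (b - c) + cmod (c - d)"
    using norm_triangle_ineq[of "a - b" "b - d"] norm_triangle_ineq[of "b - c" "c - d"] by simp
  then have "(cmod (a - d))^2 \<le> (cmod (a - b) + cmod (b - c) + cmod (c - d))^2"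
    by (rule power_mono) simp
  also have "\<dots> \<le> 3 * (cmod (a - b))^2 + 3 * (cmod (b - c))^2 + 3 * (cmod (c - d))^2"
    using sum_squares_bound[of "cmod (a - b)" "cmod (b - c)"] sum_squares_bound[of "cmod (a - b)" "cmod (c - d)"]
      sum_squares_bound[of "cmod (b - c)" "cmod (c - d)"]
    by (simp add: power2_eq_square algebra_simps)
  finally show ?thesis .
qed

lemma cmod_add_sq_le: "(cmod (a + b))^2 \<le> 2 * (cmod a)^2 + 2 * (cmod b)^2"
  using power_mono[OF norm_triangle_ineq[of a b], of 2] sum_squares_bound[of "cmod a" "cmod b"]
  by (simp add: power2_sum)

text \<open>Translate a continuous approximation \<open>w\<close>, which is uniformly continuous on
  \<open>I\<close>, and pay twice for replacing \<open>v\<close> by \<open>w\<close>. With the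
  factor 3 of \<open>cmod_diff_sq_le3\<close> the three errors total less than
  \<open>3 * e / 4\<close>.\<close>

lemma L2_translation_continuous:
  fixes v :: "real \<Rightarrow> complex"
  assumes [measurable]: "v \<in> borel_measurable borel"
    and int: "integrable lborel (\<lambda>x. (cmod (v x))^2)" and L: "L > 0"
  shows "((\<lambda>t. LINT x:{0..L}|lborel. (cmod (v (t + x) - v (t0 + x)))^2) \<longlongrightarrow> 0) (at t0 within S)"
proof (rule tendstoI)
  fix e :: real assume e: "e > 0"
  \<comment> \<open>The margin 1 keeps \<open>t + x\<close> inside \<open>I\<close> whenever
    \<open>|t - t0| < 1\<close>, so one \<open>w\<close> serves all nearby translates.\<close>
  define I where "I = {t0 - 1 .. t0 + 1 + L}"
  obtain w where w: "continuous_on UNIV w" and we: "(LINT x:I|lborel. (cmod (v x - w x))^2) < e/12"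
    unfolding I_def by (rule L2_dense_continuous[OF assms(1) int, of "e/12"]) (use e in auto)
  have [measurable]: "w \<in> borel_measurable borel"
    by (rule borel_measurable_continuous_onI[OF w])
  have wI: "continuous_on I w" using w continuous_on_subset by blast
  have "uniformly_continuous_on I w"
    by (intro compact_uniformly_continuous wI) (simp add: I_def)
  then obtain d where d: "d > 0" "\<And>x y. x \<in> I \<Longrightarrow> y \<in> I \<Longrightarrow> dist y x < d \<Longrightarrow> dist (w y) (w x) < sqrt (e/(12*L))"
    unfolding uniformly_continuous_on_def using e L by (metis divide_pos_pos mult_pos_pos real_sqrt_gt_0_iff zero_less_numeral)
  have intw: "set_integrable lborel I (\<lambda>x. (cmod (w x))^2)"
    unfolding I_def by (intro borel_integrable_atLeastAtMost' continuous_intros wI[unfolded I_def])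
  have intvw: "integrable lborel (\<lambda>x. indicator I x * (cmod (v x - w x))^2)"
  proof (rule Bochner_Integration.integrable_bound)
    show "integrable lborel (\<lambda>x. 2 * (cmod (v x))^2 + 2 * (indicator I x * (cmod (w x))^2))"
      using int intw by (simp add: set_integrable_def)
    have "(cmod (a - b))^2 \<le> 2 * (cmod a)^2 + 2 * (cmod b)^2" for a b
      using cmod_add_sq_le[of a "- b"] by simp
    then show "AE x in lborel. norm (indicator I x * (cmod (v x - w x))^2)
        \<le> norm (2 * (cmod (v x))^2 + 2 * (indicator I x * (cmod (w x))^2))"
      by (intro AE_I2) (auto simp: indicator_def)
  qed (simp add: I_def)
  define F where "F x = indicator I x * (cmod (v x - w x))^2" for x
  have Fi: "integrable lborel (\<lambda>x. F (x + t))" for t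
    using intvw by (intro lborel_integrable_shift) (simp add: F_def[abs_def])
  have Fe: "(LINT x|lborel. F (x + t)) < e/12" for t
    unfolding lborel_integral_shift using we by (simp add: F_def[abs_def] set_lebesgue_integral_def)
  have "(LINT x:{0..L}|lborel. (cmod (v (t + x) - v (t0 + x)))^2) < e" if t: "\<bar>t - t0\<bar> < min d 1" for t
  proof -
    have "(LINT x:{0..L}|lborel. (cmod (v (t + x) - v (t0 + x)))^2)
      \<le> (LINT x|lborel. 3 * F (x + t) + 3 * (e/(12*L)) * indicat_real {0..L} x + 3 * F (x + t0))"
      unfolding set_lebesgue_integral_def
    proof (rule integral_mono')
      show "integrable lborel (\<lambda>x. 3 * F (x + t) + 3 * (e/(12*L)) * indicat_real {0..L} x + 3 * F (x + t0))"
        by (intro Bochner_Integration.integrable_add integrable_mult_right Fi integrable_indicator_Icc)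
      fix x
      have F0: "F y \<ge> 0" for y by (simp add: F_def)
      show "0 \<le> 3 * F (x + t) + 3 * (e/(12*L)) * indicat_real {0..L} x + 3 * F (x + t0)"
        using F0 e L by (simp add: add_nonneg_nonneg)
      show "indicat_real {0..L} x *\<^sub>R (cmod (v (t + x) - v (t0 + x)))^2
        \<le> 3 * F (x + t) + 3 * (e/(12*L)) * indicat_real {0..L} x + 3 * F (x + t0)"
      proof (cases "x \<in> {0..L}")
        case True
        then have I: "t + x \<in> I" "t0 + x \<in> I" using t by (auto simp: I_def)
        have "dist (w (t + x)) (w (t0 + x)) < sqrt (e/(12*L))"
          using t by (intro d(2) I) (simp add: dist_real_def)
        then have "(cmod (w (t + x) - w (t0 + x)))^2 \<le> (sqrt (e/(12*L)))^2"
          by (intro power_mono) (auto simp: dist_norm)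
        then have "(cmod (w (t + x) - w (t0 + x)))^2 \<le> e/(12*L)" using e L by simp
        then show ?thesis
          using cmod_diff_sq_le3[of "v (t + x)" "v (t0 + x)" "w (t + x)" "w (t0 + x)"] True I
          by (simp add: F_def add.commute norm_minus_commute)
      next
        case False
        then show ?thesis using F0 by simp
      qed
    qed
    also have "\<dots> = 3 * (LINT x|lborel. F (x + t)) + 3 * (e/(12*L)) * L + 3 * (LINT x|lborel. F (x + t0))"
      using Fi L by simp
    also have "\<dots> < e" using Fe[of t] Fe[of t0] L e by (simp add: field_simps)
    finally show ?thesis .
  qed
  moreover have "0 \<le> (LINT x:{0..L}|lborel. (cmod (v (t + x) - v (t0 + x)))^2)" for t
    unfolding set_lebesgue_integral_def by (rule Bochner_Integration.integral_nonneg) simp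
  ultimately show "\<forall>\<^sub>F t in at t0 within S. dist (LINT x:{0..L}|lborel. (cmod (v (t + x) - v (t0 + x)))^2) 0 < e"
    unfolding eventually_at using d(1) by (intro exI[of _ "min d 1"]) (auto simp: dist_real_def)
qed

section \<open>Transport along characteristics\<close>

lemma integrable_mult_bounded:
  fixes w q :: "real \<Rightarrow> complex"
  assumes w: "integrable lborel w" and [measurable]: "q \<in> borel_measurable borel"
    and q: "\<And>x. cmod (q x) \<le> M"
  shows "integrable lborel (\<lambda>x. w x * q x)"
proof (rule Bochner_Integration.integrable_bound)
  show "integrable lborel (\<lambda>x. M * cmod (w x))"
    using w by (intro integrable_mult_right integrable_norm)
  have "M \<ge> 0" using q[of 0] norm_ge_zero order_trans by blast
  then show "AE x in lborel. cmod (w x * q x) \<le> norm (M * cmod (w x))"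
    using q by (intro AE_I2) (simp add: norm_mult mult.commute mult_right_mono)
qed (use w in measurable)

lemma indicator_scaleR_bounded:
  fixes f :: "'a::topological_space \<Rightarrow> complex"
  assumes "compact S" "continuous_on S f"
  obtains M where "M \<ge> 0" "\<And>x. cmod (indicat_real S x *\<^sub>R f x) \<le> M"
proof -
  have "bounded (f ` S)"
    by (intro compact_imp_bounded compact_continuous_image assms)
  then obtain M where "\<And>x. x \<in> S \<Longrightarrow> cmod (f x) \<le> M"
    unfolding bounded_iff by auto
  then have "cmod (indicat_real S x *\<^sub>R f x) \<le> max M 0" for x
    by (auto simp: indicator_def le_max_iff_disj)
  then show thesis by (intro that[of "max M 0"]) auto
qed

lemma continuous_on_compose_Pair':
  assumes "continuous_on (A \<times> B) (\<lambda>(t, x). F t x)" "continuous_on S a" "continuous_on S b"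
    and "\<And>s. s \<in> S \<Longrightarrow> a s \<in> A \<and> b s \<in> B"
  shows "continuous_on S (\<lambda>s. F (a s) (b s))"
proof -
  have "continuous_on S (\<lambda>s. case (a s, b s) of (t, x) \<Rightarrow> F t x)"
    by (rule continuous_on_compose2[OF assms(1)]) (use assms in \<open>auto intro!: continuous_intros\<close>)
  then show ?thesis by simp
qed

text \<open>\<open>C1_rect\<close> supplies only partial derivatives, one-sided at the boundary.
  Continuity of \<open>\<psi>x\<close> upgrades them to a total derivative within the closed
  rectangle, and then the chain rule along \<open>s \<mapsto> (s, r - s)\<close> holds up to the
  boundary.\<close>

lemma C1_rect_characteristic:
  assumes C1: "C1_rect \<tau> L \<psi> \<psi>t \<psi>x" and t: "t \<in> S"
    and S: "\<And>s. s \<in> S \<Longrightarrow> s \<in> {0..\<tau>} \<and> r - s \<in> {0..L}"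
  shows "((\<lambda>s. \<psi> s (r - s)) has_vector_derivative (\<psi>t t (r - t) - \<psi>x t (r - t))) (at t within S)"
proof -
  let ?X = "{0..\<tau>}" and ?Y = "{0..L}"
  have p: "t \<in> ?X" "r - t \<in> ?Y" using S[OF t] by auto
  have "((\<lambda>(s, y). \<psi> s y) has_derivative
      (\<lambda>(h, k). h *\<^sub>R \<psi>t t (r - t) + blinfun_apply (blinfun_scaleR_left (\<psi>x t (r - t))) k))
      (at (t, r - t) within ?X \<times> ?Y)"
  proof (rule has_derivative_partialsI)
    show "((\<lambda>s. \<psi> s (r - t)) has_derivative (\<lambda>h. h *\<^sub>R \<psi>t t (r - t))) (at t within ?X)"
      using C1 p unfolding C1_rect_def has_vector_derivative_def by blast
    show "((\<lambda>y. \<psi> s y) has_derivative blinfun_apply (blinfun_scaleR_left (\<psi>x s y))) (at y within ?Y)"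
      if "s \<in> ?X" "y \<in> ?Y" for s y
      using C1 that unfolding C1_rect_def has_vector_derivative_def by simp
    have "continuous_on (?X \<times> ?Y) (\<lambda>p. blinfun_scaleR_left (case p of (s, y) \<Rightarrow> \<psi>x s y))"
      using C1 unfolding C1_rect_def
      by (intro bounded_linear.continuous_on[OF bounded_linear_blinfun_scaleR_left]) auto
    then have "continuous_on (?X \<times> ?Y) (\<lambda>(s, y). blinfun_scaleR_left (\<psi>x s y))"
      by (simp add: case_prod_unfold)
    then show "continuous (at (t, r - t) within ?X \<times> ?Y) (\<lambda>(s, y). blinfun_scaleR_left (\<psi>x s y))"
      using p by (simp add: continuous_on_eq_continuous_within)
  qed (use p in auto)
  then have 1: "((\<lambda>(s, y). \<psi> s y) has_derivative
      (\<lambda>(h, k). h *\<^sub>R \<psi>t t (r - t) + k *\<^sub>R \<psi>x t (r - t))) (at (t, r - t) within (\<lambda>s. (s, r - s)) ` S)"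
    using S by (auto intro: has_derivative_subset)
  have 2: "((\<lambda>s. (s, r - s)) has_derivative (\<lambda>h. (h, - h))) (at t within S)"
    by (auto intro!: derivative_eq_intros)
  show ?thesis
    using has_derivative_in_compose[OF 2 1] unfolding has_vector_derivative_def
    by (simp add: scaleR_diff_right)
qed

text \<open>Along the characteristic \<open>t + x = r\<close> the integrand is minus the derivative of \<open>\<psi>\<close>. The two plus
  terms come from the point where the characteristic enters the rectangle (through \<open>t = s\<close> or
  \<open>x = L\<close>), the minus term from its exit through \<open>t = \<tau>\<close>; an exit through \<open>x = 0\<close> contributes nothing.\<close>

lemma integral_characteristic:
  assumes C1: "C1_rect \<tau> L \<psi> \<psi>t \<psi>x" and s: "0 \<le> s" "s \<le> \<tau>" and L: "0 < L"
    and bc: "\<And>t. t \<in> {0..\<tau>} \<Longrightarrow> \<psi> t 0 = 0"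
  shows "(LINT t|lborel. indicat_real {s..\<tau>} t *\<^sub>R indicat_real {0..L} (r - t) *\<^sub>R (\<psi>x t (r - t) - \<psi>t t (r - t)))
    = indicat_real {s..s+L} r *\<^sub>R \<psi> s (r - s) + indicat_real {s+L<..\<tau>+L} r *\<^sub>R \<psi> (r - L) L
      - indicat_real {\<tau>..\<tau>+L} r *\<^sub>R \<psi> \<tau> (r - \<tau>)"
proof (cases "r \<in> {s..\<tau>+L}")
  case True
  define a where "a = max s (r - L)"
  define b where "b = min \<tau> r"
  have ab: "a \<le> b" using True s L by (auto simp: a_def b_def)
  have sub: "t \<in> {0..\<tau>} \<and> r - t \<in> {0..L}" if "t \<in> {a..b}" for t
    using that s L by (auto simp: a_def b_def)
  have c: "continuous_on {a..b} (\<lambda>t. \<psi>x t (r - t))" "continuous_on {a..b} (\<lambda>t. \<psi>t t (r - t))"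
    by (rule continuous_on_compose_Pair'[of "{0..\<tau>}" "{0..L}"];
        use C1 sub in \<open>auto simp: C1_rect_def intro!: continuous_intros\<close>)+
  have "(LINT t|lborel. indicat_real {s..\<tau>} t *\<^sub>R indicat_real {0..L} (r - t) *\<^sub>R (\<psi>x t (r - t) - \<psi>t t (r - t)))
    = (LINT t|lborel. indicat_real {a..b} t *\<^sub>R (\<psi>x t (r - t) - \<psi>t t (r - t)))"
    by (intro Bochner_Integration.integral_cong) (auto simp: a_def b_def indicator_def)
  also have "\<dots> = - \<psi> b (r - b) - (- \<psi> a (r - a))"
  proof (rule integral_FTC_atLeastAtMost[OF ab])
    fix t assume "a \<le> t" "t \<le> b"
    then have "((\<lambda>s. \<psi> s (r - s)) has_vector_derivative (\<psi>t t (r - t) - \<psi>x t (r - t))) (at t within {a..b})"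
      by (intro C1_rect_characteristic[OF C1] sub) auto
    from has_vector_derivative_minus[OF this]
    show "((\<lambda>s. - \<psi> s (r - s)) has_vector_derivative (\<psi>x t (r - t) - \<psi>t t (r - t))) (at t within {a..b})"
      by simp
  qed (intro continuous_intros c)
  also have "\<psi> b (r - b) = indicat_real {\<tau>..\<tau>+L} r *\<^sub>R \<psi> \<tau> (r - \<tau>)"
    using True s bc[of r] by (auto simp: b_def indicator_def min_def)
  \<comment> \<open>At \<open>r = s + L\<close> the characteristic enters through the corner; the
    half-open second indicator keeps this entry from being counted twice.\<close>
  also have "\<psi> a (r - a) = indicat_real {s..s+L} r *\<^sub>R \<psi> s (r - s) + indicat_real {s+L<..\<tau>+L} r *\<^sub>R \<psi> (r - L) L"
    using True by (cases "r = s + L") (auto simp: a_def indicator_def max_def)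
  finally show ?thesis by simp
next
  case False
  then have "(LINT t|lborel. indicat_real {s..\<tau>} t *\<^sub>R indicat_real {0..L} (r - t) *\<^sub>R (\<psi>x t (r - t) - \<psi>t t (r - t)))
    = (LINT (t::real)|lborel. 0)"
    by (intro Bochner_Integration.integral_cong) (auto simp: indicator_def)
  then show ?thesis using False s L by (auto simp: indicator_def)
qed

text \<open>\<open>w\<close> is only integrable, so no derivative may fall on it. In the coordinates
  \<open>(t, r)\<close> with \<open>r = x + t\<close> it factors out of the
  \<open>t\<close>-integral, which \<open>integral_characteristic\<close> evaluates. The starting
  time \<open>s\<close> is general because each pulse in the Duhamel formula starts at its own
  time.\<close>

lemma transport_identity:
  fixes w :: "real \<Rightarrow> complex"
  assumes C1: "C1_rect \<tau> L \<psi> \<psi>t \<psi>x" and s: "0 \<le> s" "s \<le> \<tau>" and L: "0 < L"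
    and bc: "\<And>t. t \<in> {0..\<tau>} \<Longrightarrow> \<psi> t 0 = 0"
    and w: "integrable lborel w"
  shows "(LINT t:{s..\<tau>}|lborel. LINT x:{0..L}|lborel. w (x + t) * (\<psi>x t x - \<psi>t t x))
    = (LINT x:{0..L}|lborel. w (x + s) * \<psi> s x) - (LINT x:{0..L}|lborel. w (x + \<tau>) * \<psi> \<tau> x)
      + (LINT t:{s..\<tau>}|lborel. w (L + t) * \<psi> t L)"
proof -
  have [measurable]: "w \<in> borel_measurable borel" using w by auto
  let ?R = "{0..\<tau>} \<times> {0..L}"
  \<comment> \<open>The test function is controlled only on the rectangle; the cut-off turns it into
    a bounded Borel function on the whole plane.\<close>
  define Q where "Q p = indicat_real ?R p *\<^sub>R (\<psi>x (fst p) (snd p) - \<psi>t (fst p) (snd p))" for p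
  have cR: "compact ?R" by (intro compact_Times) auto
  have cQ: "continuous_on ?R (\<lambda>p. \<psi>x (fst p) (snd p) - \<psi>t (fst p) (snd p))"
    using C1 unfolding C1_rect_def by (intro continuous_intros) (simp_all add: case_prod_unfold)
  have "Q \<in> borel_measurable borel"
    unfolding Q_def by (intro borel_measurable_continuous_on_indicator cQ borel_closed compact_imp_closed cR)
  then have [measurable]: "Q \<in> borel_measurable (borel \<Otimes>\<^sub>M borel)" by (simp add: borel_prod)
  obtain M where M: "M \<ge> 0" "\<And>p. cmod (Q p) \<le> M"
    unfolding Q_def by (rule indicator_scaleR_bounded[OF cR cQ]) auto
  have c1: "continuous_on {0..L} (\<lambda>x. \<psi> t x)" if "t \<in> {0..\<tau>}" for t
    by (rule continuous_on_compose_Pair'[of "{0..\<tau>}" "{0..L}"])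
       (use C1 that in \<open>auto simp: C1_rect_def intro!: continuous_intros\<close>)
  have c2: "continuous_on {s..\<tau>} (\<lambda>t. \<psi> t L)"
    by (rule continuous_on_compose_Pair'[of "{0..\<tau>}" "{0..L}"])
       (use C1 s L in \<open>auto simp: C1_rect_def intro!: continuous_intros\<close>)
  define f where "f t r = w r * (indicat_real {s..\<tau>} t *\<^sub>R Q (t, r - t))" for t r
  have A: "indicat_real {s..\<tau>} t *\<^sub>R indicat_real {0..L} x *\<^sub>R (\<psi>x t x - \<psi>t t x)
      = indicat_real {s..\<tau>} t *\<^sub>R Q (t, x)" for t x
    using s by (auto simp: Q_def indicator_def)
  have f_bound: "cmod (indicat_real {s..\<tau>} t *\<^sub>R Q (t, r - t)) \<le> M" for t r
    using M by (auto simp: indicator_def)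
  have fi: "integrable lborel (f t)" for t
    unfolding f_def by (rule integrable_mult_bounded[OF w _ f_bound]) measurable
  have fb: "(LINT r|lborel. cmod (f t r)) \<le> (LINT r|lborel. cmod (w r) * M)" for t
    using w f_bound by (intro integral_mono integrable_norm fi) (auto simp: f_def norm_mult mult_left_mono simp del: norm_scaleR mult_scaleR_right)
  have sh: "(LINT r|lborel. w r * (indicat_real {0..L} (r - t) *\<^sub>R \<psi> t (r - t)))
     = (LINT x:{0..L}|lborel. w (x + t) * \<psi> t x)" for t
    unfolding set_lebesgue_integral_def
    by (subst lborel_integral_shift(1)[where t=t, symmetric]) simp
  have "(LINT t:{s..\<tau>}|lborel. LINT x:{0..L}|lborel. w (x + t) * (\<psi>x t x - \<psi>t t x))
     = (LINT t|lborel. LINT x|lborel. f t (x + t))"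
    unfolding set_lebesgue_integral_def integral_scaleR_right[symmetric]
    by (intro Bochner_Integration.integral_cong refl) (simp add: f_def A[symmetric])
  also have "\<dots> = (LINT t|lborel. LINT r|lborel. f t r)"
    by (simp add: lborel_integral_shift(1)[of "f t" t for t])
  also have "\<dots> = (LINT r|lborel. LINT t|lborel. f t r)"
  proof (rule lborel_Fubini_bounded[of f s \<tau>, OF _ fi _ fb])
    show "case_prod f \<in> borel_measurable (lborel \<Otimes>\<^sub>M lborel)"
      unfolding f_def[abs_def] by measurable
  qed (simp add: f_def)
  also have "\<dots> = (LINT r|lborel. w r * (indicat_real {s..s+L} r *\<^sub>R \<psi> s (r - s)
      + indicat_real {s+L<..\<tau>+L} r *\<^sub>R \<psi> (r - L) L - indicat_real {\<tau>..\<tau>+L} r *\<^sub>R \<psi> \<tau> (r - \<tau>)))"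
    unfolding f_def A[symmetric] by (simp only: integral_mult_right_zero integral_characteristic[OF C1 s L bc])
  also have "\<dots> = (LINT r|lborel. w r * (indicat_real {0..L} (r - s) *\<^sub>R \<psi> s (r - s))
      + w r * (indicat_real {s<..\<tau>} (r - L) *\<^sub>R \<psi> (r - L) L)
      - w r * (indicat_real {0..L} (r - \<tau>) *\<^sub>R \<psi> \<tau> (r - \<tau>)))"
    by (intro Bochner_Integration.integral_cong refl) (auto simp: indicator_def algebra_simps)
  also have "\<dots> = (LINT r|lborel. w r * (indicat_real {0..L} (r - s) *\<^sub>R \<psi> s (r - s)))
      + (LINT r|lborel. w r * (indicat_real {s<..\<tau>} (r - L) *\<^sub>R \<psi> (r - L) L))
      - (LINT r|lborel. w r * (indicat_real {0..L} (r - \<tau>) *\<^sub>R \<psi> \<tau> (r - \<tau>)))"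
  proof -
    have i1: "integrable lborel (\<lambda>r. w r * (indicat_real {0..L} (r - t) *\<^sub>R \<psi> t (r - t)))"
      if t: "t \<in> {0..\<tau>}" for t
    proof -
      obtain M' where M': "\<And>x. cmod (indicat_real {0..L} x *\<^sub>R \<psi> t x) \<le> M'"
        by (rule indicator_scaleR_bounded[OF _ c1[OF t]]) auto
      have [measurable]: "(\<lambda>x. indicat_real {0..L} x *\<^sub>R \<psi> t x) \<in> borel_measurable borel"
        by (intro borel_measurable_continuous_on_indicator c1 t) auto
      have "(\<lambda>r. (\<lambda>x. indicat_real {0..L} x *\<^sub>R \<psi> t x) (r - t)) \<in> borel_measurable borel"
        by measurable
      then show ?thesis using M' by (intro integrable_mult_bounded[OF w]) auto
    qed
    have i2: "integrable lborel (\<lambda>r. w r * (indicat_real {s<..\<tau>} (r - L) *\<^sub>R \<psi> (r - L) L))"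
    proof -
      obtain M' where M': "M' \<ge> 0" "\<And>x. cmod (indicat_real {s..\<tau>} x *\<^sub>R \<psi> x L) \<le> M'"
        by (rule indicator_scaleR_bounded[OF _ c2]) auto
      have [measurable]: "(\<lambda>t. indicat_real {s..\<tau>} t *\<^sub>R \<psi> t L) \<in> borel_measurable borel"
        by (intro borel_measurable_continuous_on_indicator c2) auto
      have "(\<lambda>r. indicat_real {s<..\<tau>} (r - L) *\<^sub>R (\<lambda>t. indicat_real {s..\<tau>} t *\<^sub>R \<psi> t L) (r - L)) \<in> borel_measurable borel"
        by measurable
      also have "(\<lambda>r. indicat_real {s<..\<tau>} (r - L) *\<^sub>R (\<lambda>t. indicat_real {s..\<tau>} t *\<^sub>R \<psi> t L) (r - L))
        = (\<lambda>r. indicat_real {s<..\<tau>} (r - L) *\<^sub>R \<psi> (r - L) L)"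
        by (auto simp: indicator_def)
      finally show ?thesis
      proof (rule integrable_mult_bounded[OF w])
        show "cmod (indicat_real {s<..\<tau>} (r - L) *\<^sub>R \<psi> (r - L) L) \<le> M'" for r
          using M'(2)[of "r - L"] M'(1) by (auto simp: indicator_def split: if_splits)
      qed
    qed
    show ?thesis
      using i1[of s] i1[of \<tau>] i2 s by simp
  qed
  also have "(LINT r|lborel. w r * (indicat_real {s<..\<tau>} (r - L) *\<^sub>R \<psi> (r - L) L))
     = (LINT x|lborel. w (L + x) * (indicat_real {s<..\<tau>} x *\<^sub>R \<psi> x L))"
    by (subst lborel_integral_shift(1)[where t=L, symmetric]) (simp add: add.commute)
  also have "\<dots> = (LINT t:{s..\<tau>}|lborel. w (L + t) * \<psi> t L)"
    unfolding set_lebesgue_integral_def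
  proof (rule integral_cong_AE)
    have m1: "(\<lambda>t. w (L + t) * (indicat_real {s..\<tau>} t *\<^sub>R \<psi> t L)) \<in> borel_measurable lborel"
      using borel_measurable_continuous_on_indicator[OF _ c2] by measurable
    then show "(\<lambda>t. indicat_real {s..\<tau>} t *\<^sub>R (w (L + t) * \<psi> t L)) \<in> borel_measurable lborel"
      by simp
    have "(\<lambda>t. indicat_real {s<..\<tau>} t *\<^sub>R (w (L + t) * (indicat_real {s..\<tau>} t *\<^sub>R \<psi> t L))) \<in> borel_measurable lborel"
      using m1 by measurable
    also have "(\<lambda>t. indicat_real {s<..\<tau>} t *\<^sub>R (w (L + t) * (indicat_real {s..\<tau>} t *\<^sub>R \<psi> t L)))
      = (\<lambda>t. w (L + t) * (indicat_real {s<..\<tau>} t *\<^sub>R \<psi> t L))"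
      by (auto simp: indicator_def)
    finally show "(\<lambda>t. w (L + t) * (indicat_real {s<..\<tau>} t *\<^sub>R \<psi> t L)) \<in> borel_measurable lborel" .
    have "AE t in lborel. t \<noteq> s" by (rule AE_lborel_singleton)
    then show "AE t in lborel. w (L + t) * (indicat_real {s<..\<tau>} t *\<^sub>R \<psi> t L)
        = indicat_real {s..\<tau>} t *\<^sub>R (w (L + t) * \<psi> t L)"
      by eventually_elim (auto simp: indicator_def)
  qed
  finally show ?thesis unfolding sh by simp
qed

section \<open>Trigonometric approximation\<close>

definition fmode :: "real \<Rightarrow> int \<Rightarrow> real \<Rightarrow> complex" where
  "fmode L k t = cis (2 * pi * real_of_int k * t / L)"

lemma fmode_0 [simp]: "fmode L 0 t = 1"
  by (simp add: fmode_def)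

lemma fmode_at_0 [simp]: "fmode L k 0 = 1"
  by (simp add: fmode_def)

lemma fmode_add: "fmode L (k + l) t = fmode L k t * fmode L l t"
  by (simp add: fmode_def cis_mult field_simps flip: add_divide_distrib)

lemma fmode_diff: "fmode L k (t - s) = fmode L k t * fmode L (- k) s"
  by (simp add: fmode_def cis_mult field_simps flip: diff_divide_distrib)

lemma fmode_periodic: "L \<noteq> 0 \<Longrightarrow> fmode L k (t + L) = fmode L k t"
  using cis_multiple_2pi[of "real_of_int k"]
  by (simp add: fmode_def add_divide_distrib distrib_left mult.assoc flip: cis_mult)

lemma norm_fmode [simp]: "cmod (fmode L k t) = 1"
  by (simp add: fmode_def)

lemma continuous_on_fmode [continuous_intros]:
  "L \<noteq> 0 \<Longrightarrow> continuous_on S f \<Longrightarrow> continuous_on S (\<lambda>x. fmode L k (f x))"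
  unfolding fmode_def by (intro continuous_intros) auto

lemma borel_measurable_fmode [measurable]: "fmode L k \<in> borel_measurable borel"
  by (intro borel_measurable_continuous_onI)
     (auto simp: fmode_def divide_inverse intro!: continuous_intros)

definition trigpoly :: "real \<Rightarrow> (real \<Rightarrow> complex) \<Rightarrow> bool" where
  "trigpoly L f \<longleftrightarrow> (\<exists>K p. finite K \<and> f = (\<lambda>t. \<Sum>k\<in>K. p k * fmode L k t))"

lemma trigpoly_mode: "trigpoly L (\<lambda>t. c * fmode L k t)"
  unfolding trigpoly_def by (intro exI[of _ "{k}"] exI[of _ "\<lambda>_. c"]) simp

lemma trigpoly_add:
  assumes "trigpoly L f" "trigpoly L g"
  shows "trigpoly L (\<lambda>t. f t + g t)"
proof -
  obtain K p where K: "finite K" and f: "f = (\<lambda>t. \<Sum>k\<in>K. p k * fmode L k t)"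
    using assms(1) unfolding trigpoly_def by blast
  obtain K' p' where K': "finite K'" and g: "g = (\<lambda>t. \<Sum>k\<in>K'. p' k * fmode L k t)"
    using assms(2) unfolding trigpoly_def by blast
  define q where "q k = (if k \<in> K then p k else 0) + (if k \<in> K' then p' k else 0)" for k
  have "f t + g t = (\<Sum>k\<in>K \<union> K'. q k * fmode L k t)" for t
  proof -
    have "f t = (\<Sum>k\<in>K \<union> K'. (if k \<in> K then p k else 0) * fmode L k t)"
      unfolding f using K K' by (intro sum.mono_neutral_cong_left) auto
    moreover have "g t = (\<Sum>k\<in>K \<union> K'. (if k \<in> K' then p' k else 0) * fmode L k t)"
      unfolding g using K K' by (intro sum.mono_neutral_cong_left) auto
    ultimately show ?thesis by (simp add: q_def distrib_right sum.distrib)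
  qed
  then show ?thesis unfolding trigpoly_def using K K' by (intro exI[of _ "K \<union> K'"] exI[of _ q]) auto
qed

lemma trigpoly_sum:
  assumes "finite I" "\<And>i. i \<in> I \<Longrightarrow> trigpoly L (f i)"
  shows "trigpoly L (\<lambda>t. \<Sum>i\<in>I. f i t)"
  using assms
proof (induction I rule: finite_induct)
  case empty
  show ?case using trigpoly_mode[of L 0 0] by simp
next
  case (insert i I)
  then show ?case by (simp add: trigpoly_add)
qed

lemma trigpoly_mult:
  assumes "trigpoly L f" "trigpoly L g"
  shows "trigpoly L (\<lambda>t. f t * g t)"
proof -
  obtain K p where K: "finite K" and f: "f = (\<lambda>t. \<Sum>k\<in>K. p k * fmode L k t)"
    using assms(1) unfolding trigpoly_def by blast
  obtain K' p' where K': "finite K'" and g: "g = (\<lambda>t. \<Sum>k\<in>K'. p' k * fmode L k t)"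
    using assms(2) unfolding trigpoly_def by blast
  have "f t * g t = (\<Sum>k\<in>K. \<Sum>l\<in>K'. (p k * p' l) * fmode L (k + l) t)" for t
    unfolding f g sum_product by (simp add: fmode_add mult_ac)
  then show ?thesis
    by (simp only:) (intro trigpoly_sum K K' trigpoly_mode)
qed

text \<open>A real-linear functional of \<open>z\<close> combines
  \<open>Re z = (z + cnj z) / 2\<close> and \<open>Im z = (z - cnj z) / (2 * \<i>)\<close>, and on
  the circle \<open>z\<close> and \<open>cnj z\<close> are the modes 1 and -1. Sums and products
  stay within trigonometric polynomials.\<close>

lemma trigpoly_real_polynomial:
  assumes "real_polynomial_function h"
  shows "trigpoly L (\<lambda>t. complex_of_real (h (fmode L 1 t)))"
  using assms
proof (induction h rule: real_polynomial_function.induct)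
  case (linear h)
  interpret bounded_linear h by fact
  define a where "a = complex_of_real (h 1)"
  define b where "b = complex_of_real (h \<i>)"
  have "complex_of_real (h (fmode L 1 t))
      = (a - \<i> * b) / 2 * fmode L 1 t + (a + \<i> * b) / 2 * fmode L (-1) t" for t
  proof -
    have "h (fmode L 1 t) = h (Re (fmode L 1 t) *\<^sub>R 1 + Im (fmode L 1 t) *\<^sub>R \<i>)"
      by (rule arg_cong[of _ _ h]) (simp add: complex_eq_iff)
    also have "\<dots> = Re (fmode L 1 t) * h 1 + Im (fmode L 1 t) * h \<i>"
      by (simp only: add scaleR) simp
    finally show ?thesis
      by (simp add: a_def b_def fmode_def complex_eq_iff field_simps)
  qed
  then show ?case by (simp only:) (intro trigpoly_add trigpoly_mode)
next
  case (const c)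
  show ?case using trigpoly_mode[of L "of_real c" 0] by simp
qed (auto intro: trigpoly_add trigpoly_mult)

lemma trigpoly_polynomial:
  assumes "polynomial_function h"
  shows "trigpoly L (\<lambda>t. h (fmode L 1 t))"
proof -
  have "real_polynomial_function (Re \<circ> h)" "real_polynomial_function (Im \<circ> h)"
    using assms bounded_linear_Re bounded_linear_Im unfolding polynomial_function_def by blast+
  then have "trigpoly L (\<lambda>t. complex_of_real ((Re \<circ> h) (fmode L 1 t))
      + (\<i> * fmode L 0 t) * complex_of_real ((Im \<circ> h) (fmode L 1 t)))"
    by (intro trigpoly_add trigpoly_mult trigpoly_mode trigpoly_real_polynomial)
  also have "(\<lambda>t. complex_of_real ((Re \<circ> h) (fmode L 1 t))
      + (\<i> * fmode L 0 t) * complex_of_real ((Im \<circ> h) (fmode L 1 t))) = (\<lambda>t. h (fmode L 1 t))"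
    by (rule ext) (simp add: complex_eq_iff)
  finally show ?thesis .
qed

text \<open>Since \<open>C 0 = C L\<close>, the function descends to the unit circle, where
  Stone-Weierstrass applies.\<close>

lemma trigpoly_uniform_approx:
  assumes L: "L > 0" and C: "continuous_on {0..L} C" and C0: "C 0 = C L" and e: "e > 0"
  obtains P where "trigpoly L P" "\<And>t. t \<in> {0..L} \<Longrightarrow> cmod (C t - P t) < e"
proof -
  define p where "p t = C (L * t)" for t
  have "continuous_on {0..1} p"
    unfolding p_def using L
    by (intro continuous_on_compose2[OF C]) (auto intro!: continuous_intros simp: mult_left_le)
  \<comment> \<open>Continuity of the descended function on the circle is read off from the trivial
    homotopy of the loop \<open>p\<close> with itself.\<close>
  then have "homotopic_loops UNIV p p"
    by (simp add: homotopic_loops_refl path_def pathfinish_def pathstart_def p_def C0)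
  from homotopic_loops_imp_homotopic_circlemaps[OF this]
  have "continuous_on (sphere 0 1) (p \<circ> (\<lambda>z. Arg2pi z / (2 * pi)))"
    by (rule homotopic_with_imp_continuous[THEN conjunct1])
  then obtain h where h: "polynomial_function h"
    and he: "\<And>z. z \<in> sphere 0 1 \<Longrightarrow> cmod ((p \<circ> (\<lambda>z. Arg2pi z / (2 * pi))) z - h z) < e"
    using Stone_Weierstrass_polynomial_function[of "sphere (0::complex) 1" "p \<circ> (\<lambda>z. Arg2pi z / (2 * pi))" e] e
    by auto
  show thesis
  proof
    show "trigpoly L (\<lambda>t. h (fmode L 1 t))" by (rule trigpoly_polynomial[OF h])
    fix t assume t: "t \<in> {0..L}"
    have "p (Arg2pi (fmode L 1 t) / (2 * pi)) = C t"
    \<comment> \<open>\<open>Arg2pi\<close> takes values in \<open>[0, 2 pi)\<close>, so at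
      \<open>t = L\<close> it falls back to \<open>0\<close>; there \<open>C 0 = C L\<close> is
      needed.\<close>
    proof (cases "t = L")
      case True
      then have "fmode L 1 t = 1" using fmode_periodic[of L 1 0] L by simp
      moreover have "Arg2pi 1 = 0" by (rule Arg2pi_unique[of 1]) auto
      ultimately show ?thesis using True C0 by (simp add: p_def)
    next
      case False
      have "Arg2pi (fmode L 1 t) = 2 * pi * t / L"
        by (rule Arg2pi_unique[of 1]) (use t False L in \<open>auto simp: fmode_def cis_conv_exp field_simps\<close>)
      then show ?thesis using L by (simp add: p_def)
    qed
    then show "cmod (C t - h (fmode L 1 t)) < e"
      using he[of "fmode L 1 t"] by simp
  qed
qed

text \<open>A continuous function on an interval need not close up on the circle. A steep ramp near
  \<open>L\<close> closes the gap \<open>\<gamma>\<close> at small \<open>L\<^sup>1\<close> cost,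
  after which uniform approximation is possible.\<close>

lemma trigpoly_L1_approx:
  assumes L: "L > 0" and G: "continuous_on {0..L} G" and e: "e > 0"
  obtains K p where "finite K"
    "(LINT r:{0..L}|lborel. cmod (G r - (\<Sum>k\<in>K. p k * fmode L k r))) < e"
proof -
  define \<gamma> where "\<gamma> = G 0 - G L"
  \<comment> \<open>This width makes the ramp cost less than \<open>e / 2\<close>;
    \<open>d \<le> L\<close> keeps \<open>C 0 = G 0\<close>, and the \<open>+ 1\<close> covers
    \<open>\<gamma> = 0\<close>.\<close>
  define d where "d = min L (e / (2 * (cmod \<gamma> + 1)))"
  have d: "0 < d" "d \<le> L" using L e by (auto simp: d_def add_nonneg_pos)
  have "cmod \<gamma> * d \<le> cmod \<gamma> * (e / (2 * (cmod \<gamma> + 1)))"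
    by (intro mult_left_mono) (auto simp: d_def)
  also have "\<dots> < e / 2"
  proof -
    have "cmod \<gamma> / (cmod \<gamma> + 1) < 1" by (simp add: divide_less_eq add_nonneg_pos)
    then show ?thesis using e mult_strict_left_mono[of "cmod \<gamma> / (cmod \<gamma> + 1)" 1 "e/2"] by (simp add: mult.commute)
  qed
  finally have d2: "cmod \<gamma> * d < e / 2" .
  define C where "C r = G r + \<gamma> * complex_of_real (max 0 (1 - (L - r) / d))" for r
  have "continuous_on {0..L} C"
    unfolding C_def using d by (intro continuous_intros G) auto
  moreover have "C 0 = C L"
    using d by (simp add: C_def \<gamma>_def field_simps max_def)
  ultimately obtain P where P: "trigpoly L P" and PC: "\<And>t. t \<in> {0..L} \<Longrightarrow> cmod (C t - P t) < e / (2 * L)"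
    using trigpoly_uniform_approx[OF L, of C "e / (2 * L)"] L e by auto
  obtain K p where K: "finite K" and Peq: "P = (\<lambda>t. \<Sum>k\<in>K. p k * fmode L k t)"
    using P unfolding trigpoly_def by blast
  have "(LINT r:{0..L}|lborel. cmod (G r - P r))
    \<le> (LINT r|lborel. cmod \<gamma> * indicat_real {L-d..L} r + e / (2 * L) * indicat_real {0..L} r)"
    unfolding set_lebesgue_integral_def
  proof (rule integral_mono')
    fix r
    show "indicat_real {0..L} r *\<^sub>R cmod (G r - P r)
      \<le> cmod \<gamma> * indicat_real {L-d..L} r + e / (2 * L) * indicat_real {0..L} r"
    proof (cases "r \<in> {0..L}")
      case True
      have "cmod (G r - C r) = cmod \<gamma> * max 0 (1 - (L - r) / d)"
        by (simp add: C_def norm_mult)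
      also have "\<dots> \<le> cmod \<gamma> * indicat_real {L-d..L} r"
        using True d by (intro mult_left_mono) (auto simp: indicator_def field_simps)
      finally have "cmod (G r - C r) \<le> cmod \<gamma> * indicat_real {L-d..L} r" .
      then show ?thesis
        using PC[OF True] norm_triangle_ineq[of "G r - C r" "C r - P r"] True by simp
    qed simp
  qed (use e L in \<open>auto intro!: Bochner_Integration.integrable_add integrable_mult_right add_nonneg_nonneg\<close>)
  also have "\<dots> = cmod \<gamma> * d + e / (2 * L) * L"
    using d L by simp
  also have "\<dots> < e" using d2 L by simp
  finally show thesis using K unfolding Peq by (rule that[rotated])
qed

section \<open>Convolution equations on the circle\<close>

text \<open>One class for the continuous unknowns and for the kernels cut off at \<open>L\<close>:
  closed under sums and products, and integrable over bounded intervals.\<close>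

definition bounded_borel :: "(real \<Rightarrow> complex) \<Rightarrow> bool" where
  "bounded_borel h \<longleftrightarrow> h \<in> borel_measurable borel \<and> bounded (range h)"

lemma bounded_borelI:
  assumes "h \<in> borel_measurable borel" "\<And>x. cmod (h x) \<le> M"
  shows "bounded_borel h"
  using assms by (auto simp: bounded_borel_def bounded_iff)

lemma bounded_borelE:
  assumes "bounded_borel h"
  obtains M where "h \<in> borel_measurable borel" "M \<ge> 0" "\<And>x. cmod (h x) \<le> M"
  using assms that unfolding bounded_borel_def bounded_pos by (metis less_imp_le rangeI)

lemma bounded_borel_continuous:
  "continuous_on UNIV h \<Longrightarrow> bounded (range h) \<Longrightarrow> bounded_borel h"
  by (simp add: bounded_borel_def borel_measurable_continuous_onI)

lemma bounded_borel_mode [simp]: "bounded_borel (fmode L k)"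
  by (rule bounded_borelI[of _ 1]) auto

lemma bounded_borel_add: "bounded_borel f \<Longrightarrow> bounded_borel g \<Longrightarrow> bounded_borel (\<lambda>x. f x + g x)"
  unfolding bounded_borel_def by (auto intro: bounded_plus_comp)

lemma bounded_borel_mult:
  assumes "bounded_borel f" "bounded_borel g"
  shows "bounded_borel (\<lambda>x. f x * g x)"
proof -
  obtain M where M: "f \<in> borel_measurable borel" "M \<ge> 0" "\<And>x. cmod (f x) \<le> M" by (rule bounded_borelE[OF assms(1)]) (rule that)
  obtain N where N: "g \<in> borel_measurable borel" "N \<ge> 0" "\<And>x. cmod (g x) \<le> N" by (rule bounded_borelE[OF assms(2)]) (rule that)
  show ?thesis
    using M N by (intro bounded_borelI[of _ "M * N"]) (auto simp: norm_mult intro!: mult_mono)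
qed

lemma bounded_borel_const [simp]: "bounded_borel (\<lambda>_. c)"
  by (rule bounded_borelI[of _ "cmod c"]) auto

lemma bounded_borel_sum:
  "finite I \<Longrightarrow> (\<And>i. i \<in> I \<Longrightarrow> bounded_borel (f i)) \<Longrightarrow> bounded_borel (\<lambda>x. \<Sum>i\<in>I. f i x)"
  by (induction I rule: finite_induct) (auto intro: bounded_borel_add)

lemma bounded_borel_integrable:
  assumes "bounded_borel h"
  shows "integrable lborel (\<lambda>x. indicat_real {a..b} x *\<^sub>R h x)"
proof -
  obtain M where [measurable]: "h \<in> borel_measurable borel" and M: "M \<ge> 0" "\<And>x. cmod (h x) \<le> M" by (rule bounded_borelE[OF assms]) (rule that)
  show ?thesis
    by (rule Bochner_Integration.integrable_bound[of _ "\<lambda>x. M * indicat_real {a..b} x"])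
       (use M in \<open>auto intro!: integrable_mult_right split: split_indicator\<close>)
qed

text \<open>Convolution on the circle of length \<open>L\<close> with the \<open>L\<close>-periodic extension of a kernel \<open>H\<close>
  supported in \<open>[0,L)\<close>: for \<open>t, s \<in> [0,L]\<close> the extension is evaluated at \<open>t - s\<close>.\<close>

definition pconv :: "real \<Rightarrow> (real \<Rightarrow> complex) \<Rightarrow> (real \<Rightarrow> complex) \<Rightarrow> real \<Rightarrow> complex" where
  "pconv L H w t = (LINT s:{0..L}|lborel. (H (t - s) + H (t - s + L)) * w s)"

lemma bounded_borel_kernel:
  assumes "bounded_borel H"
  shows "bounded_borel (\<lambda>s. H (t - s) + H (t - s + L))"
proof -
  obtain M where [measurable]: "H \<in> borel_measurable borel" and M: "M \<ge> 0" "\<And>x. cmod (H x) \<le> M" by (rule bounded_borelE[OF assms]) (rule that)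
  have "cmod (H (t - s) + H (t - s + L)) \<le> M + M" for s
    using norm_triangle_ineq M(2) add_mono order_trans by metis
  then show ?thesis by (intro bounded_borelI[of _ "M + M"]) auto
qed

lemma pconv_integrable:
  assumes "bounded_borel H" "bounded_borel w"
  shows "integrable lborel (\<lambda>s. indicat_real {0..L} s *\<^sub>R ((H (t - s) + H (t - s + L)) * w s))"
  by (intro bounded_borel_integrable bounded_borel_mult bounded_borel_kernel assms)

lemma pconv_add_left:
  assumes "bounded_borel H" "bounded_borel H'" "bounded_borel w"
  shows "pconv L (\<lambda>x. H x + H' x) w t = pconv L H w t + pconv L H' w t"
proof -
  have "pconv L (\<lambda>x. H x + H' x) w t
      = (LINT s|lborel. indicat_real {0..L} s *\<^sub>R ((H (t - s) + H (t - s + L)) * w s)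
          + indicat_real {0..L} s *\<^sub>R ((H' (t - s) + H' (t - s + L)) * w s))"
    unfolding pconv_def set_lebesgue_integral_def
    by (intro Bochner_Integration.integral_cong refl) (simp add: algebra_simps)
  then show ?thesis
    unfolding pconv_def set_lebesgue_integral_def
    using pconv_integrable[OF assms(1,3)] pconv_integrable[OF assms(2,3)] by simp
qed

lemma pconv_add_right:
  assumes "bounded_borel H" "bounded_borel w" "bounded_borel w'"
  shows "pconv L H (\<lambda>x. w x + w' x) t = pconv L H w t + pconv L H w' t"
  unfolding pconv_def set_lebesgue_integral_def
  by (subst Bochner_Integration.integral_add[symmetric])
     (auto intro!: pconv_integrable assms Bochner_Integration.integral_cong simp: distrib_left scaleR_add_right)

lemma pconv_cmult_right: "pconv L H (\<lambda>x. c * w x) t = c * pconv L H w t"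
proof -
  have "pconv L H (\<lambda>x. c * w x) t
      = (LINT s|lborel. c * (indicat_real {0..L} s *\<^sub>R ((H (t - s) + H (t - s + L)) * w s)))"
    unfolding pconv_def set_lebesgue_integral_def
    by (intro Bochner_Integration.integral_cong refl) (simp add: algebra_simps)
  then show ?thesis
    unfolding pconv_def set_lebesgue_integral_def integral_mult_right_zero .
qed

lemma pconv_sum_right:
  assumes "bounded_borel H" "finite I" "\<And>i. i \<in> I \<Longrightarrow> bounded_borel (w i)"
  shows "pconv L H (\<lambda>x. \<Sum>i\<in>I. w i x) t = (\<Sum>i\<in>I. pconv L H (w i) t)"
  using assms(2,3)
proof (induction I rule: finite_induct)
  case empty
  show ?case by (simp add: pconv_def)
next
  case (insert i I)
  then show ?case by (simp add: pconv_add_right assms(1) bounded_borel_sum)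
qed

text \<open>As \<open>s\<close> runs over \<open>[0, L]\<close>, the arguments \<open>t - s\<close>
  and \<open>t - s + L\<close> sweep \<open>[t - L, t]\<close> and \<open>[t, t + L]\<close>. These
  cover the support of \<open>H\<close> and meet only in \<open>t\<close>.\<close>

lemma periodization_integral:
  fixes H :: "real \<Rightarrow> complex"
  assumes H: "integrable lborel H" and supp: "\<And>x. x \<notin> {0..<L} \<Longrightarrow> H x = 0" and t: "t \<in> {0..L}"
  shows "(LINT s:{0..L}|lborel. H (t - s) + H (t - s + L)) = (LINT r|lborel. H r)"
proof -
  have i1: "integrable lborel (\<lambda>r. indicat_real {t-L..t} r *\<^sub>R H r)"
    and i2: "integrable lborel (\<lambda>r. indicat_real {t..t+L} r *\<^sub>R H r)"
    using H by (auto intro: integrable_mult_indicator)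
  have e1: "indicat_real {0..L} s *\<^sub>R H (t - s) = indicat_real {t-L..t} (t - s) *\<^sub>R H (t - s)"
    and e2: "indicat_real {0..L} s *\<^sub>R H (t - s + L) = indicat_real {t..t+L} (t + L - s) *\<^sub>R H (t + L - s)" for s
    by (auto simp: indicator_def algebra_simps)
  have "(LINT s:{0..L}|lborel. H (t - s) + H (t - s + L))
     = (LINT s|lborel. indicat_real {t-L..t} (t - s) *\<^sub>R H (t - s)
          + indicat_real {t..t+L} (t + L - s) *\<^sub>R H (t + L - s))"
    unfolding set_lebesgue_integral_def by (simp only: scaleR_add_right e1 e2)
  also have "\<dots> = (LINT r|lborel. indicat_real {t-L..t} r *\<^sub>R H r) + (LINT r|lborel. indicat_real {t..t+L} r *\<^sub>R H r)"
    using lborel_integrable_shift(2)[OF i1, of t] lborel_integrable_shift(2)[OF i2, of "t + L"]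
      lborel_integral_shift(2)[of "\<lambda>r. indicat_real {t-L..t} r *\<^sub>R H r" t]
      lborel_integral_shift(2)[of "\<lambda>r. indicat_real {t..t+L} r *\<^sub>R H r" "t + L"]
    by (subst Bochner_Integration.integral_add) simp_all
  also have "\<dots> = (LINT r|lborel. indicat_real {t-L..t} r *\<^sub>R H r + indicat_real {t..t+L} r *\<^sub>R H r)"
    using i1 i2 by simp
  also have "\<dots> = (LINT r|lborel. H r)"
  proof (rule integral_cong_AE)
    have "AE r in lborel. r \<noteq> t" by (rule AE_lborel_singleton)
    then show "AE r in lborel. indicat_real {t-L..t} r *\<^sub>R H r + indicat_real {t..t+L} r *\<^sub>R H r = H r"
      by eventually_elim (use t supp in \<open>force simp: indicator_def\<close>)
  qed (use H i1 i2 in measurable)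
  finally show ?thesis .
qed

text \<open>From \<open>fmode L k s = fmode L k t * fmode L (- k) (t - s)\<close> the factor in
  \<open>t\<close> leaves the integral; periodicity treats both translates alike, and one full
  period remains, whose integral is independent of \<open>t\<close>.\<close>

lemma pconv_mode:
  assumes L: "L > 0" and H: "bounded_borel H" and supp: "\<And>x. x \<notin> {0..<L} \<Longrightarrow> H x = 0"
    and t: "t \<in> {0..L}"
  shows "pconv L H (fmode L k) t = fmode L k t * (LINT r:{0..L}|lborel. H r * fmode L (- k) r)"
proof -
  define H' where "H' r = H r * fmode L (- k) r" for r
  have ind: "indicat_real {0..L} x *\<^sub>R H' x = H' x" for x
    using supp[of x] by (auto simp: H'_def indicator_def)
  have "bounded_borel H'"
    unfolding H'_def by (intro bounded_borel_mult H bounded_borel_mode)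
  from bounded_borel_integrable[OF this, of 0 L] have H'i: "integrable lborel H'"
    by (simp only: ind)
  have "(H (t - s) + H (t - s + L)) * fmode L k s = fmode L k t * (H' (t - s) + H' (t - s + L))" for s
  proof -
    have "fmode L k s = fmode L k (t - (t - s))" by simp
    also have "\<dots> = fmode L k t * fmode L (- k) (t - s)" by (rule fmode_diff)
    finally show ?thesis
      using fmode_periodic[of L "-k" "t - s"] L by (simp add: H'_def algebra_simps)
  qed
  then have "pconv L H (fmode L k) t = fmode L k t * (LINT s:{0..L}|lborel. H' (t - s) + H' (t - s + L))"
    by (simp add: pconv_def)
  also have "(LINT s:{0..L}|lborel. H' (t - s) + H' (t - s + L)) = (LINT r|lborel. H' r)"
    by (rule periodization_integral[OF H'i _ t]) (simp add: H'_def supp)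
  also have "\<dots> = (LINT r:{0..L}|lborel. H' r)"
    unfolding set_lebesgue_integral_def by (simp only: ind)
  finally show ?thesis by (simp add: H'_def)
qed

text \<open>A trigonometric kernel gives an operator of finite rank: splitting each mode of the
  kernel at \<open>t - s\<close> leaves Fourier integrals of \<open>w\<close> as
  coefficients.\<close>

lemma pconv_trigpoly:
  assumes L: "L > 0" and K: "finite K" and w: "bounded_borel w" and t: "t \<in> {0..L}"
  shows "pconv L (\<lambda>r. indicat_real {0..<L} r *\<^sub>R (\<Sum>k\<in>K. p k * fmode L k r)) w t
    = (\<Sum>k\<in>K. p k * (LINT s:{0..L}|lborel. fmode L (- k) s * w s) * fmode L k t)" (is "pconv L ?P w t = _")
proof -
  have [measurable]: "w \<in> borel_measurable borel" using w by (simp add: bounded_borel_def)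
  have "pconv L ?P w t = (LINT s|lborel. (\<Sum>k\<in>K. p k * fmode L k t * (indicat_real {0..L} s *\<^sub>R (fmode L (- k) s * w s))))"
    unfolding pconv_def set_lebesgue_integral_def
  proof (rule integral_cong_AE)
    have "AE s in lborel. s \<noteq> (0::real)" by (rule AE_lborel_singleton)
    then show "AE s in lborel. indicat_real {0..L} s *\<^sub>R ((?P (t - s) + ?P (t - s + L)) * w s)
       = (\<Sum>k\<in>K. p k * fmode L k t * (indicat_real {0..L} s *\<^sub>R (fmode L (- k) s * w s)))"
    proof eventually_elim
      case (elim s)
      show ?case
      proof (cases "s \<in> {0..L}")
        case True
        \<comment> \<open>For \<open>s \<noteq> 0\<close> exactly one of \<open>t - s\<close> and
          \<open>t - s + L\<close> lies in \<open>[0, L)\<close>. For \<open>s = 0\<close> and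
          \<open>t = L\<close> neither does.\<close>
        have "?P (t - s) + ?P (t - s + L) = (\<Sum>k\<in>K. p k * fmode L k (t - s))"
          using True elim t L fmode_periodic[of L _ "t - s"] by (auto simp: indicator_def)
        then show ?thesis using True
          by (simp add: fmode_diff sum_distrib_left mult_ac)
      qed simp
    qed
  qed (measurable)
  also have "\<dots> = (\<Sum>k\<in>K. LINT s|lborel. p k * fmode L k t * (indicat_real {0..L} s *\<^sub>R (fmode L (- k) s * w s)))"
    by (intro Bochner_Integration.integral_sum integrable_mult_right bounded_borel_integrable bounded_borel_mult w bounded_borel_mode)
  finally show ?thesis
    unfolding set_lebesgue_integral_def integral_mult_right_zero by (simp add: mult_ac)
qed

text \<open>The factor 2 arises because each of the two translates of the kernel is estimated by its
  integral over the whole line. It dictates the threshold \<open>1/4\<close> in the contraction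
  argument.\<close>

lemma pconv_bound:
  assumes H: "bounded_borel H" and Hi: "integrable lborel H" and w: "w \<in> borel_measurable borel"
    and B: "\<And>x. cmod (w x) \<le> B"
  shows "cmod (pconv L H w t) \<le> 2 * (LINT r|lborel. cmod (H r)) * B"
proof -
  have i: "integrable lborel (\<lambda>s. cmod (H (t - s)))" "integrable lborel (\<lambda>s. cmod (H (t - s + L)))"
    using lborel_integrable_shift(2)[OF Hi, of t] lborel_integrable_shift(2)[OF Hi, of "t + L"]
    by (auto intro!: integrable_norm simp: algebra_simps)
  have B0: "B \<ge> 0" using B[of 0] norm_ge_zero order_trans by blast
  have "cmod (pconv L H w t) \<le> (LINT s|lborel. (cmod (H (t - s)) + cmod (H (t - s + L))) * B)"
    unfolding pconv_def set_lebesgue_integral_def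
  proof (rule Bochner_Integration.integral_norm_bound_integral)
    fix s
    have "cmod ((H (t - s) + H (t - s + L)) * w s) \<le> (cmod (H (t - s)) + cmod (H (t - s + L))) * B"
      unfolding norm_mult by (intro mult_mono norm_triangle_ineq B) auto
    then show "cmod (indicat_real {0..L} s *\<^sub>R ((H (t - s) + H (t - s + L)) * w s))
      \<le> (cmod (H (t - s)) + cmod (H (t - s + L))) * B"
      using B0 by (auto simp: indicator_def)
  qed (use i in \<open>auto intro!: pconv_integrable[OF H] bounded_borelI[OF w B]\<close>)
  also have "\<dots> = 2 * (LINT r|lborel. cmod (H r)) * B"
    using i lborel_integral_shift(2)[of "\<lambda>r. cmod (H r)" t] lborel_integral_shift(2)[of "\<lambda>r. cmod (H r)" "t + L"]
    by (simp add: algebra_simps)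
  finally show ?thesis .
qed

text \<open>The kernel may jump at \<open>0\<close> and \<open>L\<close>. In the limit
  \<open>a\<close> this affects only \<open>s = a\<close>, \<open>s = a - L\<close> and
  \<open>s = a + L\<close>, a null set, so dominated convergence still applies.\<close>

lemma continuous_on_pconv:
  assumes H: "bounded_borel H" and w: "bounded_borel w"
    and cont: "\<And>x. x \<notin> {0, L} \<Longrightarrow> isCont H x"
  shows "continuous_on UNIV (pconv L H w)"
  unfolding continuous_on_sequentially o_def
proof (intro ballI allI impI, elim conjE)
  fix a :: real and x :: "nat \<Rightarrow> real" assume x: "x \<longlonglongrightarrow> a"
  have [measurable]: "w \<in> borel_measurable borel" "H \<in> borel_measurable borel"
    using w H by (simp_all add: bounded_borel_def)
  obtain M where M: "M \<ge> 0" "\<And>x. cmod (H x) \<le> M" by (rule bounded_borelE[OF H]) (rule that)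
  obtain B where B: "B \<ge> 0" "\<And>x. cmod (w x) \<le> B" by (rule bounded_borelE[OF w]) (rule that)
  show "(\<lambda>n. pconv L H w (x n)) \<longlonglongrightarrow> pconv L H w a"
    unfolding pconv_def set_lebesgue_integral_def
  proof (rule integral_dominated_convergence[where w="\<lambda>s. (M + M) * B * indicat_real {0..L} s"])
    have "AE s in lborel. s \<noteq> a" "AE s in lborel. s \<noteq> a - L" "AE s in lborel. s \<noteq> a + L"
      by (rule AE_lborel_singleton)+
    then show "AE s in lborel. (\<lambda>n. indicat_real {0..L} s *\<^sub>R ((H (x n - s) + H (x n - s + L)) * w s))
       \<longlonglongrightarrow> indicat_real {0..L} s *\<^sub>R ((H (a - s) + H (a - s + L)) * w s)"
    proof eventually_elim
      case (elim s)
      have "isCont H (a - s)" "isCont H (a - s + L)"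
        using elim by (auto intro!: cont)
      then have "(\<lambda>n. H (x n - s)) \<longlonglongrightarrow> H (a - s)" "(\<lambda>n. H (x n - s + L)) \<longlonglongrightarrow> H (a - s + L)"
        by (auto intro!: isCont_tendsto_compose[of _ H] tendsto_intros x)
      then show ?case by (intro tendsto_intros)
    qed
    fix n
    show "AE s in lborel. norm (indicat_real {0..L} s *\<^sub>R ((H (x n - s) + H (x n - s + L)) * w s))
      \<le> (M + M) * B * indicat_real {0..L} s"
    proof (intro AE_I2)
      fix s
      have "cmod (H (x n - s) + H (x n - s + L)) \<le> M + M"
        using norm_triangle_ineq M(2) add_mono order_trans by metis
      then have "cmod ((H (x n - s) + H (x n - s + L)) * w s) \<le> (M + M) * B"
        unfolding norm_mult using B M by (intro mult_mono) auto
      then show "norm (indicat_real {0..L} s *\<^sub>R ((H (x n - s) + H (x n - s + L)) * w s))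
        \<le> (M + M) * B * indicat_real {0..L} s"
        by (auto simp: indicator_def)
    qed
  qed (auto intro!: integrable_mult_right)
qed

text \<open>Banach's fixed point theorem in the bounded continuous functions on the line: by
  \<open>pconv_bound\<close> the threshold \<open>1/4\<close> gives the contraction factor
  \<open>1/2\<close>.\<close>

lemma pconv_fixpoint:
  assumes H: "bounded_borel H" and Hi: "integrable lborel H"
    and cont: "\<And>x. x \<notin> {0, L} \<Longrightarrow> isCont H x"
    and small: "(LINT r|lborel. cmod (H r)) < 1/4"
    and f: "continuous_on UNIV f" "bounded (range f)"
  obtains w where "continuous_on UNIV w" "bounded (range w)" "\<And>t. w t = f t + pconv L H w t"
proof -
  define \<Phi> where "\<Phi> w = Bcontfun (\<lambda>t. f t + pconv L H (apply_bcontfun w) t)" for w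
  have bb: "bounded_borel (apply_bcontfun w)" for w :: "real \<Rightarrow>\<^sub>C complex"
    by (intro bounded_borel_continuous) auto
  have ap: "apply_bcontfun (\<Phi> w) = (\<lambda>t. f t + pconv L H (apply_bcontfun w) t)" for w
  proof -
    have "bounded (range (\<lambda>t. f t + pconv L H (apply_bcontfun w) t))"
    proof (rule bounded_plus_comp[OF f(2)])
      obtain B where "\<And>x. cmod (apply_bcontfun w x) \<le> B" by (rule bounded_borelE[OF bb[of w]]) (rule that)
      then have "cmod (pconv L H (apply_bcontfun w) t) \<le> 2 * (LINT r|lborel. cmod (H r)) * B" for t
        using bb[of w] by (intro pconv_bound[OF H Hi]) (auto simp: bounded_borel_def)
      then show "bounded (range (pconv L H (apply_bcontfun w)))"
        unfolding bounded_iff by blast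
    qed
    then have "(\<lambda>t. f t + pconv L H (apply_bcontfun w) t) \<in> bcontfun"
      unfolding bcontfun_def using continuous_on_pconv[OF H bb cont] f(1)
      by (auto intro!: continuous_intros)
    then show ?thesis unfolding \<Phi>_def by (rule Bcontfun_inverse)
  qed
  have "dist (\<Phi> v) (\<Phi> w) \<le> (1/2) * dist v w" for v w
  proof (rule dist_bound)
    fix t
    have bd: "bounded_borel (\<lambda>s. apply_bcontfun v s - apply_bcontfun w s)"
      using bounded_borel_add[OF bb[of v] bounded_borel_mult[OF bounded_borel_const[of "-1"] bb[of w]]] by simp
    have "pconv L H (apply_bcontfun v) t
        = pconv L H (\<lambda>s. apply_bcontfun w s + (apply_bcontfun v s - apply_bcontfun w s)) t" by simp
    also have "\<dots> = pconv L H (apply_bcontfun w) t + pconv L H (\<lambda>s. apply_bcontfun v s - apply_bcontfun w s) t"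
      by (rule pconv_add_right[OF H bb bd])
    finally have "dist (\<Phi> v t) (\<Phi> w t) = cmod (pconv L H (\<lambda>s. apply_bcontfun v s - apply_bcontfun w s) t)"
      by (simp add: ap dist_norm)
    also have "\<dots> \<le> 2 * (LINT r|lborel. cmod (H r)) * dist v w"
      using bd dist_bounded[of v _ w]
      by (intro pconv_bound[OF H Hi]) (auto simp: bounded_borel_def dist_norm)
    also have "\<dots> \<le> (1/2) * dist v w"
      using small by (intro mult_right_mono) auto
    finally show "dist (\<Phi> v t) (\<Phi> w t) \<le> (1/2) * dist v w" .
  qed
  then obtain w where "\<Phi> w = w"
    using banach_fix_type[of "1/2" \<Phi>] by auto
  then have "apply_bcontfun w t = f t + pconv L H (apply_bcontfun w) t" for t
    using ap[of w] by metis
  then show thesis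
    by (rule that[OF continuous_on_apply_bcontfun bounded_apply_bcontfun])
qed

text \<open>Split the kernel into a trigonometric polynomial \<open>P\<close> and a remainder \<open>R\<close> that is small in
  \<open>L\<^sup>1\<close>, and solve \<open>w = f + R * w\<close> by contraction. Since Fourier modes are eigenfunctions of every
  convolution, adding a suitable multiple of each mode of \<open>P\<close> corrects \<open>w\<close> to a solution of
  \<open>m - G * m = f + const\<close>; the mode \<open>k = 0\<close> is free and is used to arrange \<open>m 0 = f 0\<close>.\<close>

lemma circulant_equation_solvable:
  fixes G f :: "real \<Rightarrow> complex"
  assumes L: "L > 0" and G: "continuous_on UNIV G"
    and f: "continuous_on UNIV f" "bounded (range f)"
    and nonres: "\<And>k. k \<noteq> 0 \<Longrightarrow> (LINT r:{0..L}|lborel. G r * fmode L (- k) r) \<noteq> 1"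
  defines "G0 \<equiv> \<lambda>r. indicat_real {0..<L} r *\<^sub>R G r"
  obtains m where "continuous_on UNIV m" "bounded (range m)"
    "\<And>t. t \<in> {0..L} \<Longrightarrow> m t = f t + pconv L G0 m t - pconv L G0 m 0"
proof -
  have cut: "bounded_borel (\<lambda>r. indicat_real {0..<L} r *\<^sub>R h r)" "integrable lborel (\<lambda>r. indicat_real {0..<L} r *\<^sub>R h r)"
    if h: "continuous_on UNIV h" for h :: "real \<Rightarrow> complex"
  proof -
    have [measurable]: "h \<in> borel_measurable borel" by (rule borel_measurable_continuous_onI[OF h])
    obtain M where M: "M \<ge> 0" "\<And>x. cmod (indicat_real {0..L} x *\<^sub>R h x) \<le> M"
      using indicator_scaleR_bounded[of "{0..L}" h] continuous_on_subset[OF h] by auto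
    show "bounded_borel (\<lambda>r. indicat_real {0..<L} r *\<^sub>R h r)"
    proof (rule bounded_borelI)
      show "cmod (indicat_real {0..<L} r *\<^sub>R h r) \<le> M" for r
        using M(2)[of r] M(1) by (auto simp: indicator_def split: if_splits)
    qed measurable
    from bounded_borel_integrable[OF this, of 0 L]
    show "integrable lborel (\<lambda>r. indicat_real {0..<L} r *\<^sub>R h r)"
      by (rule Bochner_Integration.integrable_cong[THEN iffD1, rotated -1]) (auto simp: indicator_def)
  qed
  have isc: "isCont (\<lambda>r. indicat_real {0..<L} r *\<^sub>R h r) x"
    if h: "continuous_on UNIV h" and x: "x \<notin> {0, L}" for h :: "real \<Rightarrow> complex" and x
  proof (cases "x \<in> {0<..<L}")
    case True
    then have "\<forall>\<^sub>F r in nhds x. r \<in> {0<..<L}" by (intro eventually_nhds_in_open) auto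
    then have "\<forall>\<^sub>F r in nhds x. indicat_real {0..<L} r *\<^sub>R h r = h r"
      by eventually_elim (auto simp: indicator_def)
    then show ?thesis using h by (subst isCont_cong) (auto simp: continuous_on_eq_continuous_at)
  next
    case False
    then have "\<forall>\<^sub>F r in nhds x. r \<in> - {0..L}" using x by (intro eventually_nhds_in_open) auto
    then have "\<forall>\<^sub>F r in nhds x. indicat_real {0..<L} r *\<^sub>R h r = 0"
      by eventually_elim (auto simp: indicator_def)
    from isCont_cong[OF this] show ?thesis by simp
  qed
  obtain K p where K: "finite K"
    and small: "(LINT r:{0..L}|lborel. cmod (G r - (\<Sum>k\<in>K. p k * fmode L k r))) < 1/4"
    by (rule trigpoly_L1_approx[OF L continuous_on_subset[OF G], of "1/4"]) auto
  define P where "P r = (\<Sum>k\<in>K. p k * fmode L k r)" for r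
  have cP: "continuous_on UNIV P"
    unfolding P_def using L by (intro continuous_intros) auto
  have cGP: "continuous_on UNIV (\<lambda>r. G r - P r)" by (intro continuous_intros G cP)
  define R where "R r = indicat_real {0..<L} r *\<^sub>R (G r - P r)" for r
  define P0 where "P0 r = indicat_real {0..<L} r *\<^sub>R P r" for r
  have R: "bounded_borel R" "integrable lborel R" "\<And>x. x \<notin> {0, L} \<Longrightarrow> isCont R x"
    unfolding R_def using cut[OF cGP] isc[OF cGP] by auto
  have P0: "bounded_borel P0" unfolding P0_def by (rule cut(1)[OF cP])
  have G0: "bounded_borel G0" unfolding G0_def by (rule cut(1)[OF G])
  have RP: "G0 = (\<lambda>r. R r + P0 r)"
    by (auto simp: G0_def R_def P0_def scaleR_diff_right)
  have "(LINT r|lborel. cmod (R r)) = (LINT r|lborel. indicat_real {0..L} r *\<^sub>R cmod (G r - P r))"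
  proof (rule integral_cong_AE)
    have "AE r in lborel. r \<noteq> L" by (rule AE_lborel_singleton)
    then show "AE r in lborel. cmod (R r) = indicat_real {0..L} r *\<^sub>R cmod (G r - P r)"
      by eventually_elim (auto simp: R_def indicator_def)
    show "(\<lambda>r. indicat_real {0..L} r *\<^sub>R cmod (G r - P r)) \<in> borel_measurable lborel"
      using borel_measurable_continuous_onI[OF cGP] by measurable
  qed (use R(2) in measurable)
  with small have smallR: "(LINT r|lborel. cmod (R r)) < 1/4"
    unfolding P_def set_lebesgue_integral_def by simp
  obtain w where w: "continuous_on UNIV w" "bounded (range w)" "\<And>t. w t = f t + pconv L R w t"
    using pconv_fixpoint[of R L f] R smallR f by blast
  have wb: "bounded_borel w" by (rule bounded_borel_continuous[OF w(1,2)])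
  define wh where "wh k = (LINT s:{0..L}|lborel. fmode L (- k) s * w s)" for k
  define \<gamma> where "\<gamma> k = (LINT r:{0..L}|lborel. G0 r * fmode L (- k) r)" for k
  have [measurable]: "G0 \<in> borel_measurable borel" using G0 by (simp add: bounded_borel_def)
  have [measurable]: "G \<in> borel_measurable borel" by (rule borel_measurable_continuous_onI[OF G])
  have \<gamma>_eq: "\<gamma> k = (LINT r:{0..L}|lborel. G r * fmode L (- k) r)" for k
    unfolding \<gamma>_def set_lebesgue_integral_def
  proof (rule integral_cong_AE)
    have "AE r in lborel. r \<noteq> L" by (rule AE_lborel_singleton)
    then show "AE r in lborel. indicat_real {0..L} r *\<^sub>R (G0 r * fmode L (- k) r) = indicat_real {0..L} r *\<^sub>R (G r * fmode L (- k) r)"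
      by eventually_elim (auto simp: G0_def indicator_def)
    show "(\<lambda>r. indicat_real {0..L} r *\<^sub>R (G0 r * fmode L (- k) r)) \<in> borel_measurable lborel"
      by simp
    show "(\<lambda>r. indicat_real {0..L} r *\<^sub>R (G r * fmode L (- k) r)) \<in> borel_measurable lborel"
      by simp
  qed
  \<comment> \<open>Mode \<open>0\<close> is set apart because \<open>1 - \<gamma> 0\<close> may
    vanish.\<close>
  define K' where "K' = K - {0}"
  have K': "finite K'" using K by (simp add: K'_def)
  \<comment> \<open>In mode \<open>k\<close> of \<open>m - G0 * m\<close>, the function
    \<open>w\<close> leaves the defect \<open>- p k * wh k\<close>, and \<open>a k\<close> times the
    mode contributes \<open>a k * (1 - \<gamma> k)\<close>. This choice makes them cancel.\<close>
  define a where "a k = p k * wh k / (1 - \<gamma> k)" for k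
  define c where "c = f 0 - (w 0 + (\<Sum>k\<in>K'. a k))"
  define m where "m t = w t + (\<Sum>k\<in>K'. a k * fmode L k t) + c * fmode L 0 t" for t
  \<comment> \<open>The coefficient left over in mode \<open>0\<close>. Evaluating the equation at
    \<open>t = 0\<close>, where \<open>m 0 = f 0\<close>, identifies it with
    \<open>- pconv L G0 m 0\<close>.\<close>
  define C where "C = c * (1 - \<gamma> 0) - (if 0 \<in> K then p 0 * wh 0 else 0)"
  have main: "m t = f t + C + pconv L G0 m t" if t: "t \<in> {0..L}" for t
  proof -
    have bs: "bounded_borel (\<lambda>t. \<Sum>k\<in>K'. a k * fmode L k t)"
      by (intro bounded_borel_sum K' bounded_borel_mult) auto
    have mode: "pconv L G0 (fmode L k) t = fmode L k t * \<gamma> k" for k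
      unfolding \<gamma>_def by (rule pconv_mode[OF L G0 _ t]) (simp add: G0_def)
    have "pconv L G0 m t = pconv L G0 (\<lambda>t. w t + (\<Sum>k\<in>K'. a k * fmode L k t)) t + pconv L G0 (\<lambda>t. c * fmode L 0 t) t"
      unfolding m_def by (intro pconv_add_right G0 bounded_borel_add wb bs bounded_borel_mult bounded_borel_const bounded_borel_mode)
    also have "pconv L G0 (\<lambda>t. c * fmode L 0 t) t = c * \<gamma> 0"
      by (simp only: pconv_cmult_right mode) simp
    also have "pconv L G0 (\<lambda>t. w t + (\<Sum>k\<in>K'. a k * fmode L k t)) t
        = pconv L G0 w t + pconv L G0 (\<lambda>t. \<Sum>k\<in>K'. a k * fmode L k t) t"
      by (intro pconv_add_right G0 wb bs)
    also have "pconv L G0 (\<lambda>t. \<Sum>k\<in>K'. a k * fmode L k t) t = (\<Sum>k\<in>K'. pconv L G0 (\<lambda>t. a k * fmode L k t) t)"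
      by (intro pconv_sum_right G0 K' bounded_borel_mult bounded_borel_const bounded_borel_mode)
    also have "pconv L G0 w t = pconv L R w t + pconv L P0 w t"
      unfolding RP by (rule pconv_add_left[OF R(1) P0 wb])
    also have "pconv L R w t = w t - f t" using w(3)[of t] by simp
    also have "pconv L P0 w t = (\<Sum>k\<in>K. p k * wh k * fmode L k t)"
      unfolding P0_def P_def wh_def by (rule pconv_trigpoly[OF L K wb t])
    also have "\<dots> = (\<Sum>k\<in>K'. p k * wh k * fmode L k t) + (if 0 \<in> K then p 0 * wh 0 else 0)"
      using K by (auto simp: K'_def sum.remove[of K 0])
    also have "(\<Sum>k\<in>K'. p k * wh k * fmode L k t) = (\<Sum>k\<in>K'. a k * (1 - \<gamma> k) * fmode L k t)"
      using nonres by (intro sum.cong) (auto simp: K'_def a_def \<gamma>_eq)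
    finally show ?thesis
      unfolding m_def C_def
      by (simp add: pconv_cmult_right mode algebra_simps sum.distrib sum_subtractf)
  qed
  show thesis
  proof
    show cm: "continuous_on UNIV m"
      unfolding m_def using L by (intro continuous_intros w(1)) auto
    have "bounded_borel m"
      unfolding m_def by (intro bounded_borel_add wb bounded_borel_sum K' bounded_borel_mult bounded_borel_const bounded_borel_mode)
    then show "bounded (range m)" by (simp add: bounded_borel_def)
    fix t assume t: "t \<in> {0..L}"
    have "m 0 = f 0" by (simp add: m_def c_def)
    then have "C = - pconv L G0 m 0" using main[of 0] L by (simp add: add_eq_0_iff2)
    then show "m t = f t + pconv L G0 m t - pconv L G0 m 0"
      using main[OF t] by simp
  qed
qed

section \<open>The controlled solution\<close>

lemma tendsto_indicator_atLeast:
  fixes y :: real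
  assumes "a \<longlonglongrightarrow> l" "y \<noteq> l"
  shows "(\<lambda>n. indicat_real {a n..} y) \<longlonglongrightarrow> indicat_real {l..} y"
proof (cases "l < y")
  case True
  then have "\<forall>\<^sub>F n in sequentially. a n < y" using assms(1) order_tendstoD(2) by blast
  then have "\<forall>\<^sub>F n in sequentially. indicat_real {a n..} y = indicat_real {l..} y"
    by eventually_elim (use True in auto)
  then show ?thesis by (rule tendsto_eventually)
next
  case False
  then have "y < l" using assms(2) by simp
  then have "\<forall>\<^sub>F n in sequentially. y < a n" using assms(1) order_tendstoD(1) by blast
  then have "\<forall>\<^sub>F n in sequentially. indicat_real {a n..} y = indicat_real {l..} y"
    by eventually_elim (use False \<open>y < l\<close> in auto)
  then show ?thesis by (rule tendsto_eventually)
qed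

lemma tendsto_indicator_atMost:
  fixes y :: real
  assumes "a \<longlonglongrightarrow> l" "y \<noteq> l"
  shows "(\<lambda>n. indicat_real {..a n} y) \<longlonglongrightarrow> indicat_real {..l} y"
proof -
  have "(\<lambda>n. indicat_real {- a n..} (- y)) \<longlonglongrightarrow> indicat_real {- l..} (- y)"
    by (intro tendsto_indicator_atLeast tendsto_intros) (use assms in auto)
  then show ?thesis by (simp add: indicator_def)
qed

text \<open>The indicator of a moving interval converges except at the two limiting endpoints, so
  dominated convergence works for a merely integrable \<open>w\<close>. The parameter lies in a
  metric space so that it can be a number or a pair \<open>(t, x)\<close>.\<close>

lemma continuous_moving_integral:
  fixes w :: "real \<Rightarrow> complex" and \<alpha> \<beta> :: "'a::metric_space \<Rightarrow> real" and k :: "'a \<Rightarrow> real \<Rightarrow> complex"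
  assumes w: "integrable lborel w" and [measurable]: "\<And>p. k p \<in> borel_measurable borel"
    and kB: "\<And>p y. cmod (k p y) \<le> B" and kc: "\<And>y. continuous_on UNIV (\<lambda>p. k p y)"
    and \<alpha>: "continuous_on UNIV \<alpha>" and \<beta>: "continuous_on UNIV \<beta>"
  shows "continuous_on UNIV (\<lambda>p. LINT y:{\<alpha> p..\<beta> p}|lborel. w y * k p y)"
  unfolding continuous_on_sequentially o_def
proof (intro ballI allI impI, elim conjE)
  fix a :: 'a and p :: "nat \<Rightarrow> 'a" assume p: "p \<longlonglongrightarrow> a"
  have [measurable]: "w \<in> borel_measurable borel" using w by auto
  have B: "B \<ge> 0" using kB[of a 0] norm_ge_zero order_trans by blast
  have lim: "(\<lambda>n. h (p n)) \<longlonglongrightarrow> h a" if "continuous_on UNIV h" for h :: "'a \<Rightarrow> 'b::topological_space"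
    using that p by (auto simp: continuous_on_def intro: filterlim_compose tendsto_at_iff_tendsto_nhds[THEN iffD1])
  have ind: "indicat_real {b..c} y = indicat_real {b..} y * indicat_real {..c} y" for b c y
    by (auto simp: indicator_def)
  show "(\<lambda>n. LINT y:{\<alpha> (p n)..\<beta> (p n)}|lborel. w y * k (p n) y) \<longlonglongrightarrow> (LINT y:{\<alpha> a..\<beta> a}|lborel. w y * k a y)"
    unfolding set_lebesgue_integral_def
  proof (rule integral_dominated_convergence[where w="\<lambda>y. cmod (w y) * B"])
    have "AE y in lborel. y \<noteq> \<alpha> a" "AE y in lborel. y \<noteq> \<beta> a" by (rule AE_lborel_singleton)+
    then show "AE y in lborel. (\<lambda>n. indicat_real {\<alpha> (p n)..\<beta> (p n)} y *\<^sub>R (w y * k (p n) y))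
        \<longlonglongrightarrow> indicat_real {\<alpha> a..\<beta> a} y *\<^sub>R (w y * k a y)"
    proof eventually_elim
      case (elim y)
      then show ?case unfolding ind
        by (intro tendsto_intros tendsto_indicator_atLeast tendsto_indicator_atMost lim \<alpha> \<beta> kc)
    qed
    show "AE y in lborel. norm (indicat_real {\<alpha> (p n)..\<beta> (p n)} y *\<^sub>R (w y * k (p n) y)) \<le> cmod (w y) * B" for n
      using kB B by (intro AE_I2) (auto simp: indicator_def norm_mult mult_left_mono)
  qed (use w in auto)
qed

lemma borel_measurable_cnj [measurable]: "cnj \<in> borel_measurable borel"
  by (intro borel_measurable_continuous_onI continuous_intros)

lemma C1_rect_cnj:
  assumes "C1_rect \<tau> L \<phi> \<phi>t \<phi>x"
  shows "C1_rect \<tau> L (\<lambda>t x. cnj (\<phi> t x)) (\<lambda>t x. cnj (\<phi>t t x)) (\<lambda>t x. cnj (\<phi>x t x))"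
  using assms unfolding C1_rect_def
  by (auto simp: case_prod_unfold intro!: continuous_intros has_vector_derivative_cnj)

text \<open>\<open>h t x\<close> is the contribution of the source \<open>g(x) m(t)\<close> to the solution of \<open>u\<^sub>t - u\<^sub>x = g(x) m(t)\<close>.
  As \<open>g\<close> vanishes outside \<open>[0,L]\<close>, no distinction between \<open>x + t \<le> L\<close> and \<open>x + t > L\<close> is needed.\<close>

locale duhamel =
  fixes L :: real and g m :: "real \<Rightarrow> complex"
  assumes L: "L > 0" and g: "integrable lborel g" and g_supp: "\<And>x. x \<notin> {0..L} \<Longrightarrow> g x = 0"
    and m: "continuous_on UNIV m" "bounded (range m)"
begin

definition h :: "real \<Rightarrow> real \<Rightarrow> complex" where
  "h t x = (LINT s:{0..t}|lborel. g (x + t - s) * m s)"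

definition G :: "real \<Rightarrow> complex" where
  "G r = (LINT y:{r..L}|lborel. g y)"

lemma g_meas [measurable]: "g \<in> borel_measurable borel" using g by auto

lemma m_meas [measurable]: "m \<in> borel_measurable borel"
  by (rule borel_measurable_continuous_onI[OF m(1)])

lemma m_bb: "bounded_borel m" by (rule bounded_borel_continuous[OF m])

lemma g_shift: "integrable lborel (\<lambda>x. g (x + c - s))" "integrable lborel (\<lambda>s. g (c - s))"
  using lborel_integrable_shift(1)[OF g, of "c - s"] lborel_integrable_shift(2)[OF g, of c]
  by (simp_all add: algebra_simps)

lemma g_shift_norm: "(LINT x|lborel. cmod (g (x + c - s))) = (LINT x|lborel. cmod (g x))"
  "(LINT s|lborel. cmod (g (c - s))) = (LINT x|lborel. cmod (g x))"
  using lborel_integral_shift(1)[of "\<lambda>x. cmod (g x)" "c - s"] lborel_integral_shift(2)[of "\<lambda>x. cmod (g x)" c]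
  by (simp_all add: algebra_simps)

text \<open>The substitution \<open>y = x + t - s\<close> moves the parameters from
  \<open>g\<close>, which is only integrable, to the continuous \<open>m\<close> and to the
  endpoints.\<close>

lemma continuous_h: "continuous_on UNIV (\<lambda>(t, x). h t x)"
proof -
  obtain B where B: "\<And>x. cmod (m x) \<le> B" by (rule bounded_borelE[OF m_bb]) (rule that)
  have "h t x = (LINT y:{x..x+t}|lborel. g y * m (x + t - y))" for t x
  proof -
    have "h t x = (LINT s|lborel. indicat_real {x..x+t} (x + t - s) *\<^sub>R (g (x + t - s) * m (x + t - (x + t - s))))"
      unfolding h_def set_lebesgue_integral_def
      by (intro Bochner_Integration.integral_cong refl) (auto simp: indicator_def)
    then show ?thesis
      unfolding set_lebesgue_integral_def
      by (simp only: lborel_integral_shift(2)[of "\<lambda>y. indicat_real {x..x+t} y *\<^sub>R (g y * m (x + t - y))" "x + t"])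
  qed
  then have eq: "(\<lambda>(t, x). h t x) = (\<lambda>p. LINT y:{snd p..snd p + fst p}|lborel. g y * m (snd p + fst p - y))"
    by (auto simp: fun_eq_iff)
  show ?thesis
    unfolding eq
    by (intro continuous_moving_integral[OF g _ B] continuous_intros continuous_on_compose2[OF m(1)]) auto
qed

lemma continuous_h_snd: "continuous_on UNIV (h t)"
  using continuous_on_compose_Pair'[of UNIV UNIV h UNIV "\<lambda>_. t" "\<lambda>x. x"] continuous_h by simp

lemma h_meas [measurable]: "(\<lambda>(t, x). h t x) \<in> borel_measurable (borel \<Otimes>\<^sub>M borel)" "h t \<in> borel_measurable borel"
  using borel_measurable_continuous_onI[OF continuous_h] borel_measurable_continuous_onI[OF continuous_h_snd]
  by (auto simp: borel_prod)

text \<open>By Fubini, pairing \<open>h t\<close> with \<open>q\<close> amounts to pairing the pulse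
  emitted at each time \<open>s\<close> with \<open>q\<close>, weighted by \<open>m s\<close>. The
  choices of \<open>q\<close> will be cut-off test functions and indicators of intervals.\<close>

lemma integral_h:
  assumes q [measurable]: "q \<in> borel_measurable borel" and supp: "\<And>x. x \<notin> {0..L} \<Longrightarrow> q x = 0"
    and qM: "\<And>x. cmod (q x) \<le> M"
  shows "(LINT x|lborel. h t x * q x) = (LINT s:{0..t}|lborel. m s * (LINT x|lborel. g (x + t - s) * q x))"
proof -
  obtain B where B: "B \<ge> 0" "\<And>x. cmod (m x) \<le> B" by (rule bounded_borelE[OF m_bb]) (rule that)
  have M: "M \<ge> 0" using qM[of 0] norm_ge_zero order_trans by blast
  define f where "f x s = indicat_real {0..t} s *\<^sub>R (m s * (g (x + t - s) * q x))" for x s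
  have fn: "cmod (f x s) \<le> cmod (g (x + t - s)) * (B * M)" for x s
  proof -
    have "cmod (m s) * (cmod (g (x + t - s)) * cmod (q x)) \<le> B * (cmod (g (x + t - s)) * M)"
      using B M qM by (intro mult_mono) auto
    then show ?thesis using B M by (auto simp: f_def indicator_def norm_mult mult_ac)
  qed
  have fi: "integrable lborel (f x)" for x
  proof (rule Bochner_Integration.integrable_bound)
    show "integrable lborel (\<lambda>s. cmod (g (x + t - s)) * (B * M))"
      by (intro integrable_mult_left integrable_norm g_shift)
    show "AE s in lborel. norm (f x s) \<le> norm (cmod (g (x + t - s)) * (B * M))"
      using fn by (intro AE_I2) (metis order_trans abs_ge_self real_norm_def)
    show "f x \<in> borel_measurable lborel" unfolding f_def by measurable
  qed
  have fb: "(LINT s|lborel. cmod (f x s)) \<le> (LINT y|lborel. cmod (g y)) * (B * M)" for x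
  proof -
    have "(LINT s|lborel. cmod (f x s)) \<le> (LINT s|lborel. cmod (g (x + t - s)) * (B * M))"
      using fn by (intro integral_mono integrable_norm fi integrable_mult_left g_shift) auto
    then show ?thesis by (simp add: g_shift_norm)
  qed
  have "(LINT x|lborel. h t x * q x) = (LINT x|lborel. LINT s|lborel. f x s)"
  proof (rule Bochner_Integration.integral_cong[OF refl])
    fix x
    have "(LINT s|lborel. f x s) = (LINT s|lborel. (indicat_real {0..t} s *\<^sub>R (g (x + t - s) * m s)) * q x)"
      by (intro Bochner_Integration.integral_cong refl) (simp add: f_def mult_ac)
    then show "h t x * q x = (LINT s|lborel. f x s)"
      by (simp only: h_def set_lebesgue_integral_def integral_mult_left_zero)
  qed
  also have "\<dots> = (LINT s|lborel. LINT x|lborel. f x s)"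
  proof (rule lborel_Fubini_bounded[of f 0 L, OF _ fi _ fb])
    show "case_prod f \<in> borel_measurable (lborel \<Otimes>\<^sub>M lborel)" unfolding f_def[abs_def] by measurable
  qed (simp add: f_def supp)
  also have "\<dots> = (LINT s:{0..t}|lborel. m s * (LINT x|lborel. g (x + t - s) * q x))"
    unfolding set_lebesgue_integral_def f_def by simp
  finally show ?thesis .
qed

text \<open>Duhamel's principle: \<open>h\<close> superposes pulses \<open>g (x + t - s)\<close>
  born at time \<open>s\<close> and transported from then on. The transport identity on
  \<open>[s, \<tau>]\<close> is applied to each pulse; its initial terms add up to the source term
  and its final terms to the pairing with \<open>h \<tau>\<close>.\<close>

lemma duhamel_identity:
  assumes C1: "C1_rect \<tau> L \<psi> \<psi>t \<psi>x" and \<tau>: "0 \<le> \<tau>"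
    and bc: "\<And>t. t \<in> {0..\<tau>} \<Longrightarrow> \<psi> t 0 = 0"
  shows "(LINT t:{0..\<tau>}|lborel. LINT x:{0..L}|lborel. h t x * (\<psi>x t x - \<psi>t t x))
    = (LINT s:{0..\<tau>}|lborel. m s * (LINT x:{0..L}|lborel. g x * \<psi> s x)) - (LINT x:{0..L}|lborel. h \<tau> x * \<psi> \<tau> x)"
proof -
  obtain B where B: "B \<ge> 0" "\<And>x. cmod (m x) \<le> B" by (rule bounded_borelE[OF m_bb]) (rule that)
  let ?R = "{0..\<tau>} \<times> {0..L}"
  have cR: "compact ?R" by (intro compact_Times) auto
  define Q where "Q p = indicat_real ?R p *\<^sub>R (\<psi>x (fst p) (snd p) - \<psi>t (fst p) (snd p))" for p
  have cQ: "continuous_on ?R (\<lambda>p. \<psi>x (fst p) (snd p) - \<psi>t (fst p) (snd p))"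
    using C1 unfolding C1_rect_def by (intro continuous_intros) (simp_all add: case_prod_unfold)
  have "Q \<in> borel_measurable borel"
    unfolding Q_def by (intro borel_measurable_continuous_on_indicator cQ borel_closed compact_imp_closed cR)
  then have [measurable]: "Q \<in> borel_measurable (borel \<Otimes>\<^sub>M borel)" by (simp add: borel_prod)
  obtain M where M: "M \<ge> 0" "\<And>p. cmod (Q p) \<le> M"
    unfolding Q_def by (rule indicator_scaleR_bounded[OF cR cQ]) auto
  define P where "P p = indicat_real ?R p *\<^sub>R \<psi> (fst p) (snd p)" for p
  have cP: "continuous_on ?R (\<lambda>p. \<psi> (fst p) (snd p))"
    using C1 unfolding C1_rect_def by (simp add: case_prod_unfold)
  have "P \<in> borel_measurable borel"
    unfolding P_def by (intro borel_measurable_continuous_on_indicator cP borel_closed compact_imp_closed cR)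
  then have [measurable]: "P \<in> borel_measurable (borel \<Otimes>\<^sub>M borel)" by (simp add: borel_prod)
  obtain M' where M': "M' \<ge> 0" "\<And>p. cmod (P p) \<le> M'"
    unfolding P_def by (rule indicator_scaleR_bounded[OF cR cP]) auto
  define N where "N = (LINT y|lborel. cmod (g y))"
  have N: "N \<ge> 0" unfolding N_def by (rule Bochner_Integration.integral_nonneg) simp
  define f where "f t s = indicat_real {0..t} s *\<^sub>R (m s * (LINT x|lborel. g (x + t - s) * Q (t, x)))" for t s
  have gi: "integrable lborel (\<lambda>x. g (x + t - s) * Q (t', x))" for t s t'
    by (rule integrable_mult_bounded[OF g_shift(1) _ M(2)]) measurable
  have gb: "cmod (LINT x|lborel. g (x + t - s) * q x) \<le> N * M0"
    if [measurable]: "q \<in> borel_measurable borel" and qM: "\<And>x. cmod (q x) \<le> M0" for t s q M0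
  proof -
    have "cmod (LINT x|lborel. g (x + t - s) * q x) \<le> (LINT x|lborel. cmod (g (x + t - s)) * M0)"
      by (intro Bochner_Integration.integral_norm_bound_integral integrable_mult_bounded[OF g_shift(1) _ qM]
          integrable_mult_left integrable_norm g_shift)
         (auto simp: norm_mult intro!: mult_left_mono qM)
    then show ?thesis by (simp add: g_shift_norm N_def)
  qed
  have f_out: "f t s = 0" if "t \<notin> {0..\<tau>}" for t s
  proof -
    have "Q (t, x) = 0" for x using that by (auto simp: Q_def indicator_def)
    then show ?thesis by (simp add: f_def)
  qed
  have fn: "cmod (f t s) \<le> (B * (N * M)) * indicat_real {0..\<tau>} s" for t s
  proof (cases "t \<in> {0..\<tau>}")
    case True
    have "cmod (m s * (LINT x|lborel. g (x + t - s) * Q (t, x))) \<le> B * (N * M)"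
      unfolding norm_mult using B N M by (intro mult_mono gb) auto
    then show ?thesis using True B N M by (auto simp: f_def indicator_def)
  next
    case False
    then show ?thesis using B N M f_out by simp
  qed
  have f_meas [measurable]: "case_prod f \<in> borel_measurable (lborel \<Otimes>\<^sub>M lborel)"
  proof -
    have [measurable]: "(\<lambda>p. LINT x|lborel. g (x + fst p - snd p) * Q (fst p, x)) \<in> borel_measurable (borel \<Otimes>\<^sub>M borel)"
      by (rule lborel.borel_measurable_lebesgue_integral) measurable
    have "(\<lambda>p. (if 0 \<le> snd p \<and> snd p \<le> fst p then 1 else 0) *\<^sub>R (m (snd p) * (LINT x|lborel. g (x + fst p - snd p) * Q (fst p, x))))
      \<in> borel_measurable (borel \<Otimes>\<^sub>M borel)" by measurable
    also have "(\<lambda>p. (if 0 \<le> snd p \<and> snd p \<le> fst p then 1 else 0) *\<^sub>R (m (snd p) * (LINT x|lborel. g (x + fst p - snd p) * Q (fst p, x))))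
      = case_prod f" by (auto simp: f_def indicator_def fun_eq_iff)
    finally show ?thesis by simp
  qed
  have fi: "integrable lborel (f t)" for t
    by (rule Bochner_Integration.integrable_bound[of _ "\<lambda>s. (B * (N * M)) * indicat_real {0..\<tau>} s"])
       (use fn B N M in \<open>auto intro!: integrable_mult_right\<close>)
  have fb: "(LINT s|lborel. cmod (f t s)) \<le> (B * (N * M)) * \<tau>" for t
  proof -
    have "(LINT s|lborel. cmod (f t s)) \<le> (LINT s|lborel. (B * (N * M)) * indicat_real {0..\<tau>} s)"
      using fn by (intro integral_mono integrable_norm fi integrable_mult_right) auto
    then show ?thesis using \<tau> by simp
  qed
  have "(LINT t:{0..\<tau>}|lborel. LINT x:{0..L}|lborel. h t x * (\<psi>x t x - \<psi>t t x))
     = (LINT t|lborel. LINT x|lborel. h t x * Q (t, x))"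
    unfolding set_lebesgue_integral_def integral_scaleR_right[symmetric]
    by (intro Bochner_Integration.integral_cong refl) (simp add: Q_def indicator_times)
  also have "\<dots> = (LINT t|lborel. LINT s|lborel. f t s)"
  proof (rule Bochner_Integration.integral_cong[OF refl])
    fix t
    have "(LINT x|lborel. h t x * Q (t, x)) = (LINT s:{0..t}|lborel. m s * (LINT x|lborel. g (x + t - s) * Q (t, x)))"
    proof (rule integral_h[of "\<lambda>x. Q (t, x)" M])
      show "Q (t, x) = 0" if "x \<notin> {0..L}" for x using that by (simp add: Q_def indicator_def)
    qed (simp_all add: M(2))
    then show "(LINT x|lborel. h t x * Q (t, x)) = (LINT s|lborel. f t s)"
      by (simp add: set_lebesgue_integral_def f_def)
  qed
  also have "\<dots> = (LINT s|lborel. LINT t|lborel. f t s)"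
    by (rule lborel_Fubini_bounded[OF f_meas fi f_out fb])
  also have "\<dots> = (LINT s:{0..\<tau>}|lborel. m s * ((LINT x:{0..L}|lborel. g x * \<psi> s x)
       - (LINT x:{0..L}|lborel. g (x + \<tau> - s) * \<psi> \<tau> x)))"
    unfolding set_lebesgue_integral_def
  proof (rule Bochner_Integration.integral_cong[OF refl])
    fix s
    show "(LINT t|lborel. f t s) = indicat_real {0..\<tau>} s *\<^sub>R (m s * ((LINT x|lborel. indicat_real {0..L} x *\<^sub>R (g x * \<psi> s x))
       - (LINT x|lborel. indicat_real {0..L} x *\<^sub>R (g (x + \<tau> - s) * \<psi> \<tau> x))))"
    proof (cases "s \<in> {0..\<tau>}")
      case True
      then have s: "0 \<le> s" "s \<le> \<tau>" by auto
      have "(LINT t|lborel. f t s) = (LINT t|lborel. m s * (indicat_real {s..\<tau>} t *\<^sub>R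
          (LINT x|lborel. indicat_real {0..L} x *\<^sub>R (g (x + t - s) * (\<psi>x t x - \<psi>t t x)))))"
      proof (rule Bochner_Integration.integral_cong[OF refl])
        fix t
        show "f t s = m s * (indicat_real {s..\<tau>} t *\<^sub>R
          (LINT x|lborel. indicat_real {0..L} x *\<^sub>R (g (x + t - s) * (\<psi>x t x - \<psi>t t x))))"
        proof (cases "t \<in> {s..\<tau>}")
          case True
          then have "Q (t, x) = indicat_real {0..L} x *\<^sub>R (\<psi>x t x - \<psi>t t x)" for x
            using s by (auto simp: Q_def indicator_def)
          then show ?thesis using True s by (simp add: f_def)
        next
          case False
          then have "t < s \<or> t \<notin> {0..\<tau>}" using s by auto
          then show ?thesis using False f_out[of t s] by (auto simp: f_def)
        qed
      qed
      also have "\<dots> = m s * (LINT t:{s..\<tau>}|lborel. LINT x:{0..L}|lborel. g (x + t - s) * (\<psi>x t x - \<psi>t t x))"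
        unfolding set_lebesgue_integral_def by (simp only: integral_mult_right_zero)
      also have "(LINT t:{s..\<tau>}|lborel. LINT x:{0..L}|lborel. g (x + t - s) * (\<psi>x t x - \<psi>t t x))
        = (LINT x:{0..L}|lborel. g (x + s - s) * \<psi> s x) - (LINT x:{0..L}|lborel. g (x + \<tau> - s) * \<psi> \<tau> x)
          + (LINT t:{s..\<tau>}|lborel. g (L + t - s) * \<psi> t L)"
        by (rule transport_identity[of \<tau> L \<psi> \<psi>t \<psi>x s "\<lambda>r. g (r - s)", OF C1 s L bc])
           (use g_shift(1)[of 0 s] in auto)
      \<comment> \<open>For \<open>t > s\<close> the argument exceeds \<open>L\<close>, where
        \<open>g\<close> vanishes: a pulse receives nothing through the boundary.\<close>
      also have "(LINT t:{s..\<tau>}|lborel. g (L + t - s) * \<psi> t L) = 0"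
        unfolding set_lebesgue_integral_def
      proof (rule integral_eq_zero_AE)
        have "AE t in lborel. t \<noteq> s" by (rule AE_lborel_singleton)
        then show "AE t in lborel. indicat_real {s..\<tau>} t *\<^sub>R (g (L + t - s) * \<psi> t L) = 0"
        proof eventually_elim
          case (elim t)
          then show ?case using g_supp[of "L + t - s"] by (cases "t > s") auto
        qed
      qed
      finally show ?thesis using True by (simp add: set_lebesgue_integral_def)
    next
      case False
      then have "f t s = 0" for t
        using f_out[of t s] by (cases "t \<in> {0..\<tau>}") (auto simp: f_def indicator_def)
      then show ?thesis using False by simp
    qed
  qed
  also have "\<dots> = (LINT s|lborel. indicat_real {0..\<tau>} s *\<^sub>R (m s * (LINT x|lborel. g x * P (s, x)))
      - indicat_real {0..\<tau>} s *\<^sub>R (m s * (LINT x|lborel. g (x + \<tau> - s) * P (\<tau>, x))))"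
    unfolding set_lebesgue_integral_def
    by (intro Bochner_Integration.integral_cong refl)
       (use \<tau> in \<open>auto simp: P_def indicator_def algebra_simps intro!: Bochner_Integration.integral_cong split: if_splits\<close>)
  also have "\<dots> = (LINT s|lborel. indicat_real {0..\<tau>} s *\<^sub>R (m s * (LINT x|lborel. g x * P (s, x))))
      - (LINT s|lborel. indicat_real {0..\<tau>} s *\<^sub>R (m s * (LINT x|lborel. g (x + \<tau> - s) * P (\<tau>, x))))"
  proof (rule Bochner_Integration.integral_diff)
    have "bounded_borel (\<lambda>s. m s * (LINT x|lborel. g x * P (s, x)))"
    proof (intro bounded_borel_mult m_bb bounded_borelI)
      show "cmod (LINT x|lborel. g x * P (s, x)) \<le> N * M'" for s
        using gb[of "\<lambda>x. P (s, x)" M' 0 0] M' by simp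
    qed measurable
    then show "integrable lborel (\<lambda>s. indicat_real {0..\<tau>} s *\<^sub>R (m s * (LINT x|lborel. g x * P (s, x))))"
      by (rule bounded_borel_integrable)
    have "bounded_borel (\<lambda>s. m s * (LINT x|lborel. g (x + \<tau> - s) * P (\<tau>, x)))"
      by (intro bounded_borel_mult m_bb bounded_borelI[of _ "N * M'"] gb M') measurable
    then show "integrable lborel (\<lambda>s. indicat_real {0..\<tau>} s *\<^sub>R (m s * (LINT x|lborel. g (x + \<tau> - s) * P (\<tau>, x))))"
      by (rule bounded_borel_integrable)
  qed
  also have "(LINT s|lborel. indicat_real {0..\<tau>} s *\<^sub>R (m s * (LINT x|lborel. g (x + \<tau> - s) * P (\<tau>, x))))
      = (LINT x|lborel. h \<tau> x * P (\<tau>, x))"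
    unfolding set_lebesgue_integral_def[symmetric]
  proof (rule integral_h[symmetric, of "\<lambda>x. P (\<tau>, x)" M'])
    show "P (\<tau>, x) = 0" if "x \<notin> {0..L}" for x using that by (simp add: P_def indicator_def)
  qed (simp_all add: M'(2))
  also have "(LINT x|lborel. h \<tau> x * P (\<tau>, x)) = (LINT x:{0..L}|lborel. h \<tau> x * \<psi> \<tau> x)"
    unfolding set_lebesgue_integral_def
    by (intro Bochner_Integration.integral_cong refl) (use \<tau> in \<open>auto simp: P_def indicator_def\<close>)
  also have "(LINT s|lborel. indicat_real {0..\<tau>} s *\<^sub>R (m s * (LINT x|lborel. g x * P (s, x))))
      = (LINT s:{0..\<tau>}|lborel. m s * (LINT x:{0..L}|lborel. g x * \<psi> s x))"
    unfolding set_lebesgue_integral_def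
    by (intro Bochner_Integration.integral_cong refl)
       (auto simp: P_def indicator_def intro!: Bochner_Integration.integral_cong split: if_splits)
  finally show ?thesis .
qed

section \<open>Tail integrals of \<open>g\<close> and integrals of \<open>h\<close> in space\<close>

lemma G_bound: "cmod (G r) \<le> (LINT y|lborel. cmod (g y))"
  unfolding G_def set_lebesgue_integral_def
  by (rule Bochner_Integration.integral_norm_bound_integral)
     (use g in \<open>auto intro: integrable_mult_indicator split: split_indicator\<close>)

lemma continuous_G: "continuous_on UNIV G"
  using continuous_moving_integral[OF g, of "\<lambda>_ _. 1" 1 "\<lambda>r. r" "\<lambda>_. L"]
  by (simp add: G_def[abs_def])

lemma G_meas [measurable]: "G \<in> borel_measurable borel"
  by (rule borel_measurable_continuous_onI[OF continuous_G])

lemma G_bb: "bounded_borel (\<lambda>s. G (c - s))"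
  by (rule bounded_borelI[OF _ G_bound]) measurable

lemma G_zero:
  assumes "r \<ge> L"
  shows "G r = 0"
  unfolding G_def set_lebesgue_integral_def
proof (rule integral_eq_zero_AE)
  have "AE y in lborel. y \<noteq> L" by (rule AE_lborel_singleton)
  then show "AE y in lborel. indicat_real {r..L} y *\<^sub>R g y = 0"
    by eventually_elim (use assms in \<open>auto simp: indicator_def\<close>)
qed

lemma integral_g_shift:
  assumes "0 \<le> b"
  shows "(LINT x:{0..b}|lborel. g (x + c)) = G c - G (b + c)"
proof -
  have "(LINT x:{0..b}|lborel. g (x + c)) = (LINT x|lborel. indicat_real {c..b+c} (x + c) *\<^sub>R g (x + c))"
    unfolding set_lebesgue_integral_def
    by (intro Bochner_Integration.integral_cong refl) (auto simp: indicator_def)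
  also have "\<dots> = (LINT y|lborel. indicat_real {c..b+c} y *\<^sub>R g y)"
    by (rule lborel_integral_shift(1))
  also have "\<dots> = (LINT y|lborel. indicat_real {c..L} y *\<^sub>R g y - indicat_real {b+c..L} y *\<^sub>R g y)"
  proof (rule integral_cong_AE)
    have "AE y in lborel. y \<noteq> b + c" by (rule AE_lborel_singleton)
    then show "AE y in lborel. indicat_real {c..b+c} y *\<^sub>R g y = indicat_real {c..L} y *\<^sub>R g y - indicat_real {b+c..L} y *\<^sub>R g y"
    proof eventually_elim
      case (elim y)
      then show ?case using assms g_supp[of y] by (cases "y \<le> L") (auto simp: indicator_def)
    qed
  qed auto
  also have "\<dots> = G c - G (b + c)"
    unfolding G_def set_lebesgue_integral_def
    by (rule Bochner_Integration.integral_diff) (use g in \<open>auto intro: integrable_mult_indicator\<close>)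
  finally show ?thesis .
qed

text \<open>Integrating a single pulse over \<open>[0, b]\<close> gives a difference of two tails of
  \<open>g\<close>, which is how \<open>G\<close> enters. The case \<open>b = L\<close> yields the
  mean at time \<open>t\<close>; time \<open>L\<close> with \<open>b = t\<close> yields the
  correction inside the control.\<close>

lemma integral_h_Icc:
  assumes "b \<in> {0..L}"
  shows "(LINT x:{0..b}|lborel. h t x) = (LINT s:{0..t}|lborel. m s * (G (t - s) - G (b + t - s)))"
proof -
  have inner: "(LINT x|lborel. g (x + t - s) * of_real (indicat_real {0..b} x)) = G (t - s) - G (b + t - s)" for s
    using integral_g_shift[of b "t - s"] assms
    by (simp add: set_lebesgue_integral_def scaleR_conv_of_real mult.commute add_diff_eq)
  have "(LINT x:{0..b}|lborel. h t x) = (LINT x|lborel. h t x * of_real (indicat_real {0..b} x))"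
    unfolding set_lebesgue_integral_def by (simp add: scaleR_conv_of_real mult.commute)
  also have "\<dots> = (LINT s:{0..t}|lborel. m s * (LINT x|lborel. g (x + t - s) * of_real (indicat_real {0..b} x)))"
    by (rule integral_h[of _ 1]) (use assms in \<open>auto simp: indicator_def\<close>)
  finally show ?thesis unfolding inner .
qed

lemma h_bounded: obtains C where "\<And>t x. cmod (h t x) \<le> C"
proof -
  obtain B where B: "B \<ge> 0" "\<And>x. cmod (m x) \<le> B" by (rule bounded_borelE[OF m_bb]) (rule that)
  have "cmod (h t x) \<le> (LINT y|lborel. cmod (g y)) * B" for t x
  proof -
    have "cmod (h t x) \<le> (LINT s|lborel. cmod (g (x + t - s)) * B)"
      unfolding h_def set_lebesgue_integral_def
    proof (rule Bochner_Integration.integral_norm_bound_integral)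
      show "integrable lborel (\<lambda>s. indicat_real {0..t} s *\<^sub>R (g (x + t - s) * m s))"
        by (intro integrable_mult_indicator integrable_mult_bounded[OF g_shift(2) _ B(2)]) auto
      show "integrable lborel (\<lambda>s. cmod (g (x + t - s)) * B)"
        by (intro integrable_mult_left integrable_norm g_shift)
      show "cmod (indicat_real {0..t} s *\<^sub>R (g (x + t - s) * m s)) \<le> cmod (g (x + t - s)) * B" for s
        using B by (auto simp: indicator_def norm_mult intro!: mult_left_mono)
    qed
    then show ?thesis by (simp add: g_shift_norm)
  qed
  then show thesis by (rule that)
qed

end

text \<open>The control \<open>U\<close> is read off from the requirement that \<open>u L = u1\<close>. The equation for \<open>m\<close> expresses
  that the prescribed \<open>m t\<close> is the integral of the resulting \<open>u t\<close>.\<close>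

locale controlled = duhamel +
  fixes u0 u1 :: "real \<Rightarrow> complex"
  assumes u0: "integrable lborel u0" "integrable lborel (\<lambda>x. (cmod (u0 x))^2)" "\<And>x. x \<notin> {0..L} \<Longrightarrow> u0 x = 0"
    and u1: "integrable lborel u1" "integrable lborel (\<lambda>x. (cmod (u1 x))^2)" "\<And>x. x \<notin> {0..L} \<Longrightarrow> u1 x = 0"
    and m_eq: "\<And>t. t \<in> {0..L} \<Longrightarrow> m t = (LINT y:{t..L}|lborel. u0 y) + (LINT y:{0..t}|lborel. u1 y)
      + pconv L (\<lambda>r. indicat_real {0..<L} r *\<^sub>R G r) m t - pconv L (\<lambda>r. indicat_real {0..<L} r *\<^sub>R G r) m 0"
begin

text \<open>The left end is excluded so that \<open>U (r - L)\<close> vanishes for all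
  \<open>r \<le> L\<close> and cannot interfere with \<open>u0\<close> at
  \<open>r = L\<close>.\<close>

definition U :: "real \<Rightarrow> complex" where
  "U x = indicat_real {0<..L} x *\<^sub>R (u1 x - h L x)"

text \<open>The value carried by the characteristic \<open>x + t = r\<close>: initial data for
  \<open>r \<le> L\<close>, boundary data for \<open>r > L\<close>. Extension by zero lets a sum
  replace the case distinction.\<close>

definition v :: "real \<Rightarrow> complex" where
  "v r = u0 r + U (r - L)"

definition u :: "real \<Rightarrow> real \<Rightarrow> complex" where
  "u t x = v (t + x) + h t x"

lemma u0_meas [measurable]: "u0 \<in> borel_measurable borel" using u0(1) by auto
lemma u1_meas [measurable]: "u1 \<in> borel_measurable borel" using u1(1) by auto
lemma U_meas [measurable]: "U \<in> borel_measurable borel" unfolding U_def[abs_def] by measurable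
lemma v_meas [measurable]: "v \<in> borel_measurable borel" unfolding v_def[abs_def] by measurable
lemma u_meas [measurable]: "u t \<in> borel_measurable borel" unfolding u_def[abs_def] by measurable

lemma bounded_borel_h: "bounded_borel (h t)"
proof -
  obtain C where "\<And>t x. cmod (h t x) \<le> C" by (rule h_bounded) (rule that)
  then show ?thesis by (intro bounded_borelI[of _ C]) auto
qed

lemma U_integrable: "integrable lborel U" "integrable lborel (\<lambda>x. (cmod (U x))^2)"
proof -
  have i: "integrable lborel (\<lambda>x. indicat_real {0<..L} x *\<^sub>R u1 x)"
    using u1(1) by (intro integrable_mult_indicator) auto
  have j: "integrable lborel (\<lambda>x. indicat_real {0<..L} x *\<^sub>R (indicat_real {0..L} x *\<^sub>R h L x))"
    by (intro integrable_mult_indicator bounded_borel_integrable bounded_borel_h) auto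
  have "U = (\<lambda>x. indicat_real {0<..L} x *\<^sub>R u1 x - indicat_real {0<..L} x *\<^sub>R (indicat_real {0..L} x *\<^sub>R h L x))"
    by (auto simp: U_def indicator_def fun_eq_iff)
  then show "integrable lborel U"
    using Bochner_Integration.integrable_diff[OF i j] by simp
  show "integrable lborel (\<lambda>x. (cmod (U x))^2)"
  proof (rule Bochner_Integration.integrable_bound)
    show "integrable lborel (\<lambda>x. 2 * (cmod (u1 x))^2 + 2 * cmod (indicat_real {0..L} x *\<^sub>R (h L x * h L x)))"
      by (intro Bochner_Integration.integrable_add integrable_mult_right u1 integrable_norm
          bounded_borel_integrable bounded_borel_mult bounded_borel_h)
    show "AE x in lborel. norm ((cmod (U x))\<^sup>2) \<le> norm (2 * (cmod (u1 x))^2 + 2 * cmod (indicat_real {0..L} x *\<^sub>R (h L x * h L x)))"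
      using cmod_add_sq_le[of "u1 x" "- h L x" for x]
      by (intro AE_I2) (auto simp: U_def indicator_def norm_mult power2_eq_square)
  qed simp
qed

lemma v_integrable: "integrable lborel v" "integrable lborel (\<lambda>x. (cmod (v x))^2)"
proof -
  have i: "integrable lborel (\<lambda>r. U (r - L))" "integrable lborel (\<lambda>r. (cmod (U (r - L)))^2)"
    using lborel_integrable_shift(1)[OF U_integrable(1), of "-L"]
      lborel_integrable_shift(1)[OF U_integrable(2), of "-L"] by simp_all
  show "integrable lborel v"
    unfolding v_def[abs_def] by (intro Bochner_Integration.integrable_add u0 i)
  show "integrable lborel (\<lambda>x. (cmod (v x))^2)"
  proof (rule Bochner_Integration.integrable_bound)
    show "integrable lborel (\<lambda>x. 2 * (cmod (u0 x))^2 + 2 * (cmod (U (x - L)))^2)"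
      by (intro Bochner_Integration.integrable_add integrable_mult_right u0 i)
    show "AE x in lborel. norm ((cmod (v x))\<^sup>2) \<le> norm (2 * (cmod (u0 x))^2 + 2 * (cmod (U (x - L)))^2)"
      using cmod_add_sq_le[of "u0 x" "U (x - L)" for x] by (intro AE_I2) (auto simp: v_def)
  qed simp
qed

text \<open>The unwrapped translate survives for \<open>s \<le> t\<close>, the wrapped one for
  \<open>s > t\<close>. The second integral may run over all of \<open>[0, L]\<close> because
  \<open>G\<close> vanishes from \<open>L\<close> on.\<close>

lemma pconv_G:
  assumes t: "t \<in> {0..L}"
  shows "pconv L (\<lambda>r. indicat_real {0..<L} r *\<^sub>R G r) m t
    = (LINT s:{0..t}|lborel. m s * G (t - s)) + (LINT s:{0..L}|lborel. m s * G (L + t - s))"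
proof -
  have i1: "integrable lborel (\<lambda>s. indicat_real {0..t} s *\<^sub>R (m s * G (t - s)))"
    and i2: "integrable lborel (\<lambda>s. indicat_real {0..L} s *\<^sub>R (m s * G (L + t - s)))"
    by (intro bounded_borel_integrable bounded_borel_mult m_bb G_bb)+
  have "pconv L (\<lambda>r. indicat_real {0..<L} r *\<^sub>R G r) m t
      = (LINT s|lborel. indicat_real {0..t} s *\<^sub>R (m s * G (t - s)) + indicat_real {0..L} s *\<^sub>R (m s * G (L + t - s)))"
    unfolding pconv_def set_lebesgue_integral_def
  proof (rule integral_cong_AE)
    have "AE s in lborel. s \<noteq> (0::real)" by (rule AE_lborel_singleton)
    then show "AE s in lborel. indicat_real {0..L} s *\<^sub>R ((indicat_real {0..<L} (t - s) *\<^sub>R G (t - s)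
          + indicat_real {0..<L} (t - s + L) *\<^sub>R G (t - s + L)) * m s)
        = indicat_real {0..t} s *\<^sub>R (m s * G (t - s)) + indicat_real {0..L} s *\<^sub>R (m s * G (L + t - s))"
    proof eventually_elim
      case (elim s)
      then show ?case using t G_zero[of "L + t - s"]
        by (cases "s \<le> t") (auto simp: indicator_def algebra_simps)
    qed
  qed measurable
  then show ?thesis using i1 i2 by (simp add: set_lebesgue_integral_def)
qed

text \<open>This closes the loop: \<open>h\<close> was built from a prescribed \<open>m\<close>, and
  only now is \<open>m\<close> seen to be the mean of \<open>u\<close>. The transported data give
  the integrals of \<open>u0\<close> and \<open>u1\<close>, \<open>h t\<close> gives the Volterra
  part, and the term \<open>h L\<close> inside \<open>U\<close> gives the rest.\<close>

lemma mean_u: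
  assumes t: "t \<in> {0..L}"
  shows "(LINT x:{0..L}|lborel. u t x) = m t"
proof -
  have iu: "integrable lborel (\<lambda>y. indicat_real {a..b} y *\<^sub>R u0 y)" "integrable lborel (\<lambda>y. indicat_real {a..b} y *\<^sub>R U y)"
    for a b using u0(1) U_integrable(1) by (auto intro: integrable_mult_indicator)
  have ih: "integrable lborel (\<lambda>x. indicat_real {a..b} x *\<^sub>R h t x)" for a b t
    by (intro bounded_borel_integrable bounded_borel_h)
  have i1: "integrable lborel (\<lambda>s. indicat_real {a..b} s *\<^sub>R (m s * G (c - s)))" for a b c
    by (intro bounded_borel_integrable bounded_borel_mult m_bb G_bb)
  have "(LINT x:{0..L}|lborel. u t x)
     = (LINT x|lborel. indicat_real {t..t+L} (x + t) *\<^sub>R u0 (x + t) + indicat_real {t-L..t} (x + (t - L)) *\<^sub>R U (x + (t - L))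
         + indicat_real {0..L} x *\<^sub>R h t x)"
    unfolding set_lebesgue_integral_def
    by (intro Bochner_Integration.integral_cong refl) (auto simp: u_def v_def indicator_def algebra_simps)
  also have "\<dots> = (LINT x|lborel. indicat_real {t..t+L} (x + t) *\<^sub>R u0 (x + t))
      + (LINT x|lborel. indicat_real {t-L..t} (x + (t - L)) *\<^sub>R U (x + (t - L))) + (LINT x:{0..L}|lborel. h t x)"
    using lborel_integrable_shift(1)[OF iu(1), of t "t + L" t] lborel_integrable_shift(1)[OF iu(2), of "t - L" t "t - L"] ih
    by (simp add: set_lebesgue_integral_def)
  also have "(LINT x|lborel. indicat_real {t..t+L} (x + t) *\<^sub>R u0 (x + t)) = (LINT y|lborel. indicat_real {t..t+L} y *\<^sub>R u0 y)"
    by (rule lborel_integral_shift(1))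
  also have "\<dots> = (LINT y:{t..L}|lborel. u0 y)"
    unfolding set_lebesgue_integral_def
    by (intro Bochner_Integration.integral_cong refl) (use t u0(3) in \<open>auto simp: indicator_def\<close>)
  also have "(LINT x|lborel. indicat_real {t-L..t} (x + (t - L)) *\<^sub>R U (x + (t - L))) = (LINT y|lborel. indicat_real {t-L..t} y *\<^sub>R U y)"
    by (rule lborel_integral_shift(1))
  also have "\<dots> = (LINT y|lborel. indicat_real {0..t} y *\<^sub>R u1 y - indicat_real {0..t} y *\<^sub>R h L y)"
  proof (rule integral_cong_AE)
    have "AE y in lborel. y \<noteq> (0::real)" by (rule AE_lborel_singleton)
    then show "AE y in lborel. indicat_real {t-L..t} y *\<^sub>R U y = indicat_real {0..t} y *\<^sub>R u1 y - indicat_real {0..t} y *\<^sub>R h L y"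
      by eventually_elim (use t in \<open>auto simp: U_def indicator_def\<close>)
  qed auto
  also have "\<dots> = (LINT y:{0..t}|lborel. u1 y) - (LINT y:{0..t}|lborel. h L y)"
    unfolding set_lebesgue_integral_def
    by (rule Bochner_Integration.integral_diff) (use u1(1) ih in \<open>auto intro: integrable_mult_indicator\<close>)
  \<comment> \<open>The tail \<open>G (t + L - s)\<close> supplies the wrapped part of the
    convolution, and \<open>G (L - s)\<close> its value at \<open>0\<close>.\<close>
  also have "(LINT y:{0..t}|lborel. h L y) = (LINT s:{0..L}|lborel. m s * (G (L - s) - G (t + L - s)))"
    by (rule integral_h_Icc[OF t])
  also have "\<dots> = (LINT s:{0..L}|lborel. m s * G (L - s)) - (LINT s:{0..L}|lborel. m s * G (L + t - s))"
    unfolding set_lebesgue_integral_def using i1[of 0 L L] i1[of 0 L "L + t"]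
    by (simp add: right_diff_distrib scaleR_diff_right add.commute)
  also have "(LINT x:{0..L}|lborel. h t x) = (LINT s:{0..t}|lborel. m s * (G (t - s) - G (L + t - s)))"
    by (rule integral_h_Icc) (use L in auto)
  also have "\<dots> = (LINT s:{0..t}|lborel. m s * G (t - s))"
    unfolding set_lebesgue_integral_def
    by (intro Bochner_Integration.integral_cong refl) (auto simp: indicator_def G_zero)
  finally have eq: "(LINT x:{0..L}|lborel. u t x) = (LINT y:{t..L}|lborel. u0 y) + (LINT y:{0..t}|lborel. u1 y)
     + (LINT s:{0..t}|lborel. m s * G (t - s)) + (LINT s:{0..L}|lborel. m s * G (L + t - s)) - (LINT s:{0..L}|lborel. m s * G (L - s))"
    by simp
  have "(LINT s:{0..0}|lborel. m s * G (0 - s)) = 0"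
    unfolding set_lebesgue_integral_def
  proof (rule integral_eq_zero_AE)
    have "AE y in lborel. y \<noteq> (0::real)" by (rule AE_lborel_singleton)
    then show "AE s in lborel. indicat_real {0..0} s *\<^sub>R (m s * G (0 - s)) = 0"
      by eventually_elim auto
  qed
  then show ?thesis
    unfolding eq using m_eq[OF t] pconv_G[OF t] pconv_G[of 0] L by simp
qed

text \<open>The two parts are continuous for different reasons: \<open>v\<close> is merely square
  integrable and needs continuity of translations, while \<open>h\<close> is bounded and jointly
  continuous, so pointwise convergence is enough.\<close>

lemma C0_L2_u: "C0_L2 L L u"
  unfolding C0_L2_def
proof (intro conjI ballI)
  obtain C where C: "\<And>t x. cmod (h t x) \<le> C" by (rule h_bounded) (rule that)
  have iv: "integrable lborel (\<lambda>x. (cmod (v (t + x)))^2)" for t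
    using lborel_integrable_shift(1)[OF v_integrable(2), of t] by (simp add: add.commute)
  show "L2 {0..L} (u t)" for t
    unfolding L2_iff_lborel[OF u_meas] set_integrable_def
  proof (rule Bochner_Integration.integrable_bound)
    show "integrable lborel (\<lambda>x. 2 * (cmod (v (t + x)))^2 + 2 * cmod (indicat_real {0..L} x *\<^sub>R (h t x * h t x)))"
      by (intro Bochner_Integration.integrable_add integrable_mult_right iv integrable_norm
          bounded_borel_integrable bounded_borel_mult bounded_borel_h)
    show "AE x in lborel. norm (indicat_real {0..L} x *\<^sub>R (cmod (u t x))\<^sup>2)
       \<le> norm (2 * (cmod (v (t + x)))^2 + 2 * cmod (indicat_real {0..L} x *\<^sub>R (h t x * h t x)))"
      using cmod_add_sq_le[of "v (t + x)" "h t x" for x]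
      by (intro AE_I2) (auto simp: u_def indicator_def norm_mult power2_eq_square)
  qed simp
  fix t0 assume t0: "t0 \<in> {0..L}"
  define D where "D t = (LINT x:{0..L}|lborel. (cmod (v (t + x) - v (t0 + x)))^2)" for t
  define E where "E t = (LINT x:{0..L}|lborel. (cmod (h t x - h t0 x))^2)" for t
  have D: "(D \<longlongrightarrow> 0) (at t0 within {0..L})"
    unfolding D_def[abs_def] by (rule L2_translation_continuous[OF v_meas v_integrable(2) L])
  have hC: "cmod (h t x - h t0 x) \<le> 2 * C" for t x
    using norm_triangle_ineq4[of "h t x" "h t0 x"] C[of t x] C[of t0 x] by linarith
  have hC2: "(cmod (h t x - h t0 x))^2 \<le> (2 * C)^2" for t x
    by (intro power_mono hC) simp
  have E: "(E \<longlongrightarrow> 0) (at t0 within {0..L})"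
    unfolding tendsto_at_iff_sequentially o_def
  proof (intro allI impI)
    fix X :: "nat \<Rightarrow> real" assume X: "X \<longlonglongrightarrow> t0"
    have "(\<lambda>n. LINT x|lborel. indicat_real {0..L} x *\<^sub>R (cmod (h (X n) x - h t0 x))^2) \<longlonglongrightarrow> (LINT (x::real)|lborel. 0)"
    proof (rule integral_dominated_convergence[where w="\<lambda>x. (2*C)^2 * indicat_real {0..L} x"])
      show "AE x in lborel. (\<lambda>n. indicat_real {0..L} x *\<^sub>R (cmod (h (X n) x - h t0 x))^2) \<longlonglongrightarrow> 0"
      proof (intro AE_I2)
        fix x
        have "isCont (\<lambda>p. case p of (t, x) \<Rightarrow> h t x) (t0, x)"
          using continuous_h by (simp add: continuous_on_eq_continuous_at)
        then have "(\<lambda>n. case (X n, x) of (t, x) \<Rightarrow> h t x) \<longlonglongrightarrow> (case (t0, x) of (t, x) \<Rightarrow> h t x)"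
          by (rule isCont_tendsto_compose) (intro tendsto_intros X)
        then have "(\<lambda>n. indicat_real {0..L} x *\<^sub>R (cmod (h (X n) x - h t0 x))^2)
           \<longlonglongrightarrow> indicat_real {0..L} x *\<^sub>R (cmod (h t0 x - h t0 x))^2"
          by (intro tendsto_intros) simp
        then show "(\<lambda>n. indicat_real {0..L} x *\<^sub>R (cmod (h (X n) x - h t0 x))^2) \<longlonglongrightarrow> 0" by simp
      qed
      show "AE x in lborel. norm (indicat_real {0..L} x *\<^sub>R (cmod (h (X n) x - h t0 x))^2) \<le> (2*C)^2 * indicat_real {0..L} x" for n
        using hC2 by (intro AE_I2) (auto simp: indicator_def)
    qed (auto intro!: integrable_mult_right)
    then show "(\<lambda>n. E (X n)) \<longlonglongrightarrow> 0" by (simp add: E_def set_lebesgue_integral_def)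
  qed
  have "((\<lambda>t. 2 * D t + 2 * E t) \<longlongrightarrow> 2 * 0 + 2 * 0) (at t0 within {0..L})"
    by (intro tendsto_intros D E)
  then have lim: "((\<lambda>t. 2 * D t + 2 * E t) \<longlongrightarrow> 0) (at t0 within {0..L})" by simp
  have eq: "intL {0..L} (\<lambda>x. (cmod (u t x - u t0 x))^2) = (LINT x:{0..L}|lborel. (cmod (u t x - u t0 x))^2)" for t
    by (rule intL_eq_lborel) auto
  have iD: "integrable lborel (\<lambda>x. indicat_real {0..L} x *\<^sub>R (cmod (v (t + x) - v (t0 + x)))^2)" for t
  proof (rule Bochner_Integration.integrable_bound)
    show "integrable lborel (\<lambda>x. 2 * (cmod (v (t + x)))^2 + 2 * (cmod (v (t0 + x)))^2)"
      by (intro Bochner_Integration.integrable_add integrable_mult_right iv)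
    show "AE x in lborel. norm (indicat_real {0..L} x *\<^sub>R (cmod (v (t + x) - v (t0 + x)))^2)
      \<le> norm (2 * (cmod (v (t + x)))^2 + 2 * (cmod (v (t0 + x)))^2)"
      using cmod_add_sq_le[of "v (t + x)" "- v (t0 + x)" for x] by (intro AE_I2) (auto simp: indicator_def)
  qed simp
  have iE: "integrable lborel (\<lambda>x. indicat_real {0..L} x *\<^sub>R (cmod (h t x - h t0 x))^2)" for t
    by (rule Bochner_Integration.integrable_bound[of _ "\<lambda>x. (2*C)^2 * indicat_real {0..L} x"])
       (use hC2 in \<open>auto intro!: integrable_mult_right AE_I2 split: split_indicator\<close>)
  have le: "intL {0..L} (\<lambda>x. (cmod (u t x - u t0 x))^2) \<le> 2 * D t + 2 * E t" for t
  proof -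
    have "intL {0..L} (\<lambda>x. (cmod (u t x - u t0 x))^2)
      \<le> (LINT x|lborel. 2 * (indicat_real {0..L} x *\<^sub>R (cmod (v (t + x) - v (t0 + x)))^2)
           + 2 * (indicat_real {0..L} x *\<^sub>R (cmod (h t x - h t0 x))^2))"
      unfolding eq set_lebesgue_integral_def
    proof (rule integral_mono')
      show "integrable lborel (\<lambda>x. 2 * (indicat_real {0..L} x *\<^sub>R (cmod (v (t + x) - v (t0 + x)))^2)
           + 2 * (indicat_real {0..L} x *\<^sub>R (cmod (h t x - h t0 x))^2))"
        by (intro Bochner_Integration.integrable_add integrable_mult_right iD iE)
      fix x
      show "indicat_real {0..L} x *\<^sub>R (cmod (u t x - u t0 x))^2
        \<le> 2 * (indicat_real {0..L} x *\<^sub>R (cmod (v (t + x) - v (t0 + x)))^2) + 2 * (indicat_real {0..L} x *\<^sub>R (cmod (h t x - h t0 x))^2)"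
        using cmod_add_sq_le[of "v (t + x) - v (t0 + x)" "h t x - h t0 x"]
        by (auto simp: indicator_def u_def algebra_simps)
    qed auto
    also have "\<dots> = 2 * D t + 2 * E t"
      unfolding D_def E_def set_lebesgue_integral_def using iD iE by simp
    finally show ?thesis .
  qed
  have ge: "0 \<le> intL {0..L} (\<lambda>x. (cmod (u t x - u t0 x))^2)" for t
    unfolding intL_def by (rule Bochner_Integration.integral_nonneg) simp
  show "((\<lambda>t. intL {0..L} (\<lambda>x. (cmod (u t x - u t0 x))^2)) \<longlongrightarrow> 0) (at t0 within {0..L})"
    by (rule tendsto_sandwich[OF _ _ tendsto_const lim]) (use ge le in auto)
qed

text \<open>\<open>transport_identity\<close> handles \<open>v\<close> and
  \<open>duhamel_identity\<close> handles \<open>h\<close>. By \<open>mean_u\<close> the nonlocal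
  term of the test expression pairs with \<open>m\<close>, and it cancels exactly the source term
  that \<open>h\<close> produces.\<close>

lemma weak_solution_u: "weak_solution L g L u0 U u"
  unfolding weak_solution_def
proof (intro conjI C0_L2_u ballI allI impI, elim conjE)
  fix \<tau> \<phi> \<phi>t \<phi>x
  assume \<tau>: "\<tau> \<in> {0..L}" and C1': "C1_rect \<tau> L \<phi> \<phi>t \<phi>x" and bc': "\<forall>t\<in>{0..\<tau>}. \<phi> t 0 = 0"
  \<comment> \<open>Conjugating the test function once makes all pairings bilinear.\<close>
  define \<psi> where "\<psi> t x = cnj (\<phi> t x)" for t x
  define \<psi>t where "\<psi>t t x = cnj (\<phi>t t x)" for t x
  define \<psi>x where "\<psi>x t x = cnj (\<phi>x t x)" for t x
  have C1: "C1_rect \<tau> L \<psi> \<psi>t \<psi>x"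
    using C1_rect_cnj[OF C1'] by (simp add: \<psi>_def[abs_def] \<psi>t_def[abs_def] \<psi>x_def[abs_def])
  have bc: "\<psi> t 0 = 0" if "t \<in> {0..\<tau>}" for t using bc' that by (simp add: \<psi>_def)
  have \<tau>0: "0 \<le> \<tau>" using \<tau> by simp
  let ?R = "{0..\<tau>} \<times> {0..L}"
  have cR: "compact ?R" by (intro compact_Times) auto
  define Q where "Q p = indicat_real ?R p *\<^sub>R (\<psi>x (fst p) (snd p) - \<psi>t (fst p) (snd p))" for p
  have cQ: "continuous_on ?R (\<lambda>p. \<psi>x (fst p) (snd p) - \<psi>t (fst p) (snd p))"
    using C1 unfolding C1_rect_def by (intro continuous_intros) (simp_all add: case_prod_unfold)
  have "Q \<in> borel_measurable borel"
    unfolding Q_def by (intro borel_measurable_continuous_on_indicator cQ borel_closed compact_imp_closed cR)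
  then have [measurable]: "Q \<in> borel_measurable (borel \<Otimes>\<^sub>M borel)" by (simp add: borel_prod)
  obtain M where M: "M \<ge> 0" "\<And>p. cmod (Q p) \<le> M"
    unfolding Q_def by (rule indicator_scaleR_bounded[OF cR cQ]) auto
  define P where "P p = indicat_real ?R p *\<^sub>R \<psi> (fst p) (snd p)" for p
  have cP: "continuous_on ?R (\<lambda>p. \<psi> (fst p) (snd p))"
    using C1 unfolding C1_rect_def by (simp add: case_prod_unfold)
  have "P \<in> borel_measurable borel"
    unfolding P_def by (intro borel_measurable_continuous_on_indicator cP borel_closed compact_imp_closed cR)
  then have [measurable]: "P \<in> borel_measurable (borel \<Otimes>\<^sub>M borel)" by (simp add: borel_prod)
  obtain M' where M': "M' \<ge> 0" "\<And>p. cmod (P p) \<le> M'"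
    unfolding P_def by (rule indicator_scaleR_bounded[OF cR cP]) auto
  obtain C where C: "\<And>t x. cmod (h t x) \<le> C" by (rule h_bounded) (rule that)
  have Qind: "indicat_real {0..L} x *\<^sub>R (w * (\<psi>x t x - \<psi>t t x)) = w * Q (t, x)"
    and Pind: "indicat_real {0..L} x *\<^sub>R (w * \<psi> t x) = w * P (t, x)" if "t \<in> {0..\<tau>}" for t x w
    using that by (auto simp: Q_def P_def indicator_def)
  define q where "q t = (LINT y|lborel. g y * P (t, y))" for t
  define Dv where "Dv t = (LINT x|lborel. v (x + t) * Q (t, x))" for t
  define Dh where "Dh t = (LINT x|lborel. h t x * Q (t, x))" for t
  have q_eq: "q t = (LINT y:{0..L}|lborel. g y * \<psi> t y)" if "t \<in> {0..\<tau>}" for t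
    unfolding set_lebesgue_integral_def q_def Pind[OF that] ..
  have Dv_eq: "Dv t = (LINT x:{0..L}|lborel. v (x + t) * (\<psi>x t x - \<psi>t t x))"
    and Dh_eq: "Dh t = (LINT x:{0..L}|lborel. h t x * (\<psi>x t x - \<psi>t t x))" if "t \<in> {0..\<tau>}" for t
    unfolding set_lebesgue_integral_def Dv_def Dh_def Qind[OF that] by (rule refl)+
  have iv: "integrable lborel (\<lambda>x. v (x + t) * Q (t', x))" "integrable lborel (\<lambda>x. v (x + t) * P (t', x))" for t t'
    by (intro integrable_mult_bounded[where M=M] integrable_mult_bounded[where M=M'] M M'
        lborel_integrable_shift(1)[OF v_integrable(1)]; measurable)+
  have ih: "integrable lborel (\<lambda>x. h t x * Q (t', x))" "integrable lborel (\<lambda>x. h t x * P (t', x))" for t t'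
  proof -
    have *: "indicat_real {0..L} x *\<^sub>R (h t x * Q (t', x)) = h t x * Q (t', x)"
      "indicat_real {0..L} x *\<^sub>R (h t x * P (t', x)) = h t x * P (t', x)" for x
      by (auto simp: Q_def P_def indicator_def)
    have "bounded_borel (\<lambda>x. h t x * Q (t', x))" "bounded_borel (\<lambda>x. h t x * P (t', x))"
      by (intro bounded_borel_mult bounded_borel_h bounded_borelI[of "\<lambda>x. Q (t', x)" M] bounded_borelI[of "\<lambda>x. P (t', x)" M'] M M';
          measurable)+
    from this[THEN bounded_borel_integrable, of 0 L]
    show "integrable lborel (\<lambda>x. h t x * Q (t', x))" "integrable lborel (\<lambda>x. h t x * P (t', x))"
      by (simp_all only: *)
  qed
  have inner_g: "cnj (intL {0..L} (\<lambda>y. cnj (g y) * \<phi> t y)) = q t" if t: "t \<in> {0..\<tau>}" for t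
  proof -
    have e: "indicat_real {0..L} y *\<^sub>R (cnj (g y) * \<phi> t y) = cnj (g y * P (t, y))" for y
      using t by (auto simp: P_def \<psi>_def indicator_def)
    have "intL {0..L} (\<lambda>y. cnj (g y) * \<phi> t y) = (LINT y:{0..L}|lborel. cnj (g y) * \<phi> t y)"
      by (rule intL_eq_lborel) (unfold e, measurable)
    also have "\<dots> = cnj (q t)"
      unfolding set_lebesgue_integral_def e q_def by (rule Bochner_Integration.integral_cnj)
    finally show ?thesis by simp
  qed
  have inner: "intL {0..L} (\<lambda>x. u t x * cnj (- \<phi>t t x + \<phi>x t x - intL {0..L} (\<lambda>y. cnj (g y) * \<phi> t y)))
      = Dv t + Dh t - m t * q t" if t: "t \<in> {0..\<tau>}" for t
  proof -
    have e: "indicat_real {0..L} x *\<^sub>R (u t x * cnj (- \<phi>t t x + \<phi>x t x - intL {0..L} (\<lambda>y. cnj (g y) * \<phi> t y)))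
       = v (x + t) * Q (t, x) + h t x * Q (t, x) - (indicat_real {0..L} x *\<^sub>R u t x) * q t" for x
      using t by (auto simp: inner_g[OF t] Q_def \<psi>t_def \<psi>x_def indicator_def u_def algebra_simps)
    have iu: "integrable lborel (\<lambda>x. indicat_real {0..L} x *\<^sub>R u t x)"
    proof -
      have "integrable lborel (\<lambda>x. indicat_real {0..L} x *\<^sub>R v (x + t) + indicat_real {0..L} x *\<^sub>R h t x)"
        by (intro Bochner_Integration.integrable_add integrable_mult_indicator lborel_integrable_shift(1)
            v_integrable bounded_borel_integrable bounded_borel_h) auto
      then show ?thesis by (simp add: u_def scaleR_add_right add.commute)
    qed
    have "intL {0..L} (\<lambda>x. u t x * cnj (- \<phi>t t x + \<phi>x t x - intL {0..L} (\<lambda>y. cnj (g y) * \<phi> t y)))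
       = (LINT x|lborel. v (x + t) * Q (t, x) + h t x * Q (t, x) - (indicat_real {0..L} x *\<^sub>R u t x) * q t)"
      unfolding e[symmetric] set_lebesgue_integral_def[symmetric]
      by (rule intL_eq_lborel) (unfold e, measurable)
    also have "\<dots> = Dv t + Dh t - (LINT x:{0..L}|lborel. u t x) * q t"
      unfolding Dv_def Dh_def set_lebesgue_integral_def
      using iv(1)[of t t] ih(1)[of t t] iu by (simp del: mult_scaleR_left)
    also have "(LINT x:{0..L}|lborel. u t x) = m t" by (rule mean_u) (use t \<tau> in auto)
    finally show ?thesis .
  qed
  have [measurable]: "Dv \<in> borel_measurable borel" "Dh \<in> borel_measurable borel" "q \<in> borel_measurable borel"
    unfolding Dv_def[abs_def] Dh_def[abs_def] q_def[abs_def]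
    by - (intro lborel.borel_measurable_lebesgue_integral; measurable)+
  have "bounded_borel Dv"
  proof (rule bounded_borelI)
    fix t
    have "cmod (Dv t) \<le> (LINT x|lborel. cmod (v (x + t)) * M)"
      unfolding Dv_def
      by (rule Bochner_Integration.integral_norm_bound_integral)
         (use iv M in \<open>auto intro!: integrable_norm lborel_integrable_shift(1) v_integrable mult_left_mono simp: norm_mult\<close>)
    then show "cmod (Dv t) \<le> (LINT x|lborel. cmod (v x)) * M"
      using lborel_integral_shift(1)[of "\<lambda>x. cmod (v x)" t] by simp
  qed measurable
  then have iDv: "integrable lborel (\<lambda>t. indicat_real {0..\<tau>} t *\<^sub>R Dv t)" by (rule bounded_borel_integrable)
  have "bounded_borel Dh"
  proof (rule bounded_borelI)
    fix t
    have "cmod (Dh t) \<le> (LINT x|lborel. C * M * indicat_real {0..L} x)"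
      unfolding Dh_def
    proof (rule Bochner_Integration.integral_norm_bound_integral)
      fix x
      have "cmod (h t x) * cmod (Q (t, x)) \<le> C * M"
        using C[of t x] M(2)[of "(t, x)"] norm_ge_zero[of "h t x"] by (intro mult_mono norm_ge_zero) linarith+
      moreover have "Q (t, x) = 0" if "x \<notin> {0..L}" using that by (simp add: Q_def indicator_def)
      ultimately show "cmod (h t x * Q (t, x)) \<le> C * M * indicat_real {0..L} x"
        by (cases "x \<in> {0..L}") (auto simp: norm_mult)
    qed (use ih in \<open>auto intro!: integrable_mult_right\<close>)
    then show "cmod (Dh t) \<le> C * M * L" using L by simp
  qed measurable
  then have iDh: "integrable lborel (\<lambda>t. indicat_real {0..\<tau>} t *\<^sub>R Dh t)" by (rule bounded_borel_integrable)
  have "bounded_borel q"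
  proof (rule bounded_borelI)
    fix t
    show "cmod (q t) \<le> (LINT x|lborel. cmod (g x) * M')"
      unfolding q_def
      by (rule Bochner_Integration.integral_norm_bound_integral)
         (use g M' in \<open>auto intro!: integrable_norm integrable_mult_bounded[of _ _ M'] mult_left_mono simp: norm_mult\<close>)
  qed measurable
  then have imq: "integrable lborel (\<lambda>t. indicat_real {0..\<tau>} t *\<^sub>R (m t * q t))"
    by (intro bounded_borel_integrable bounded_borel_mult m_bb)
  have "intL {0..\<tau>} (\<lambda>t. intL {0..L} (\<lambda>x. u t x * cnj (- \<phi>t t x + \<phi>x t x - intL {0..L} (\<lambda>y. cnj (g y) * \<phi> t y))))
      = intL {0..\<tau>} (\<lambda>t. Dv t + Dh t - m t * q t)"
    unfolding intL_def[of "{0..\<tau>}"]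
    by (rule Bochner_Integration.integral_cong[OF refl inner]) simp
  also have "\<dots> = (LINT t:{0..\<tau>}|lborel. Dv t + Dh t - m t * q t)"
    by (rule intL_eq_lborel) measurable
  also have "\<dots> = (LINT t:{0..\<tau>}|lborel. Dv t) + (LINT t:{0..\<tau>}|lborel. Dh t) - (LINT t:{0..\<tau>}|lborel. m t * q t)"
    unfolding set_lebesgue_integral_def using iDv iDh imq
    by (simp add: scaleR_add_right scaleR_diff_right)
  also have "(LINT t:{0..\<tau>}|lborel. Dv t) = (LINT t:{0..\<tau>}|lborel. LINT x:{0..L}|lborel. v (x + t) * (\<psi>x t x - \<psi>t t x))"
    by (intro set_lebesgue_integral_cong) (auto simp: Dv_eq)
  also have "\<dots> = (LINT x:{0..L}|lborel. v (x + 0) * \<psi> 0 x) - (LINT x:{0..L}|lborel. v (x + \<tau>) * \<psi> \<tau> x)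
      + (LINT t:{0..\<tau>}|lborel. v (L + t) * \<psi> t L)"
    by (rule transport_identity[OF C1 order_refl \<tau>0 L bc v_integrable(1)])
  also have "(LINT t:{0..\<tau>}|lborel. Dh t) = (LINT t:{0..\<tau>}|lborel. LINT x:{0..L}|lborel. h t x * (\<psi>x t x - \<psi>t t x))"
    by (intro set_lebesgue_integral_cong) (auto simp: Dh_eq)
  also have "\<dots> = (LINT s:{0..\<tau>}|lborel. m s * (LINT x:{0..L}|lborel. g x * \<psi> s x)) - (LINT x:{0..L}|lborel. h \<tau> x * \<psi> \<tau> x)"
    by (rule duhamel_identity[OF C1 \<tau>0 bc])
  also have "(LINT s:{0..\<tau>}|lborel. m s * (LINT x:{0..L}|lborel. g x * \<psi> s x)) = (LINT t:{0..\<tau>}|lborel. m t * q t)"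
    by (intro set_lebesgue_integral_cong) (auto simp: q_eq)
  finally have main: "intL {0..\<tau>} (\<lambda>t. intL {0..L} (\<lambda>x. u t x * cnj (- \<phi>t t x + \<phi>x t x - intL {0..L} (\<lambda>y. cnj (g y) * \<phi> t y))))
     = (LINT x:{0..L}|lborel. v x * \<psi> 0 x) - (LINT x:{0..L}|lborel. v (x + \<tau>) * \<psi> \<tau> x)
      + (LINT t:{0..\<tau>}|lborel. v (L + t) * \<psi> t L) - (LINT x:{0..L}|lborel. h \<tau> x * \<psi> \<tau> x)"
    by simp
  have b1: "intL {0..L} (\<lambda>x. u \<tau> x * cnj (\<phi> \<tau> x)) = (LINT x:{0..L}|lborel. v (x + \<tau>) * \<psi> \<tau> x) + (LINT x:{0..L}|lborel. h \<tau> x * \<psi> \<tau> x)"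
  proof -
    have e: "indicat_real {0..L} x *\<^sub>R (u \<tau> x * cnj (\<phi> \<tau> x)) = v (x + \<tau>) * P (\<tau>, x) + h \<tau> x * P (\<tau>, x)" for x
      using \<tau>0 by (auto simp: u_def P_def \<psi>_def indicator_def algebra_simps)
    have "intL {0..L} (\<lambda>x. u \<tau> x * cnj (\<phi> \<tau> x)) = (LINT x|lborel. v (x + \<tau>) * P (\<tau>, x) + h \<tau> x * P (\<tau>, x))"
      unfolding e[symmetric] set_lebesgue_integral_def[symmetric]
      by (rule intL_eq_lborel) (unfold e, measurable)
    then show ?thesis
      using iv(2)[of \<tau> \<tau>] ih(2)[of \<tau> \<tau>] \<tau>0 by (simp add: set_lebesgue_integral_def Pind del: mult_scaleR_right)
  qed
  have b2: "intL {0..L} (\<lambda>x. u0 x * cnj (\<phi> 0 x)) = (LINT x:{0..L}|lborel. v x * \<psi> 0 x)"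
  proof -
    have e: "indicat_real {0..L} x *\<^sub>R (u0 x * cnj (\<phi> 0 x)) = v x * P (0, x)" for x
      using \<tau>0 by (auto simp: v_def U_def P_def \<psi>_def indicator_def)
    have "intL {0..L} (\<lambda>x. u0 x * cnj (\<phi> 0 x)) = (LINT x|lborel. v x * P (0, x))"
      unfolding e[symmetric] set_lebesgue_integral_def[symmetric]
      by (rule intL_eq_lborel) (unfold e, measurable)
    then show ?thesis
      using \<tau>0 by (simp add: set_lebesgue_integral_def Pind del: mult_scaleR_right)
  qed
  have b3: "intL {0..\<tau>} (\<lambda>t. U t * cnj (\<phi> t L)) = (LINT t:{0..\<tau>}|lborel. v (L + t) * \<psi> t L)"
  proof -
    have e: "indicat_real {0..\<tau>} t *\<^sub>R (U t * cnj (\<phi> t L)) = U t * P (t, L)"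
      "indicat_real {0..\<tau>} t *\<^sub>R (v (L + t) * \<psi> t L) = v (L + t) * P (t, L)" for t
      using L by (auto simp: P_def \<psi>_def indicator_def)
    have "intL {0..\<tau>} (\<lambda>t. U t * cnj (\<phi> t L)) = (LINT t|lborel. U t * P (t, L))"
      unfolding e[symmetric] set_lebesgue_integral_def[symmetric]
      by (rule intL_eq_lborel) (unfold e, measurable)
    also have "\<dots> = (LINT t|lborel. v (L + t) * P (t, L))"
    proof (rule integral_cong_AE)
      \<comment> \<open>At \<open>t = 0\<close> the value \<open>v L\<close> is the initial datum
        \<open>u0 L\<close> and not the control; for \<open>t > 0\<close> the two sides agree
        because \<open>u0\<close> vanishes beyond \<open>L\<close>.\<close>
      have "AE t in lborel. t \<noteq> (0::real)" by (rule AE_lborel_singleton)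
      then show "AE t in lborel. U t * P (t, L) = v (L + t) * P (t, L)"
      proof eventually_elim
        case (elim t)
        show ?case
        proof (cases "t < 0")
          case True
          then show ?thesis by (simp add: P_def indicator_def)
        next
          case False
          then show ?thesis using elim by (simp add: v_def u0(3))
        qed
      qed
    qed measurable
    finally show ?thesis by (simp add: set_lebesgue_integral_def e)
  qed
  show "intL {0..\<tau>} (\<lambda>t. intL {0..L} (\<lambda>x. u t x * cnj (- \<phi>t t x + \<phi>x t x - intL {0..L} (\<lambda>y. cnj (g y) * \<phi> t y))))
     + intL {0..L} (\<lambda>x. u \<tau> x * cnj (\<phi> \<tau> x)) - intL {0..L} (\<lambda>x. u0 x * cnj (\<phi> 0 x))
     - intL {0..\<tau>} (\<lambda>t. U t * cnj (\<phi> t L)) = 0"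
    unfolding main b1 b2 b3 by simp
qed

end

section \<open>Eigenfunctions of the adjoint and controllability\<close>

lemma intL_cong_AE:
  fixes f f' :: "real \<Rightarrow> complex"
  assumes "f \<in> borel_measurable (lebesgue_on S)" "f' \<in> borel_measurable (lebesgue_on S)"
    "AE x in lebesgue_on S. f x = f' x"
  shows "intL S f = intL S f'"
  unfolding intL_def by (rule integral_cong_AE[OF assms])

lemma L2_borel_measurable: "L2 S f \<Longrightarrow> f \<in> borel_measurable (lebesgue_on S)"
  by (simp add: L2_def)

text \<open>Solutions are built for Borel representatives of \<open>g\<close> and of the initial
  state. Both enter the weak formulation only under an integral over \<open>[0, L]\<close>, so it
  carries over to the original functions.\<close>

lemma weak_solution_cong:
  assumes ws: "weak_solution L g T u0 U u"
    and g: "L2 {0..L} g'" "AE x in lebesgue_on {0..L}. g' x = g x" "L2 {0..L} g"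
    and u0: "L2 {0..L} u0'" "AE x in lebesgue_on {0..L}. u0' x = u0 x" "L2 {0..L} u0"
  shows "weak_solution L g' T u0' U u"
  unfolding weak_solution_def
proof (intro conjI ballI allI impI, goal_cases)
  case 1
  show ?case using ws by (simp add: weak_solution_def)
next
  case (2 \<tau> \<phi> \<phi>t \<phi>x)
  then have C1: "C1_rect \<tau> L \<phi> \<phi>t \<phi>x" and \<tau>: "\<tau> \<in> {0..T}" by auto
  have "continuous_on {0..L} (\<phi> t)" if "t \<in> {0..\<tau>}" for t
    by (rule continuous_on_compose_Pair'[of "{0..\<tau>}" "{0..L}"])
       (use C1 that in \<open>auto simp: C1_rect_def intro!: continuous_intros\<close>)
  then have \<phi>m: "\<phi> t \<in> borel_measurable (lebesgue_on {0..L})" if "t \<in> {0..\<tau>}" for t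
    using that by (intro continuous_imp_measurable_on_sets_lebesgue) auto
  have mc: "(\<lambda>y. cnj (k y)) \<in> borel_measurable (lebesgue_on {0..L})"
    if "k \<in> borel_measurable (lebesgue_on {0..L})" for k
    using measurable_compose[OF that borel_measurable_cnj] by simp
  have gi: "intL {0..L} (\<lambda>y. cnj (g' y) * \<phi> t y) = intL {0..L} (\<lambda>y. cnj (g y) * \<phi> t y)" if "t \<in> {0..\<tau>}" for t
  proof (rule intL_cong_AE)
    show "AE y in lebesgue_on {0..L}. cnj (g' y) * \<phi> t y = cnj (g y) * \<phi> t y"
      using g(2) by eventually_elim simp
  qed (intro borel_measurable_times mc L2_borel_measurable g \<phi>m that)+
  have ui: "intL {0..L} (\<lambda>x. u0' x * cnj (\<phi> 0 x)) = intL {0..L} (\<lambda>x. u0 x * cnj (\<phi> 0 x))"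
  proof (rule intL_cong_AE)
    show "AE y in lebesgue_on {0..L}. u0' y * cnj (\<phi> 0 y) = u0 y * cnj (\<phi> 0 y)"
      using u0(2) by eventually_elim simp
  qed (use \<tau> 2 in \<open>intro borel_measurable_times mc L2_borel_measurable u0 \<phi>m; simp\<close>)+
  have oi: "intL {0..\<tau>} (\<lambda>t. intL {0..L} (\<lambda>x. u t x * cnj (- \<phi>t t x + \<phi>x t x - intL {0..L} (\<lambda>y. cnj (g' y) * \<phi> t y))))
      = intL {0..\<tau>} (\<lambda>t. intL {0..L} (\<lambda>x. u t x * cnj (- \<phi>t t x + \<phi>x t x - intL {0..L} (\<lambda>y. cnj (g y) * \<phi> t y))))"
    unfolding intL_def[of "{0..\<tau>}"]
    by (rule Bochner_Integration.integral_cong[OF refl]) (simp add: gi)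
  show ?case
    unfolding ui oi using ws 2 \<tau> unfolding weak_solution_def by blast
qed

section \<open>Necessity: eigenfunctions as test functions\<close>

lemma L2_continuous:
  assumes "continuous_on {a..b} f"
  shows "L2 {a..b} f"
  unfolding L2_def
proof
  show "f \<in> borel_measurable (lebesgue_on {a..b})"
    using assms by (intro continuous_imp_measurable_on_sets_lebesgue) auto
  show "integrable (lebesgue_on {a..b}) (\<lambda>x. (cmod (f x))\<^sup>2)"
    by (intro continuous_imp_integrable_real continuous_intros assms)
qed

text \<open>Bootstrapping: as a primitive \<open>z\<close> is continuous, so the eigenvalue equation
  makes its weak derivative almost everywhere equal to a continuous function, and the fundamental
  theorem of calculus applies. Test functions have to be \<open>C\<^sup>1\<close>.\<close>

lemma Astar_eigenfunction_C1:
  assumes L: "L > 0" and A: "Astar_eq L g z (\<lambda>x. lam * z x)"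
  defines "c \<equiv> intL {0..L} (\<lambda>y. cnj (g y) * z y)"
  shows "continuous_on {0..L} z"
    and "\<And>x. x \<in> {0..L} \<Longrightarrow> (z has_vector_derivative (c - lam * z x)) (at x within {0..L})"
proof -
  obtain z' where z0: "z 0 = 0" and z': "L2 {0..L} z'" and zi: "\<And>x. x \<in> {0..L} \<Longrightarrow> z x = intL {0..x} z'"
    and ae: "AE x in lebesgue_on {0..L}. - z' x + c = lam * z x"
    using A unfolding Astar_eq_def H1_with_deriv_def c_def by auto
  obtain r where r: "r \<in> borel_measurable borel" "AE x in lebesgue_on {0..L}. z' x = r x" "integrable lborel r"
    using L2_borel_representative[OF z'] by metis
  note [measurable] = r(1)
  have zr: "z x = (LINT y:{0..x}|lborel. r y)" if x: "x \<in> {0..L}" for x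
  proof -
    have sub: "{0..x} \<subseteq> {0..L}" using x by auto
    have "intL {0..x} z' = intL {0..x} r"
    proof (rule intL_cong_AE)
      show "z' \<in> borel_measurable (lebesgue_on {0..x})"
        by (rule measurable_restrict_mono[OF L2_borel_measurable[OF z'] sub])
      show "r \<in> borel_measurable (lebesgue_on {0..x})"
        by (intro measurable_restrict_space1 measurable_completion) simp
      have "AE y in lebesgue. y \<in> {0..L} \<longrightarrow> z' y = r y"
        using r(2) by (subst (asm) AE_restrict_space_iff) auto
      then have "AE y in lebesgue. y \<in> {0..x} \<longrightarrow> z' y = r y"
        by eventually_elim (use sub in auto)
      then show "AE y in lebesgue_on {0..x}. z' y = r y"
        by (subst AE_restrict_space_iff) auto
    qed
    also have "\<dots> = (LINT y:{0..x}|lborel. r y)" by (rule intL_eq_lborel) auto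
    finally show ?thesis using zi[OF x] by simp
  qed
  have "continuous_on UNIV (\<lambda>x. LINT y:{0..x}|lborel. r y)"
    using continuous_moving_integral[OF r(3), of "\<lambda>_ _. 1" 1 "\<lambda>_. 0" "\<lambda>x. x"] by simp
  then have "continuous_on {0..L} (\<lambda>x. LINT y:{0..x}|lborel. r y)"
    by (rule continuous_on_subset) simp
  then show cz: "continuous_on {0..L} z"
    by (rule continuous_on_eq) (simp add: zr)
  have cz': "continuous_on {0..L} (\<lambda>y. c - lam * z y)" by (intro continuous_intros cz)
  have "AE y in lebesgue_on {0..L}. r y = c - lam * z y"
    using r(2) ae by eventually_elim (simp add: algebra_simps)
  then have "AE y in lebesgue. y \<in> {0..L} \<longrightarrow> r y = c - lam * z y"
    by (subst (asm) AE_restrict_space_iff) auto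
  then have aer: "AE y in lborel. y \<in> {0..L} \<longrightarrow> r y = c - lam * z y"
    by (simp only: AE_completion_iff)
  have zint: "z x = integral {0..x} (\<lambda>y. c - lam * z y)" if x: "x \<in> {0..L}" for x
  proof -
    have cx: "continuous_on {0..x} (\<lambda>y. c - lam * z y)"
      by (rule continuous_on_subset[OF cz']) (use x in auto)
    have "z x = (LINT y:{0..x}|lborel. c - lam * z y)"
      unfolding zr[OF x] set_lebesgue_integral_def
    proof (rule integral_cong_AE)
      show "AE y in lborel. indicat_real {0..x} y *\<^sub>R r y = indicat_real {0..x} y *\<^sub>R (c - lam * z y)"
        using aer by eventually_elim (use x in \<open>auto simp: indicator_def\<close>)
      show "(\<lambda>y. indicat_real {0..x} y *\<^sub>R (c - lam * z y)) \<in> borel_measurable lborel"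
        using borel_measurable_continuous_on_indicator[OF _ cx] by simp
    qed simp
    also have "\<dots> = integral {0..x} (\<lambda>y. c - lam * z y)"
      by (intro set_borel_integral_eq_integral borel_integrable_atLeastAtMost' cx)
    finally show ?thesis .
  qed
  show "(z has_vector_derivative (c - lam * z x)) (at x within {0..L})" if x: "x \<in> {0..L}" for x
    by (rule has_vector_derivative_transform[OF x _ integral_has_vector_derivative[OF cz' x]])
       (simp add: zint)
qed

text \<open>Steer from \<open>0\<close> to \<open>z\<close> itself. Testing with
  \<open>\<phi>\<close> leaves only the pairing at time \<open>L\<close>, which is the nonzero
  factor \<open>cnj (e L)\<close> times the squared norm of \<open>z\<close>; hence \<open>z\<close>
  vanishes.\<close>

lemma controllable_imp_no_eigenfunction:
  assumes L: "L > 0" and ctrl: "exactly_controllable L g L"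
    and A: "Astar_eq L g z (\<lambda>x. lam * z x)" and zL: "z L = 0" and x: "x \<in> {0..L}"
  shows "z x = 0"
proof -
  define c where "c = intL {0..L} (\<lambda>y. cnj (g y) * z y)"
  have cz: "continuous_on {0..L} z"
    and dz: "\<And>x. x \<in> {0..L} \<Longrightarrow> (z has_vector_derivative (c - lam * z x)) (at x within {0..L})"
    using Astar_eigenfunction_C1[OF L A] unfolding c_def by auto
  have z0: "z 0 = 0" using A by (simp add: Astar_eq_def)
  define e where "e t = exp (- lam * complex_of_real t)" for t
  define \<phi> where "\<phi> t x = e t * z x" for t x
  define \<phi>t where "\<phi>t t x = - lam * e t * z x" for t x
  define \<phi>x where "\<phi>x t x = e t * (c - lam * z x)" for t x
  have ce: "continuous_on S e" for S unfolding e_def[abs_def] by (intro continuous_intros)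
  have de: "(e has_vector_derivative - lam * e t) (at t within S)" for t S
  proof -
    have "((\<lambda>w. exp (- lam * w)) has_field_derivative (- lam * exp (- lam * of_real t))) (at (complex_of_real t))"
      by (auto intro!: derivative_eq_intros)
    then show ?thesis
      unfolding e_def[abs_def] by (rule has_vector_derivative_real_field[THEN has_vector_derivative_at_within])
  qed
  have C1: "C1_rect L L \<phi> \<phi>t \<phi>x"
    unfolding C1_rect_def
  proof (intro conjI ballI)
    have cf: "continuous_on ({0..L} \<times> {0..L}) (\<lambda>p. e (fst p))"
      by (rule continuous_on_compose2[OF ce[of UNIV]]) (auto intro!: continuous_intros)
    have cs: "continuous_on ({0..L} \<times> {0..L}) (\<lambda>p. z (snd p))"
      by (rule continuous_on_compose2[OF cz]) (auto intro!: continuous_intros)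
    show "continuous_on ({0..L} \<times> {0..L}) (\<lambda>(t, x). \<phi> t x)" "continuous_on ({0..L} \<times> {0..L}) (\<lambda>(t, x). \<phi>t t x)"
      "continuous_on ({0..L} \<times> {0..L}) (\<lambda>(t, x). \<phi>x t x)"
      unfolding \<phi>_def \<phi>t_def \<phi>x_def case_prod_unfold by (intro continuous_intros cf cs)+
    fix t x assume "t \<in> {0..L}" "x \<in> {0..L}"
    show "((\<lambda>s. \<phi> s x) has_vector_derivative \<phi>t t x) (at t within {0..L})"
      unfolding \<phi>_def \<phi>t_def by (rule has_vector_derivative_mult_left[OF de])
    show "(\<phi> t has_vector_derivative \<phi>x t x) (at x within {0..L})"
      unfolding \<phi>_def \<phi>x_def by (rule has_vector_derivative_mult_right[OF dz]) fact
  qed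
  have bc: "\<forall>t\<in>{0..L}. \<phi> t 0 = 0" by (simp add: \<phi>_def z0)
  \<comment> \<open>\<open>\<phi>\<close> solves the adjoint evolution equation, so the double
    integral in the weak formulation vanishes whatever \<open>u\<close> is.\<close>
  have adj: "- \<phi>t t x + \<phi>x t x - intL {0..L} (\<lambda>y. cnj (g y) * \<phi> t y) = 0" for t x
  proof -
    have "intL {0..L} (\<lambda>y. cnj (g y) * \<phi> t y) = intL {0..L} (\<lambda>y. e t * (cnj (g y) * z y))"
      by (simp add: \<phi>_def mult_ac)
    also have "\<dots> = e t * c" unfolding intL_def c_def by (rule integral_mult_right_zero)
    finally show ?thesis by (simp add: \<phi>t_def \<phi>x_def algebra_simps)
  qed
  have "L2 {0..L} (\<lambda>_. 0)" "L2 {0..L} z" by (auto intro: L2_continuous cz)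
  then obtain U u where ws: "weak_solution L g L (\<lambda>_. 0) U u" and ae: "AE x in lebesgue_on {0..L}. u L x = z x"
    using ctrl unfolding exactly_controllable_def by blast
  have "intL {0..L} (\<lambda>t. intL {0..L} (\<lambda>x. u t x * cnj (- \<phi>t t x + \<phi>x t x - intL {0..L} (\<lambda>y. cnj (g y) * \<phi> t y))))
     + intL {0..L} (\<lambda>x. u L x * cnj (\<phi> L x)) - intL {0..L} (\<lambda>x. 0 * cnj (\<phi> 0 x))
     - intL {0..L} (\<lambda>t. U t * cnj (\<phi> t L)) = 0"
    using ws C1 bc L unfolding weak_solution_def by auto
  then have eq0: "intL {0..L} (\<lambda>x. u L x * cnj (\<phi> L x)) = 0"
    unfolding adj by (simp add: \<phi>_def zL intL_def)
  have zm: "z \<in> borel_measurable (lebesgue_on {0..L})"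
    using cz by (intro continuous_imp_measurable_on_sets_lebesgue) auto
  have zcm: "(\<lambda>x. cnj (e L) * cnj (z x)) \<in> borel_measurable (lebesgue_on {0..L})"
    by (intro borel_measurable_times borel_measurable_const measurable_compose[OF zm borel_measurable_cnj])
  have "intL {0..L} (\<lambda>x. u L x * cnj (\<phi> L x)) = intL {0..L} (\<lambda>x. cnj (e L) * of_real ((cmod (z x))^2))"
  proof (rule intL_cong_AE)
    have "u L \<in> borel_measurable (lebesgue_on {0..L})"
      using ws L by (intro L2_borel_measurable) (auto simp: weak_solution_def C0_L2_def)
    then show "(\<lambda>x. u L x * cnj (\<phi> L x)) \<in> borel_measurable (lebesgue_on {0..L})"
      using zcm by (simp add: \<phi>_def borel_measurable_times)
    show "(\<lambda>x. cnj (e L) * complex_of_real ((cmod (z x))^2)) \<in> borel_measurable (lebesgue_on {0..L})"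
      using zm by measurable
    show "AE x in lebesgue_on {0..L}. u L x * cnj (\<phi> L x) = cnj (e L) * complex_of_real ((cmod (z x))^2)"
      using ae
    proof eventually_elim
      case (elim x)
      then show ?case using complex_norm_square[of "z x"] by (simp add: \<phi>_def mult_ac)
    qed
  qed
  also have "\<dots> = cnj (e L) * of_real (integral\<^sup>L (lebesgue_on {0..L}) (\<lambda>x. (cmod (z x))^2))"
    unfolding intL_def integral_mult_right_zero by (simp only: integral_complex_of_real)
  finally have "integral\<^sup>L (lebesgue_on {0..L}) (\<lambda>x. (cmod (z x))^2) = 0"
    using eq0 by (simp add: e_def)
  moreover have "continuous_on {0..L} (\<lambda>x. (cmod (z x))^2)" by (intro continuous_intros cz)
  ultimately have "\<forall>x\<in>{0..L}. (cmod (z x))^2 = 0"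
    using L by (subst integralL_eq_0_iff[symmetric]) auto
  then have "(cmod (z x))^2 = 0" using x by blast
  then show ?thesis by simp
qed

section \<open>Sufficiency: a resonant mode produces an eigenfunction\<close>

lemma integral_fmode:
  assumes L: "L > 0" and k: "k \<noteq> 0" and x: "0 \<le> x"
  defines "\<mu> \<equiv> 2 * of_real pi * \<i> * of_int k / of_real L"
  shows "(LINT r:{0..x}|lborel. fmode L k r) = (fmode L k x - 1) / \<mu>"
proof -
  have \<mu>: "\<mu> \<noteq> 0" using L k by (simp add: \<mu>_def)
  have fm: "fmode L k = (\<lambda>t. exp (\<mu> * complex_of_real t))"
    by (auto simp: fmode_def cis_conv_exp \<mu>_def field_simps)
  have "(LINT r:{0..x}|lborel. fmode L k r) = fmode L k x / \<mu> - fmode L k 0 / \<mu>"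
    unfolding set_lebesgue_integral_def
  proof (rule integral_FTC_atLeastAtMost[OF x])
    fix t
    have "((\<lambda>w. exp (\<mu> * w) / \<mu>) has_field_derivative exp (\<mu> * of_real t)) (at (complex_of_real t))"
      using \<mu> by (auto intro!: derivative_eq_intros)
    then show "((\<lambda>t. fmode L k t / \<mu>) has_vector_derivative fmode L k t) (at t within {0..x})"
      unfolding fm by (rule has_vector_derivative_real_field[THEN has_vector_derivative_at_within])
  qed (use L in \<open>auto intro!: continuous_intros\<close>)
  then show ?thesis by (simp add: diff_divide_distrib)
qed

context duhamel begin

text \<open>Fubini on the triangle \<open>0 \<le> r \<le> y \<le> L\<close> moves the Fourier
  coefficient from the tail \<open>G\<close> to \<open>g\<close> itself, where the primitive of the
  mode, up to conjugation the future eigenfunction, appears.\<close>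

lemma integral_G_fmode:
  "(LINT r:{0..L}|lborel. G r * fmode L k r) = (LINT y|lborel. g y * (LINT r:{0..y}|lborel. fmode L k r))"
proof -
  define f where "f r y = (if 0 \<le> r \<and> r \<le> y \<and> y \<le> L then g y * fmode L k r else 0)" for r y
  have fm: "case_prod f \<in> borel_measurable (lborel \<Otimes>\<^sub>M lborel)"
    unfolding f_def[abs_def] by measurable
  have fi: "integrable lborel (f r)" for r
  proof (rule Bochner_Integration.integrable_bound[OF g])
    show "f r \<in> borel_measurable lborel" unfolding f_def by measurable
  qed (auto simp: f_def norm_mult intro!: AE_I2)
  have "(LINT y|lborel. cmod (f r y)) \<le> (LINT y|lborel. cmod (g y))" for r
    by (intro integral_mono integrable_norm fi g) (auto simp: f_def norm_mult)
  then have "(LINT r|lborel. LINT y|lborel. f r y) = (LINT y|lborel. LINT r|lborel. f r y)"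
    by (intro lborel_Fubini_bounded[of f 0 L, OF fm fi]) (auto simp: f_def)
  moreover have "(LINT y|lborel. f r y) = indicat_real {0..L} r *\<^sub>R (G r * fmode L k r)" for r
  proof -
    have "(LINT y|lborel. f r y) = (LINT y|lborel. (indicat_real {r..L} y *\<^sub>R g y) * (indicat_real {0..L} r *\<^sub>R fmode L k r))"
      by (intro Bochner_Integration.integral_cong refl) (auto simp: f_def indicator_def)
    then show ?thesis unfolding G_def set_lebesgue_integral_def integral_mult_left_zero by simp
  qed
  moreover have "(LINT r|lborel. f r y) = g y * (LINT r:{0..y}|lborel. fmode L k r)" for y
  proof -
    have "(LINT r|lborel. f r y) = (LINT r|lborel. g y * (indicat_real {0..y} r *\<^sub>R fmode L k r))"
      using g_supp[of y] by (intro Bochner_Integration.integral_cong refl) (auto simp: f_def indicator_def)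
    then show ?thesis unfolding set_lebesgue_integral_def integral_mult_right_zero .
  qed
  ultimately show ?thesis by (simp add: set_lebesgue_integral_def)
qed

end

text \<open>By \<open>integral_G_fmode\<close> the resonance value 1 says that
  \<open>cnj g * z\<close> has integral 1. Then \<open>A*\<close> sends \<open>z\<close> to
  \<open>1 - fmode L k\<close>, which is \<open>- \<mu> * z\<close>, so the eigenvalue is
  \<open>- \<mu>\<close>.\<close>

lemma resonance_eigenfunction:
  assumes L: "L > 0" and g': "L2 {0..L} g'" and ae: "AE x in lebesgue_on {0..L}. g' x = g x"
    and "duhamel L g m" and k: "k \<noteq> 0"
    and res: "(LINT r:{0..L}|lborel. duhamel.G L g r * fmode L (- k) r) = 1"
  obtains lam z x where "Astar_eq L g' z (\<lambda>x. lam * z x)" "z L = 0" "x \<in> {0..L}" "z x \<noteq> 0"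
proof -
  interpret duhamel L g m by fact
  define \<mu> where "\<mu> = 2 * of_real pi * \<i> * of_int k / complex_of_real L"
  have \<mu>: "\<mu> \<noteq> 0" using L k by (simp add: \<mu>_def)
  define z where "z x = (fmode L k x - 1) / \<mu>" for x
  have cz: "continuous_on S z" for S
    unfolding z_def[abs_def] using L \<mu> by (intro continuous_intros) auto
  have [measurable]: "z \<in> borel_measurable borel" by (rule borel_measurable_continuous_onI[OF cz])
  have cnj_mode: "cnj (fmode L (- k) r) = fmode L k r" for r
    by (simp add: fmode_def cis_cnj)
  have zi: "z x = (LINT r:{0..x}|lborel. fmode L k r)" if "0 \<le> x" for x
    using integral_fmode[OF L k that] by (simp add: z_def \<mu>_def)
  have zg: "intL {0..L} (\<lambda>y. cnj (g' y) * z y) = 1"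
  proof -
    have "intL {0..L} (\<lambda>y. cnj (g' y) * z y) = intL {0..L} (\<lambda>y. cnj (g y) * z y)"
    proof (rule intL_cong_AE)
      have [measurable]: "z \<in> borel_measurable (lebesgue_on {0..L})"
        using cz by (intro continuous_imp_measurable_on_sets_lebesgue) auto
      show "(\<lambda>y. cnj (g' y) * z y) \<in> borel_measurable (lebesgue_on {0..L})"
        using L2_borel_measurable[OF g'] by measurable
      show "(\<lambda>y. cnj (g y) * z y) \<in> borel_measurable (lebesgue_on {0..L})"
        by (intro measurable_restrict_space1 measurable_completion) simp
      show "AE y in lebesgue_on {0..L}. cnj (g' y) * z y = cnj (g y) * z y"
        using ae by eventually_elim simp
    qed
    also have "\<dots> = (LINT y:{0..L}|lborel. cnj (g y) * z y)"
      by (rule intL_eq_lborel) measurable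
    also have "\<dots> = (LINT y|lborel. cnj (g y * (LINT r:{0..y}|lborel. fmode L (- k) r)))"
      unfolding set_lebesgue_integral_def[of lborel "{0..L}"]
    proof (rule Bochner_Integration.integral_cong[OF refl])
      fix y
      have "cnj (LINT r:{0..y}|lborel. fmode L (- k) r) = (LINT r:{0..y}|lborel. fmode L k r)"
        unfolding set_lebesgue_integral_def
        by (simp add: cnj_mode flip: Bochner_Integration.integral_cnj)
      then show "indicat_real {0..L} y *\<^sub>R (cnj (g y) * z y) = cnj (g y * (LINT r:{0..y}|lborel. fmode L (- k) r))"
        using zi[of y] g_supp[of y] by (cases "y \<in> {0..L}") auto
    qed
    also have "\<dots> = cnj 1"
      unfolding Bochner_Integration.integral_cnj integral_G_fmode[symmetric] res ..
    finally show ?thesis by simp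
  qed
  have "Astar_eq L g' z (\<lambda>x. (- \<mu>) * z x)"
    unfolding Astar_eq_def H1_with_deriv_def
  proof (intro conjI exI[of _ "fmode L k"] ballI)
    show "z 0 = 0" by (simp add: z_def)
    show "L2 {0..L} (fmode L k)" by (rule L2_continuous) (use L in \<open>auto intro!: continuous_intros\<close>)
    show "z x = z 0 + intL {0..x} (fmode L k)" if "x \<in> {0..L}" for x
    proof -
      have "intL {0..x} (fmode L k) = (LINT r:{0..x}|lborel. fmode L k r)"
        by (rule intL_eq_lborel) auto
      then show ?thesis using zi[of x] that by (simp add: z_def)
    qed
    show "AE x in lebesgue_on {0..L}. - fmode L k x + intL {0..L} (\<lambda>y. cnj (g' y) * z y) = - \<mu> * z x"
      unfolding zg using \<mu> by (intro AE_I2) (simp add: z_def)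
  qed
  moreover have "z L = 0"
    using fmode_periodic[of L k 0] L by (simp add: z_def)
  \<comment> \<open>\<open>z\<close> cannot vanish identically, since its pairing with
    \<open>g'\<close> equals 1.\<close>
  moreover obtain x where "x \<in> {0..L}" "z x \<noteq> 0"
  proof (rule ccontr)
    assume "\<not> thesis"
    then have "\<And>x. x \<in> {0..L} \<Longrightarrow> z x = 0" using that by blast
    then have "intL {0..L} (\<lambda>y. cnj (g' y) * z y) = intL {0..L} (\<lambda>y. 0)"
      unfolding intL_def by (intro Bochner_Integration.integral_cong) auto
    then show False using zg by (simp add: intL_def)
  qed
  ultimately show thesis by (rule that)
qed

theorem theorem2:
  fixes L :: real and g :: "real \<Rightarrow> complex"
  assumes "L > 0" and "L2 {0..L} g"
  shows "exactly_controllable L g L \<longleftrightarrow>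
    (\<forall>lam::complex. \<forall>z. Astar_eq L g z (\<lambda>x. lam * z x) \<and> z L = 0 \<longrightarrow> (\<forall>x\<in>{0..L}. z x = 0))"
proof
  assume "exactly_controllable L g L"
  then show "\<forall>lam z. Astar_eq L g z (\<lambda>x. lam * z x) \<and> z L = 0 \<longrightarrow> (\<forall>x\<in>{0..L}. z x = 0)"
    by (auto intro: controllable_imp_no_eigenfunction[OF assms(1)])
next
  assume hautus: "\<forall>lam z. Astar_eq L g z (\<lambda>x. lam * z x) \<and> z L = 0 \<longrightarrow> (\<forall>x\<in>{0..L}. z x = 0)"
  obtain g0 where g0: "g0 \<in> borel_measurable borel" "\<And>x. x \<notin> {0..L} \<Longrightarrow> g0 x = 0"
    "AE x in lebesgue_on {0..L}. g x = g0 x" "integrable lborel (\<lambda>x. (cmod (g0 x))^2)" "integrable lborel g0"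
    by (rule L2_borel_representative[OF assms(2)]) (rule that)
  have g0L2: "L2 {0..L} g0"
    unfolding L2_iff_lborel[OF g0(1)] set_integrable_def using g0(4) by (intro integrable_mult_indicator) auto
  \<comment> \<open>\<open>G\<close> depends only on \<open>L\<close> and \<open>g0\<close>. The
    zero function stands in for \<open>m\<close>, which is constructed later, so that facts about
    \<open>G\<close> are available now.\<close>
  have D: "duhamel L g0 (\<lambda>_. 0)"
    by unfold_locales (use assms g0 in auto)
  interpret D: duhamel L g0 "\<lambda>_. 0" by (rule D)
  have nonres: "(LINT r:{0..L}|lborel. D.G r * fmode L (- k) r) \<noteq> 1" if "k \<noteq> 0" for k
    using resonance_eigenfunction[OF assms(1,2) g0(3) D that] hautus by metis
  show "exactly_controllable L g L"
    unfolding exactly_controllable_def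
  proof (intro allI impI, elim conjE)
    fix u0 u1 assume u0: "L2 {0..L} u0" and u1: "L2 {0..L} u1"
    obtain v0 where v0: "v0 \<in> borel_measurable borel" "\<And>x. x \<notin> {0..L} \<Longrightarrow> v0 x = 0"
      "AE x in lebesgue_on {0..L}. u0 x = v0 x" "integrable lborel (\<lambda>x. (cmod (v0 x))^2)" "integrable lborel v0"
      by (rule L2_borel_representative[OF u0]) (rule that)
    obtain v1 where v1: "v1 \<in> borel_measurable borel" "\<And>x. x \<notin> {0..L} \<Longrightarrow> v1 x = 0"
      "AE x in lebesgue_on {0..L}. u1 x = v1 x" "integrable lborel (\<lambda>x. (cmod (v1 x))^2)" "integrable lborel v1"
      by (rule L2_borel_representative[OF u1]) (rule that)
    have v0L2: "L2 {0..L} v0"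
      unfolding L2_iff_lborel[OF v0(1)] set_integrable_def using v0(4) by (intro integrable_mult_indicator) auto
    define f where "f t = (LINT y:{t..L}|lborel. v0 y) + (LINT y:{0..t}|lborel. v1 y)" for t
    have fc: "continuous_on UNIV f"
      unfolding f_def
      using continuous_moving_integral[OF v0(5), of "\<lambda>_ _. 1" 1 "\<lambda>t. t" "\<lambda>_. L"]
        continuous_moving_integral[OF v1(5), of "\<lambda>_ _. 1" 1 "\<lambda>_. 0" "\<lambda>t. t"]
      by (intro continuous_on_add) simp_all
    have fb: "bounded (range f)"
    proof -
      have b: "cmod (LINT y:{a..b}|lborel. w y) \<le> (LINT y|lborel. cmod (w y))"
        if "integrable lborel w" for a b and w :: "real \<Rightarrow> complex"
        unfolding set_lebesgue_integral_def
        by (rule Bochner_Integration.integral_norm_bound_integral)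
           (use that in \<open>auto intro: integrable_mult_indicator split: split_indicator\<close>)
      have "cmod (f t) \<le> (LINT y|lborel. cmod (v0 y)) + (LINT y|lborel. cmod (v1 y))" for t
        unfolding f_def by (intro norm_triangle_mono b v0 v1)
      then show ?thesis unfolding bounded_iff by blast
    qed
    obtain m where m: "continuous_on UNIV m" "bounded (range m)"
      and meq: "\<And>t. t \<in> {0..L} \<Longrightarrow> m t = f t + pconv L (\<lambda>r. indicat_real {0..<L} r *\<^sub>R D.G r) m t
        - pconv L (\<lambda>r. indicat_real {0..<L} r *\<^sub>R D.G r) m 0"
      by (rule circulant_equation_solvable[OF assms(1) D.continuous_G fc fb nonres]) (assumption, rule that)
    interpret C: controlled L g0 m v0 v1
      by unfold_locales (use assms g0 v0 v1 m meq in \<open>auto simp: f_def\<close>)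
    have "L2 {0..L} C.U"
      unfolding L2_iff_lborel[OF C.U_meas] set_integrable_def
      using C.U_integrable(2) by (intro integrable_mult_indicator) auto
    moreover have "weak_solution L g L u0 C.U C.u"
      by (rule weak_solution_cong[OF C.weak_solution_u assms(2) g0(3) g0L2 u0 v0(3) v0L2])
    moreover have "AE x in lebesgue_on {0..L}. C.u L x = u1 x"
    proof -
      \<comment> \<open>The target may be missed at \<open>x = 0\<close>, which the half-open
        support of \<open>U\<close> excludes.\<close>
      have "AE x in lebesgue. x \<noteq> (0::real)"
        unfolding AE_completion_iff by (rule AE_lborel_singleton)
      moreover have "AE x in lebesgue. x \<in> {0..L} \<longrightarrow> u1 x = v1 x"
        using v1(3) by (subst (asm) AE_restrict_space_iff) auto
      ultimately have "AE x in lebesgue. x \<in> {0..L} \<longrightarrow> C.u L x = u1 x"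
        by eventually_elim (auto simp: C.u_def C.v_def C.U_def v0(2))
      then show ?thesis by (subst AE_restrict_space_iff) auto
    qed
    ultimately show "\<exists>U u. L2 {0..L} U \<and> weak_solution L g L u0 U u \<and> (AE x in lebesgue_on {0..L}. u L x = u1 x)"
      by blast
  qed
qed

end
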